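(* Let $\mathcal{X}$ be a countable domain and $\mathcal{H}\subseteq\{0,1\}^{\mathcal{X}}$ a concept class. Then $\mathcal{H}$ is approximately differentially private PAC learnable if and only if its clique dimension $\mathtt{CD}(\mathcal{H})$ is finite.
   Context: Datasets, consistency, $\mathcal{H}$-realizability, and the contradiction graph: a dataset of size $m$ is $S=((x_1,y_1),\dots,(x_m,y_m))\in(\mathcal{X}\times\{0,1\})^m$; $h$ is consistent with $S$ if $h(x_i)=y_i$ for all $i$; $S$ is $\mathcal{H}$-realizable if some $h\in\mathcal{H}$ is consistent with it; $G_m(\mathcal{H})$ has as vertices the $\mathcal{H}$-realizable datasets of size $m$, with $S,S'$ adjacent iff there is $x$ with $(x,0)$ appearing in $S$ and $(x,1)$ appearing in $S'$. $\omega_m$ is the clique number of $G_m(\mathcal{H})$ and the clique dimension is $\mathtt{CD}(\mathcal{H})=\sup\{m:\omega_m=2^m\}\in\mathbb{N}\cup\{\infty\}$. PAC learning: for a distribution $\mathcal{D}$ on $\mathcal{X}\times\{0,1\}$, $L_{\mathcal{D}}(h)=\Pr_{(x,y)\sim\mathcal{D}}[h(x)\ne y]$; $\mathcal{D}$ is realizable if $\inf_{h\in\mathcal{H}}L_{\mathcal{D}}(h)=0$. A (possibly randomized) algorithm $\mathcal{A}$ is an $(m,\alpha,\beta)$-learner if for every realizable $\mathcal{D}$, $\Pr_{S\sim\mathcal{D}^m}[L_{\mathcal{D}}(\mathcal{A}(S))>\alpha]<\beta$. $\mathcal{A}$ is $(\epsilon,\delta)$-differentially private if for all datasets $S,S'$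 of the same size differing in a single example and every event $E$, $\Pr[\mathcal{A}(S)\in E]\le e^{\epsilon}\Pr[\mathcal{A}(S')\in E]+\delta$. $\mathcal{H}$ is approximately DP PAC learnable if there are $\alpha(m),\beta(m)\to0$ and an algorithm that for every $m$ is an $(m,\alpha(m),\beta(m))$-learner and is $(\epsilon(m),\delta(m))$-differentially private on inputs of size $m$, with $\epsilon(m)=O(1)$ a numerical constant and $\delta(m)=m^{-\omega(1)}$. *)

theory Defs
  imports "HOL-Probability.Probability"
begin

type_synonym 'a dataset = "('a \<times> bool) list"

definition consistent :: "('a \<Rightarrow> bool) \<Rightarrow> 'a dataset \<Rightarrow> bool" where
  "consistent h S \<longleftrightarrow> (\<forall>i<length S. h (fst (S ! i)) = snd (S ! i))"

definition realizable_data :: "('a \<Rightarrow> bool) set \<Rightarrow> 'a dataset \<Rightarrow> bool" where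
  "realizable_data H S \<longleftrightarrow> (\<exists>h\<in>H. consistent h S)"

definition cg_vertices :: "('a \<Rightarrow> bool) set \<Rightarrow> nat \<Rightarrow> 'a dataset set" where
  "cg_vertices H m = {S. length S = m \<and> realizable_data H S}"

definition contradicts :: "'a dataset \<Rightarrow> 'a dataset \<Rightarrow> bool" where
  "contradicts S S' \<longleftrightarrow> (\<exists>x. (x, False) \<in> set S \<and> (x, True) \<in> set S')"

definition cg_adjacent :: "'a dataset \<Rightarrow> 'a dataset \<Rightarrow> bool" where
  "cg_adjacent S S' \<longleftrightarrow> contradicts S S' \<or> contradicts S' S"

definition is_cg_clique :: "('a \<Rightarrow> bool) set \<Rightarrow> nat \<Rightarrow> 'a dataset set \<Rightarrow> bool" where
  "is_cg_clique H m C \<longleftrightarrow> C \<subseteq> cg_vertices H m \<and>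
     (\<forall>S\<in>C. \<forall>S'\<in>C. S \<noteq> S' \<longrightarrow> cg_adjacent S S')"

definition clique_number :: "('a \<Rightarrow> bool) set \<Rightarrow> nat \<Rightarrow> enat" where
  "clique_number H m = Sup ((\<lambda>C. enat (card C)) ` {C. finite C \<and> is_cg_clique H m C})"

definition clique_dimension :: "('a \<Rightarrow> bool) set \<Rightarrow> enat" where
  "clique_dimension H = Sup (enat ` {m. clique_number H m = enat (2 ^ m)})"

definition hyp_space :: "('a \<Rightarrow> bool) measure" where
  "hyp_space = PiM UNIV (\<lambda>_. count_space UNIV)"

definition loss :: "('a \<times> bool) pmf \<Rightarrow> ('a \<Rightarrow> bool) \<Rightarrow> real" where
  "loss D h = measure_pmf.prob D {(x, y). h x \<noteq> y}"

(* inf_{h in H} L_D(h) = 0  (L_D \<ge> 0; for empty H the infimum is +\<infinity>) *)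
definition realizable_dist :: "('a \<Rightarrow> bool) set \<Rightarrow> ('a \<times> bool) pmf \<Rightarrow> bool" where
  "realizable_dist H D \<longleftrightarrow> (\<forall>e>0. \<exists>h\<in>H. loss D h < e)"

definition randomized_alg :: "('a dataset \<Rightarrow> ('a \<Rightarrow> bool) measure) \<Rightarrow> bool" where
  "randomized_alg A \<longleftrightarrow> (\<forall>S. A S \<in> space (prob_algebra hyp_space))"

definition is_learner ::
  "('a \<Rightarrow> bool) set \<Rightarrow> ('a dataset \<Rightarrow> ('a \<Rightarrow> bool) measure) \<Rightarrow> nat \<Rightarrow> real \<Rightarrow> real \<Rightarrow> bool" where
  "is_learner H A m \<alpha> \<beta> \<longleftrightarrow>
     (\<forall>D. realizable_dist H D \<longrightarrow>
        measure_pmf.expectation (replicate_pmf m D)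
          (\<lambda>S. measure (A S) {h. loss D h > \<alpha>}) < \<beta>)"

definition differ_in_one :: "'a dataset \<Rightarrow> 'a dataset \<Rightarrow> bool" where
  "differ_in_one S S' \<longleftrightarrow> length S = length S' \<and>
     card {i. i < length S \<and> S ! i \<noteq> S' ! i} = 1"

definition is_dp_on_size ::
  "('a dataset \<Rightarrow> ('a \<Rightarrow> bool) measure) \<Rightarrow> nat \<Rightarrow> real \<Rightarrow> real \<Rightarrow> bool" where
  "is_dp_on_size A m \<epsilon> \<delta> \<longleftrightarrow>
     (\<forall>S S' E. length S = m \<longrightarrow> differ_in_one S S' \<longrightarrow> E \<in> sets hyp_space \<longrightarrow>
        measure (A S) E \<le> exp \<epsilon> * measure (A S') E + \<delta>)"

definition superpoly_small :: "(nat \<Rightarrow> real) \<Rightarrow> bool" where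
  "superpoly_small \<delta> \<longleftrightarrow> (\<forall>k::real. \<forall>\<^sub>F m in sequentially. \<delta> m \<le> real m powr (- k))"

definition approx_DP_PAC_learnable :: "('a \<Rightarrow> bool) set \<Rightarrow> bool" where
  "approx_DP_PAC_learnable H \<longleftrightarrow>
     (\<exists>\<alpha> \<beta> :: nat \<Rightarrow> real. \<alpha> \<longlonglongrightarrow> 0 \<and> \<beta> \<longlonglongrightarrow> 0 \<and>
       (\<exists>A \<epsilon> \<delta>. randomized_alg A \<and> superpoly_small \<delta> \<and>
          (\<forall>m. is_learner H A m (\<alpha> m) (\<beta> m) \<and> is_dp_on_size A m \<epsilon> (\<delta> m))))"

end

(*
  Both sides are equivalent to a bound on the depth of the mistake trees of H (finite Littlestone
  dimension).

  Cliques: the leaves of a mistake tree of depth m form a clique of 2^m datasets.  Conversely, by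
  double counting, some point splits a clique of N datasets of size m into two parts of size at
  least about N / (2m), so N >= (2m + 2)^d forces a mistake tree of depth d.

  Learnable implies bounded depth: deep mistake trees contain long thresholds.  By Ramsey's theorem
  the prediction of the learner at a point depends, up to a small error, only on the rank of the
  point among the n sample points, and accuracy makes it jump by 1/(2n) between two consecutive
  ranks.  Moving the one sample point that causes the jump over 2^s places gives 2^s distributions
  that are pairwise indistinguishable by privacy, hence, up to delta, of bounded density with respect
  to each other, but separated like thresholds with margin about 1/n.  The perceptron mistake bound
  makes this impossible for large s.

  Bounded depth implies learnable: in a random tournament two hypotheses of the optimal online
  algorithm that disagree at x are confronted with (x, coin), and the dataset of the one that errs
  survives.  Datasets with only correct coins have at most d mistakes, so at some level the
  same hypothesis must appear with a probability bounded below independently of the sample size.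
  A private vote among many independent blocks finds this hypothesis, while every
  hypothesis of large error is unlikely to receive even two votes.
*)
theory Submission
  imports Defs "HOL-Real_Asymp.Real_Asymp" "HOL-Library.Ramsey"
begin

section \<open>Mistake trees and thresholds\<close>

text \<open>Realizability only says that the infimum of the loss is 0, so \<open>H\<close> need not
  contain a hypothesis that is correct on the whole support. Countability of the domain repairs
  this: a limit concept, all of whose finite restrictions are realizable, serves as the target. The
  contradiction to learnability is found at one single sample size \<open>m\<close>. The examples
  are drawn with replacement from \<open>n\<close> points, with \<open>n\<close> about
  \<open>16 * m^2\<close>: only then is the chance of drawing the moved point twice, at most
  \<open>(m / n)^2\<close>, small against the jump \<open>1 / (2 * n)\<close>. The same comparison
  fixes how small \<delta> has to be. All later parameters depend on \<open>n\<close> and may be as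
  large as Ramsey's theorem asks, because trees of every depth are at hand. For the learner,
  \<open>m\<close> examples make \<open>q^2\<close> blocks of \<open>q^2\<close> examples, with
  \<open>q\<close> about \<open>m^(1/4)\<close>. The vote can then afford \<delta> equal to
  \<open>2 ^ (-q)\<close>, which is superpolynomially small, because the stable hypothesis collects
  a number of votes of order \<open>q^2\<close>.\<close>

lemma consistent_iff: "consistent h S \<longleftrightarrow> (\<forall>(x,y)\<in>set S. h x = y)"
  by (simp add: consistent_def all_set_conv_all_nth split_beta)

lemma consistentD: "consistent h S \<Longrightarrow> (x, y) \<in> set S \<Longrightarrow> h x = y"
  by (auto simp: consistent_iff)

lemma realizable_data_mono:
  "realizable_data H S \<Longrightarrow> set S' \<subseteq> set S \<Longrightarrow> realizable_data H S'"
  unfolding realizable_data_def consistent_iff by blast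

text \<open>The dataset \<open>S\<close> stands for the version space of the hypotheses consistent
  with it, so \<open>H\<close> stays fixed along a branch. Confining the queries to \<open>Q\<close>
  allows a tree to be thinned out to points on which a chosen hypothesis is constant.\<close>

fun mistake_tree :: "('a \<Rightarrow> bool) set \<Rightarrow> 'a set \<Rightarrow> nat \<Rightarrow> 'a dataset \<Rightarrow> bool" where
  "mistake_tree H Q 0 S = realizable_data H S"
| "mistake_tree H Q (Suc d) S = (\<exists>x\<in>Q. \<forall>y. mistake_tree H Q d ((x, y) # S))"

lemma mistake_tree_mono: "mistake_tree H Q d S \<Longrightarrow> set S' \<subseteq> set S \<Longrightarrow> mistake_tree H Q d S'"
proof (induction d arbitrary: S S')
  case 0 then show ?case using realizable_data_mono by auto
next
  case (Suc d)
  then obtain x where "x \<in> Q" "\<forall>y. mistake_tree H Q d ((x, y) # S)" by auto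
  moreover have "set ((x, y) # S') \<subseteq> set ((x, y) # S)" for y using Suc.prems by auto
  ultimately show ?case using Suc.IH by (metis mistake_tree.simps(2))
qed

lemma mistake_tree_SucD: "mistake_tree H Q (Suc d) S \<Longrightarrow> mistake_tree H Q d S"
  by (auto intro: mistake_tree_mono[where S = "(_, _) # S"])

lemma mistake_tree_antimono: "mistake_tree H Q d S \<Longrightarrow> e \<le> d \<Longrightarrow> mistake_tree H Q e S"
  by (induction d) (auto simp: le_Suc_eq simp del: mistake_tree.simps dest: mistake_tree_SucD)

lemma mistake_tree_realizable: "mistake_tree H Q d S \<Longrightarrow> realizable_data H S"
  using mistake_tree_antimono[of H Q d S 0] by simp

text \<open>Ramsey property of trees. A root in \<open>P\<close> joins two trees inside
  \<open>P\<close>, one per label; if instead one of its branches yields the tree outside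
  \<open>P\<close>, that tree already serves for \<open>S\<close>, since the extra label can be
  forgotten.\<close>

lemma mistake_tree_split:
  "mistake_tree H Q (a + b) S \<Longrightarrow> mistake_tree H (Q \<inter> P) a S \<or> mistake_tree H (Q - P) b S"
proof (induction "a + b" arbitrary: a b S)
  case 0 then show ?case by simp
next
  case (Suc n)
  from Suc(2,3) obtain x where x: "x \<in> Q" "\<And>y. mistake_tree H Q n ((x, y) # S)"
    by (metis mistake_tree.simps(2))
  show ?case
  proof (cases "a = 0 \<or> b = 0")
    case True
    then show ?thesis using mistake_tree_realizable[OF Suc.prems] by auto
  next
    case False
    then obtain a' b' where ab: "a = Suc a'" "b = Suc b'" by (metis not0_implies_Suc)
    show ?thesis
    proof (cases "x \<in> P")
      case True
      have "mistake_tree H (Q \<inter> P) a' ((x, y) # S) \<or> mistake_tree H (Q - P) b ((x, y) # S)" for y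
        by (rule Suc(1)) (use Suc(2) ab x(2) in auto)
      then show ?thesis
        using True x(1) ab mistake_tree_mono[of H "Q - P" b "(x, _) # S" S]
        by (metis Int_iff set_subset_Cons mistake_tree.simps(2))
    next
      case False
      have "mistake_tree H (Q \<inter> P) a ((x, y) # S) \<or> mistake_tree H (Q - P) b' ((x, y) # S)" for y
        by (rule Suc(1)) (use Suc(2) ab x(2) in auto)
      then show ?thesis
        using False x(1) ab mistake_tree_mono[of H "Q \<inter> P" a "(x, _) # S" S]
        by (metis Diff_iff set_subset_Cons mistake_tree.simps(2))
    qed
  qed
qed

text \<open>Each rung halves the tree, splitting the points by the value of a hypothesis, and spends
  one level on the new point. In closed form \<open>2 ^ (k + 1) - 2\<close>.\<close>

fun ladder_depth :: "nat \<Rightarrow> nat" where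
  "ladder_depth 0 = 0"
| "ladder_depth (Suc k) = 2 * ladder_depth k + 2"

text \<open>Some \<open>h0\<close> consistent with \<open>S\<close> has a constant value
  \<open>y0\<close> on the queries of one half of the tree. The root \<open>x0\<close> of that half
  receives the label opposite to \<open>y0\<close>, so all later hypotheses differ from
  \<open>h0\<close> at \<open>x0\<close>, while \<open>h0\<close> has value \<open>y0\<close> on all
  later points.\<close>

lemma mistake_tree_ladder:
  assumes "mistake_tree H Q (ladder_depth k) S"
  shows "\<exists>x h y. (\<forall>i<k. x i \<in> Q \<and> h i \<in> H \<and> consistent (h i) S) \<and>
           (\<forall>i<k. \<forall>j<k. h i (x j) = (if i \<le> j then y i else \<not> y j))"
  using assms
proof (induction k arbitrary: Q S)
  case 0 then show ?case by simp
next
  case (Suc k)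
  obtain h0 where h0: "h0 \<in> H" "consistent h0 S"
    using mistake_tree_realizable[OF Suc.prems] by (auto simp: realizable_data_def)
  let ?P = "{x. h0 x}"
  have "mistake_tree H (Q \<inter> ?P) (Suc (ladder_depth k)) S \<or> mistake_tree H (Q - ?P) (Suc (ladder_depth k)) S"
    by (rule mistake_tree_split) (use Suc.prems in \<open>simp del: mistake_tree.simps add: mult_2\<close>)
  then obtain y0 where y0: "mistake_tree H (Q \<inter> {x. h0 x = y0}) (Suc (ladder_depth k)) S"
  proof
    assume "mistake_tree H (Q \<inter> ?P) (Suc (ladder_depth k)) S"
    then show ?thesis using that[of True] by simp
  next
    assume "mistake_tree H (Q - ?P) (Suc (ladder_depth k)) S"
    moreover have "Q - ?P = Q \<inter> {x. h0 x = False}" by auto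
    ultimately show ?thesis using that[of False] by simp
  qed
  let ?Q = "Q \<inter> {x. h0 x = y0}"
  from y0 obtain x0 where x0: "x0 \<in> ?Q" "mistake_tree H ?Q (ladder_depth k) ((x0, \<not> y0) # S)"
    by auto
  from Suc.IH[OF this(2)] obtain x h y where IH:
    "\<And>i. i < k \<Longrightarrow> x i \<in> ?Q \<and> h i \<in> H \<and> consistent (h i) ((x0, \<not> y0) # S)"
    "\<And>i j. i < k \<Longrightarrow> j < k \<Longrightarrow> h i (x j) = (if i \<le> j then y i else \<not> y j)"
    by blast
  have c: "consistent (h i) S" "h i x0 = (\<not> y0)" if "i < k" for i
    using IH(1)[OF that] by (auto simp: consistent_iff)
  define x' h' y' where "x' = case_nat x0 x" and "h' = case_nat h0 h" and "y' = case_nat y0 y"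
  have "\<forall>i<Suc k. x' i \<in> Q \<and> h' i \<in> H \<and> consistent (h' i) S"
    using IH(1) c h0 x0(1) by (auto simp: x'_def h'_def less_Suc_eq_0_disj)
  moreover have "\<forall>i<Suc k. \<forall>j<Suc k. h' i (x' j) = (if i \<le> j then y' i else \<not> y' j)"
    using IH c x0(1) by (auto simp: x'_def h'_def y'_def less_Suc_eq_0_disj)
  ultimately show ?case by blast
qed

lemma pigeonhole_bool:
  fixes y :: "nat \<Rightarrow> bool"
  shows "\<exists>b r. strict_mono_on {..<k} r \<and> (\<forall>i<k. r i < 2 * k \<and> y (r i) = b)"
proof -
  have "card ({i. i < 2 * k \<and> y i} \<union> {i. i < 2 * k \<and> \<not> y i}) =
      card {i. i < 2 * k \<and> y i} + card {i. i < 2 * k \<and> \<not> y i}"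
    by (rule card_Un_disjoint) auto
  moreover have "{i. i < 2 * k \<and> y i} \<union> {i. i < 2 * k \<and> \<not> y i} = {..<2 * k}" by auto
  ultimately have "card {i. i < 2 * k \<and> y i} + card {i. i < 2 * k \<and> \<not> y i} = 2 * k" by simp
  then have "card {i. i < 2 * k \<and> y i} \<ge> k \<or> card {i. i < 2 * k \<and> \<not> y i} \<ge> k" by linarith
  then obtain b where b: "k \<le> card {i. i < 2 * k \<and> y i = b}"
    using that[of True] that[of False] by auto
  define xs where "xs = sorted_list_of_set {i. i < 2 * k \<and> y i = b}"
  have xs: "sorted_wrt (<) xs" "set xs = {i. i < 2 * k \<and> y i = b}" "k \<le> length xs"
    using b by (auto simp: xs_def)
  have "strict_mono_on {..<k} (\<lambda>i. xs ! i)"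
    using xs(1,3) by (auto simp: strict_mono_on_def sorted_wrt_iff_nth_less)
  moreover have "xs ! i < 2 * k \<and> y (xs ! i) = b" if "i < k" for i
    using nth_mem[of i xs] that xs by auto
  ultimately show ?thesis by blast
qed

text \<open>Among \<open>2 * k\<close> rungs, \<open>k\<close> share the same value
  \<open>y i\<close>; on these the ladder is a threshold matrix, in the given or in the reversed
  order.\<close>

lemma mistake_tree_thresholds:
  assumes "mistake_tree H UNIV (ladder_depth (2 * k)) []"
  shows "\<exists>x. \<forall>c. 1 \<le> c \<and> c < k \<longrightarrow> (\<exists>h\<in>H. \<forall>j<k. h (x j) \<longleftrightarrow> c \<le> j)"
proof -
  from mistake_tree_ladder[OF assms] obtain x h y where L:
    "\<And>i. i < 2 * k \<Longrightarrow> h i \<in> H"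
    "\<And>i j. i < 2 * k \<Longrightarrow> j < 2 * k \<Longrightarrow> h i (x j) = (if i \<le> j then y i else \<not> y j)"
    by blast
  obtain b r where r: "strict_mono_on {..<k} r" "\<And>i. i < k \<Longrightarrow> r i < 2 * k \<and> y (r i) = b"
    using pigeonhole_bool[of k y] by blast
  have le: "r i \<le> r j \<longleftrightarrow> i \<le> j" if "i < k" "j < k" for i j
    using strict_mono_on_less_eq[OF r(1)] that by auto
  have M: "h (r i) (x (r j)) = (if i \<le> j then b else \<not> b)" if "i < k" "j < k" for i j
    using that L(2)[of "r i" "r j"] r(2)[of i] r(2)[of j] le[of i j] by auto
  show ?thesis
  proof (cases b)
    case True
    show ?thesis
      by (rule exI[of _ "x \<circ> r"], intro allI impI, rule_tac x = "h (r c)" in bexI)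
         (use M L(1) r(2) True in auto)
  next
    case False
    show ?thesis
    \<comment> \<open>Here \<open>h (r i)\<close> is true exactly at the indices below
      \<open>i\<close>, so the points are reversed; the cut \<open>c\<close> is made by index
      \<open>k - c\<close>, which is below \<open>k\<close> because
      \<open>1 \<le> c\<close>.\<close>
    proof (rule exI[of _ "\<lambda>j. x (r (k - 1 - j))"], intro allI impI)
      fix c assume c: "1 \<le> c \<and> c < k"
      have "h (r (k - c)) (x (r (k - 1 - j))) \<longleftrightarrow> c \<le> j" if "j < k" for j
        using M[of "k - c" "k - 1 - j"] c that False by auto
      then show "\<exists>h\<in>H. \<forall>j<k. h (x (r (k - 1 - j))) \<longleftrightarrow> c \<le> j"
        using c L(1)[of "r (k - c)"] r(2)[of "k - c"] by (intro bexI[of _ "h (r (k - c))"]) auto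
    qed
  qed
qed

section \<open>Cliques of the contradiction graph\<close>

lemma adjacent_iff:
  "cg_adjacent S T \<longleftrightarrow> (\<exists>x y. (x, y) \<in> set S \<and> (x, \<not> y) \<in> set T)"
  unfolding cg_adjacent_def contradicts_def by (metis (full_types))

lemma card_extensions:
  assumes "finite X" "P \<subseteq> D" "D \<subseteq> X"
  shows "card {A. A \<subseteq> X \<and> A \<inter> D = P} = 2 ^ (card X - card D)"
proof -
  have "{A. A \<subseteq> X \<and> A \<inter> D = P} = (\<lambda>B. B \<union> P) ` Pow (X - D)"
  proof (intro set_eqI iffI)
    fix A assume "A \<in> {A. A \<subseteq> X \<and> A \<inter> D = P}"
    then have "A = (A - D) \<union> P" "A - D \<in> Pow (X - D)" using assms by auto
    then show "A \<in> (\<lambda>B. B \<union> P) ` Pow (X - D)" by blast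
  qed (use assms in auto)
  moreover have "inj_on (\<lambda>B. B \<union> P) (Pow (X - D))"
    using assms by (intro inj_onI) blast
  ultimately show ?thesis
    using assms by (simp add: card_image card_Pow card_Diff_subset finite_subset)
qed

text \<open>A realizable dataset of size \<open>m\<close> is consistent with at least a fraction \<open>2\<^sup>-\<^sup>m\<close> of all
  labellings of a finite set of points, and adjacent datasets share no consistent labelling.\<close>

lemma clique_card_le:
  assumes "is_cg_clique H m C" "finite C"
  shows "card C \<le> 2 ^ m"
proof -
  define X where "X = (\<Union>S\<in>C. fst ` set S)"
  define ext where "ext S = {A. A \<subseteq> X \<and> A \<inter> fst ` set S = {x. (x, True) \<in> set S}}" for S
  have fX: "finite X" unfolding X_def using assms(2) by auto
  have len: "length S = m" and real: "realizable_data H S" if "S \<in> C" for S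
    using assms(1) that by (auto simp: is_cg_clique_def cg_vertices_def)
  have Xm: "2 ^ card X \<le> card (ext S) * 2 ^ m" if S: "S \<in> C" for S
  proof -
    have "{x. (x, True) \<in> set S} \<subseteq> fst ` set S" by force
    moreover have D: "fst ` set S \<subseteq> X" using S X_def by auto
    ultimately have e: "card (ext S) = 2 ^ (card X - card (fst ` set S))"
      unfolding ext_def using fX by (intro card_extensions)
    have "card (fst ` set S) \<le> m"
      using card_image_le[of "set S" fst] card_length[of S] len[OF S] by simp
    then have "card X \<le> (card X - card (fst ` set S)) + m" by simp
    then have "(2::nat) ^ card X \<le> 2 ^ ((card X - card (fst ` set S)) + m)"
      by (intro power_increasing) auto
    then show "2 ^ card X \<le> card (ext S) * 2 ^ m" by (simp add: e power_add)
  qed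
  have disj: "ext S \<inter> ext T = {}" if ST: "S \<in> C" "T \<in> C" "S \<noteq> T" for S T
  proof -
    obtain x y where xy: "(x, y) \<in> set S" "(x, \<not> y) \<in> set T"
      using assms(1) ST unfolding is_cg_clique_def adjacent_iff by blast
    have rep: "x \<in> A \<longleftrightarrow> y" if "A \<in> ext S" "(x, y) \<in> set S" "S \<in> C" for A S y
    proof -
      have "x \<in> fst ` set S" using that(2) by force
      moreover have "(x, True) \<in> set S \<longleftrightarrow> y"
        using that(2) real[OF that(3)] unfolding realizable_data_def by (metis (full_types) consistentD)
      ultimately show ?thesis using that(1) unfolding ext_def by blast
    qed
    show ?thesis using rep[OF _ xy(1)] rep[OF _ xy(2)] that by blast
  qed
  have "card C * 2 ^ card X \<le> (\<Sum>S\<in>C. card (ext S) * 2 ^ m)"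
    using sum_mono[of C "\<lambda>_. 2 ^ card X" "\<lambda>S. card (ext S) * 2 ^ m"] Xm by simp
  also have "\<dots> = card (\<Union>S\<in>C. ext S) * 2 ^ m"
    using assms(2) disj fX
    by (subst card_UN_disjoint) (auto simp: sum_distrib_right ext_def)
  also have "card (\<Union>S\<in>C. ext S) \<le> card (Pow X)"
    by (intro card_mono) (auto simp: ext_def fX)
  finally show ?thesis using fX by (simp add: card_Pow mult.commute)
qed

text \<open>Two leaves contradict each other at the node where their branches part. \<open>T\<close>
  records only the queries below the current node, and \<open>S\<close> the path leading
  there.\<close>

lemma mistake_tree_clique:
  assumes "mistake_tree H UNIV d S"
  shows "\<exists>C. finite C \<and> card C = 2 ^ d \<and>
    (\<forall>T\<in>C. length T = d \<and> realizable_data H (T @ S)) \<and>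
    (\<forall>T\<in>C. \<forall>T'\<in>C. T \<noteq> T' \<longrightarrow> cg_adjacent T T')"
  using assms
proof (induction d arbitrary: S)
  case 0
  then show ?case by (intro exI[of _ "{[]}"]) auto
next
  case (Suc d)
  from Suc.prems obtain x where "\<And>y. mistake_tree H UNIV d ((x, y) # S)" by auto
  from Suc.IH[OF this] obtain C where C: "\<And>y. finite (C y) \<and> card (C y) = 2 ^ d \<and>
    (\<forall>T\<in>C y. length T = d \<and> realizable_data H (T @ (x, y) # S)) \<and>
    (\<forall>T\<in>C y. \<forall>T'\<in>C y. T \<noteq> T' \<longrightarrow> cg_adjacent T T')"
    by metis
  let ?E = "\<lambda>y. (#) (x, y) ` C y"
  have card: "card (?E y) = 2 ^ d" for y
    using C[of y] by (simp add: card_image)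
  have c: "card (?E True \<union> ?E False) = 2 ^ Suc d"
    using C by (subst card_Un_disjoint) (auto simp: card)
  have l: "length T = Suc d \<and> realizable_data H (T @ S)" if "T \<in> ?E y" for T y
    using that C[of y] by (auto elim!: realizable_data_mono)
  have a: "cg_adjacent T T'" if TT: "T \<in> ?E y" "T' \<in> ?E y'" "T \<noteq> T'" for T T' y y'
  proof (cases "y = y'")
    case True
    then obtain U U' where U: "T = (x, y) # U" "T' = (x, y) # U'" "U \<in> C y" "U' \<in> C y" "U \<noteq> U'"
      using TT by auto
    then have "cg_adjacent U U'" using C[of y] by blast
    then show ?thesis using U(1,2) unfolding adjacent_iff by (metis list.set_intros(2))
  next
    case False
    then have "y' = (\<not> y)" by auto
    then have "(x, y) \<in> set T" "(x, \<not> y) \<in> set T'" using TT by auto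
    then show ?thesis unfolding adjacent_iff by blast
  qed
  show ?case
  proof (intro exI[of _ "?E True \<union> ?E False"] conjI ballI impI)
    show "finite (?E True \<union> ?E False)" using C by simp
    fix T assume "T \<in> ?E True \<union> ?E False"
    then obtain y where T: "T \<in> ?E y" by blast
    then show "length T = Suc d" "realizable_data H (T @ S)" using l by blast+
    fix T' assume "T' \<in> ?E True \<union> ?E False" "T \<noteq> T'"
    then show "cg_adjacent T T'" using a[OF T] by blast
  qed (fact c)
qed

text \<open>Each of the \<open>N (N - 1)\<close> ordered pairs of a clique is separated at one of the points, and the
  \<open>N\<close> datasets mention at most \<open>N m\<close> points in total, so some point splits the clique into two
  parts of size at least \<open>(N - 1) / (2 m)\<close> each.\<close>

lemma clique_split:
  assumes fin: "finite C" and adj: "\<And>S T. S \<in> C \<Longrightarrow> T \<in> C \<Longrightarrow> S \<noteq> T \<Longrightarrow> cg_adjacent S T"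
    and len: "\<And>S. S \<in> C \<Longrightarrow> length S = m" and M: "2 * m * M + 1 < card C"
  shows "\<exists>x. \<forall>y. M < card {S\<in>C. (x, y) \<in> set S}"
proof (rule ccontr)
  assume neg: "\<not> ?thesis"
  define X where "X = (\<Union>S\<in>C. fst ` set S)"
  define D where "D x y = {S\<in>C. (x, y) \<in> set S}" for x y
  have fX: "finite X" unfolding X_def using fin by auto
  have fD: "finite (D x y)" for x y unfolding D_def using fin by auto
  \<comment> \<open>One of the two parts has at most \<open>M\<close> members, which turns the
    product into a linear bound that can be summed over the points.\<close>
  have small: "card (D x True) * card (D x False) \<le> M * (card (D x True) + card (D x False))" for x
  proof -
    have "\<exists>y. card (D x y) \<le> M" using neg by (auto simp: D_def not_less)
    then have "card (D x True) \<le> M \<or> card (D x False) \<le> M" by (metis (full_types))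
    then show ?thesis
    proof
      assume "card (D x True) \<le> M"
      then have "card (D x True) * card (D x False) \<le> M * card (D x False)" by (rule mult_le_mono1)
      then show ?thesis unfolding distrib_left by (rule trans_le_add2)
    next
      assume "card (D x False) \<le> M"
      then have "card (D x True) * card (D x False) \<le> M * card (D x True)"
        by (metis mult_le_mono2 mult.commute)
      then show ?thesis unfolding distrib_left by (rule trans_le_add1)
    qed
  qed
  have total: "(\<Sum>x\<in>X. card (D x True) + card (D x False)) \<le> m * card C"
  proof -
    have "(\<Sum>x\<in>X. card (D x True) + card (D x False)) = (\<Sum>x\<in>X. \<Sum>y\<in>UNIV. card (D x y))"
      by (simp add: UNIV_bool add.commute)
    also have "\<dots> = (\<Sum>p\<in>X \<times> UNIV. card (D (fst p) (snd p)))"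
      by (simp add: sum.cartesian_product split_beta)
    also have "\<dots> = card (SIGMA p:X \<times> (UNIV::bool set). D (fst p) (snd p))"
      using fX fD by (subst card_SigmaI) auto
    also have "\<dots> \<le> card (SIGMA S:C. set S)"
      by (rule card_inj_on_le[where f = "\<lambda>(p, S). (S, p)"])
         (auto simp: D_def fin intro!: inj_onI)
    also have "\<dots> = (\<Sum>S\<in>C. card (set S))" using fin by (subst card_SigmaI) auto
    also have "\<dots> \<le> (\<Sum>S\<in>C. m)" by (intro sum_mono) (metis card_length len)
    finally show ?thesis by (simp add: mult.commute)
  qed
  have "card C * card C - card C = card (C \<times> C - (\<lambda>S. (S, S)) ` C)"
    using fin by (subst card_Diff_subset) (auto simp: card_image inj_on_def card_cartesian_product)
  also have "\<dots> \<le> card (\<Union>x\<in>X. D x True \<times> D x False \<union> D x False \<times> D x True)"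
  proof (rule card_mono)
    show "C \<times> C - (\<lambda>S. (S, S)) ` C \<subseteq> (\<Union>x\<in>X. D x True \<times> D x False \<union> D x False \<times> D x True)"
    proof
      fix p assume "p \<in> C \<times> C - (\<lambda>S. (S, S)) ` C"
      then obtain S T where p: "p = (S, T)" "S \<in> C" "T \<in> C" "S \<noteq> T" by auto
      from adj[OF this(2-4)] obtain x y where xy: "(x, y) \<in> set S" "(x, \<not> y) \<in> set T"
        by (auto simp: adjacent_iff)
      then have "x \<in> X" using p(2) by (force simp: X_def)
      then show "p \<in> (\<Union>x\<in>X. D x True \<times> D x False \<union> D x False \<times> D x True)"
        using p xy by (cases y) (auto simp: D_def)
    qed
  qed (use fX fD in auto)
  also have "\<dots> \<le> (\<Sum>x\<in>X. card (D x True \<times> D x False \<union> D x False \<times> D x True))"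
    using fX by (rule card_UN_le)
  also have "\<dots> \<le> (\<Sum>x\<in>X. 2 * M * (card (D x True) + card (D x False)))"
  proof (intro sum_mono)
    fix x
    have "card (D x True \<times> D x False \<union> D x False \<times> D x True)
        \<le> card (D x True \<times> D x False) + card (D x False \<times> D x True)" by (rule card_Un_le)
    then show "card (D x True \<times> D x False \<union> D x False \<times> D x True)
        \<le> 2 * M * (card (D x True) + card (D x False))"
      using small[of x] by (simp add: card_cartesian_product mult.commute)
  qed
  also have "\<dots> \<le> 2 * M * (m * card C)"
    unfolding sum_distrib_left[symmetric] using total by (rule mult_le_mono2)
  finally have "card C * card C \<le> (2 * m * M + 1) * card C" by (simp add: algebra_simps)
  then have "card C \<le> 2 * m * M + 1" using M unfolding mult_le_cancel2 by linarith
  then show False using M by simp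
qed

text \<open>\<open>R\<close> is the path queried so far, contained in every dataset of
  \<open>C\<close>. Both parts of a split are again cliques of datasets of size \<open>m\<close>, so
  the same factor \<open>2 * m + 2\<close> is lost at every level.\<close>

lemma clique_mistake_tree:
  assumes "finite C" "\<And>S T. S \<in> C \<Longrightarrow> T \<in> C \<Longrightarrow> S \<noteq> T \<Longrightarrow> cg_adjacent S T"
    and "\<And>S. S \<in> C \<Longrightarrow> length S = m \<and> realizable_data H S \<and> set R \<subseteq> set S"
    and "(2 * m + 2) ^ d \<le> card C"
  shows "mistake_tree H UNIV d R"
  using assms
proof (induction d arbitrary: C R)
  case 0
  then have "C \<noteq> {}" by auto
  then show ?case using 0(3) realizable_data_mono by fastforce
next
  case (Suc d)
  \<comment> \<open>More than \<open>M\<close> members means at least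
    \<open>(2 * m + 2) ^ d\<close>, the size needed for the next level.\<close>
  define M where "M = (2 * m + 2) ^ d - 1"
  have p: "M + 1 = (2 * m + 2) ^ d" by (simp add: M_def)
  have "2 * m * M + 1 < (2 * m + 2) * (M + 1)" by (simp add: algebra_simps)
  also have "\<dots> \<le> card C" using Suc.prems(4) p by simp
  finally have M: "2 * m * M + 1 < card C" .
  obtain x where x: "\<And>y. M < card {S\<in>C. (x, y) \<in> set S}"
    using clique_split[OF Suc.prems(1,2) _ M] Suc.prems(3) by blast
  have "mistake_tree H UNIV d ((x, y) # R)" for y
  proof (rule Suc.IH[of "{S\<in>C. (x, y) \<in> set S}"])
    show "(2 * m + 2) ^ d \<le> card {S \<in> C. (x, y) \<in> set S}" using x[of y] p by linarith
  qed (use Suc.prems in auto)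
  then show ?case by auto
qed

section \<open>The clique dimension in terms of mistake trees\<close>

lemma clique_number_eqI:
  assumes "mistake_tree H UNIV m []"
  shows "clique_number H m = enat (2 ^ m)"
proof (rule antisym)
  show "clique_number H m \<le> enat (2 ^ m)"
    unfolding clique_number_def by (rule SUP_least) (auto intro: clique_card_le)
  obtain C where C: "finite C \<and> card C = 2 ^ m \<and> (\<forall>T\<in>C. length T = m \<and> realizable_data H (T @ [])) \<and>
    (\<forall>T\<in>C. \<forall>T'\<in>C. T \<noteq> T' \<longrightarrow> cg_adjacent T T')"
    using mistake_tree_clique[OF assms] ..
  then have "is_cg_clique H m C"
    unfolding is_cg_clique_def cg_vertices_def append_Nil2 by blast
  then show "enat (2 ^ m) \<le> clique_number H m"
    unfolding clique_number_def using C by (intro SUP_upper2[of C]) auto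
qed

lemma exp_dominates: "\<exists>M. \<forall>m\<ge>M. (2 * m + 2) ^ d \<le> (2::nat) ^ m"
proof -
  have "eventually (\<lambda>m::nat. real d * ln (2 * real m + 2) \<le> real m * ln 2) sequentially"
    by real_asymp
  then obtain M where M: "\<And>m. m \<ge> M \<Longrightarrow> real d * ln (2 * real m + 2) \<le> real m * ln 2"
    unfolding eventually_sequentially by blast
  have "(2 * m + 2) ^ d \<le> (2::nat) ^ m" if "m \<ge> M" for m
  proof -
    have "ln ((2 * real m + 2) ^ d) \<le> ln (2 ^ m)"
      using M[OF that] by (simp add: ln_realpow)
    then have "(2 * real m + 2) ^ d \<le> 2 ^ m" by (subst (asm) ln_le_cancel_iff) auto
    then have "real ((2 * m + 2) ^ d) \<le> real (2 ^ m)" by (simp add: add.commute)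
    then show ?thesis by (simp only: of_nat_le_iff)
  qed
  then show ?thesis by blast
qed

lemma clique_dimension_finite_iff:
  "clique_dimension H < \<infinity> \<longleftrightarrow> (\<exists>d. \<not> mistake_tree H UNIV d [])"
proof -
  let ?A = "{m. clique_number H m = enat (2 ^ m)}"
  show ?thesis
  proof
    assume "clique_dimension H < \<infinity>"
    then obtain n where n: "clique_dimension H = enat n" by auto
    have "Suc n \<notin> ?A"
    proof
      assume "Suc n \<in> ?A"
      then have "enat (Suc n) \<le> clique_dimension H"
        unfolding clique_dimension_def by (intro Sup_upper imageI)
      then show False using n by simp
    qed
    then show "\<exists>d. \<not> mistake_tree H UNIV d []" using clique_number_eqI by blast
  next
    assume "\<exists>d. \<not> mistake_tree H UNIV d []"
    then obtain d where d: "\<not> mistake_tree H UNIV d []" by blast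
    obtain M where M: "\<And>m. m \<ge> M \<Longrightarrow> (2 * m + 2) ^ d \<le> (2::nat) ^ m" using exp_dominates by blast
    have "m < M" if "m \<in> ?A" for m
    proof (rule ccontr)
      assume "\<not> m < M"
      \<comment> \<open>A supremum above \<open>2 ^ m - 1\<close> provides a finite clique with at
        least \<open>2 ^ m\<close> members.\<close>
      have "enat (2 ^ m - 1) < clique_number H m" using that by simp
      then obtain C where C: "finite C" "is_cg_clique H m C" "2 ^ m - 1 < card C"
        unfolding clique_number_def less_SUP_iff by auto
      have "mistake_tree H UNIV d []"
      proof (rule clique_mistake_tree[of C m])
        show "(2 * m + 2) ^ d \<le> card C" using M[of m] C(3) \<open>\<not> m < M\<close> by linarith
      qed (use C in \<open>auto simp: is_cg_clique_def cg_vertices_def\<close>)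
      then show False using d by simp
    qed
    then have "clique_dimension H \<le> enat M"
      unfolding clique_dimension_def by (intro SUP_least) (simp add: less_imp_le)
    then show "clique_dimension H < \<infinity>" by (rule le_less_trans) simp
  qed
qed

section \<open>The perceptron argument and homogeneous sets\<close>

text \<open>Jensen's inequality, read off from the nonnegativity of the variance of
  \<open>\<bar>u\<bar>\<close>.\<close>

lemma weighted_abs_le_sqrt:
  fixes p u :: "'w \<Rightarrow> real"
  assumes "finite \<Omega>" "\<And>w. w \<in> \<Omega> \<Longrightarrow> 0 \<le> p w" "sum p \<Omega> = 1"
  shows "(\<Sum>w\<in>\<Omega>. p w * \<bar>u w\<bar>)\<^sup>2 \<le> (\<Sum>w\<in>\<Omega>. p w * (u w)\<^sup>2)"
proof -
  let ?a = "\<Sum>w\<in>\<Omega>. p w * \<bar>u w\<bar>"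
  have "0 \<le> (\<Sum>w\<in>\<Omega>. p w * (\<bar>u w\<bar> - ?a)\<^sup>2)"
    using assms(2) by (intro sum_nonneg) auto
  also have "\<dots> = (\<Sum>w\<in>\<Omega>. p w * (u w)\<^sup>2 - 2 * ?a * (p w * \<bar>u w\<bar>) + ?a\<^sup>2 * p w)"
    by (intro sum.cong refl) (simp add: power2_diff algebra_simps)
  also have "\<dots> = (\<Sum>w\<in>\<Omega>. p w * (u w)\<^sup>2) - 2 * ?a * ?a + ?a\<^sup>2 * sum p \<Omega>"
    by (simp add: sum.distrib sum_subtractf sum_distrib_left)
  finally show ?thesis using assms(3) by (simp add: power2_eq_square)
qed

text \<open>Perceptron: \<open>\<nu> j\<close> separates the vectors \<open>v x\<close> with margin \<open>\<gamma>\<close> according to whether \<open>x \<le> j\<close>.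
  Binary search with the sign chosen against the current vector \<open>u\<close> keeps \<open>u\<close> short while
  every step gains \<open>\<gamma>\<close> in the direction of the surviving \<open>\<nu> j\<close>.\<close>

lemma perceptron_search:
  fixes p :: "'w \<Rightarrow> real" and v \<nu> :: "nat \<Rightarrow> 'w \<Rightarrow> real"
  assumes "finite \<Omega>" and p: "\<And>w. w \<in> \<Omega> \<Longrightarrow> 0 \<le> p w" "sum p \<Omega> = 1"
    and v: "\<And>x w. \<bar>v x w\<bar> \<le> 1"
    and lo: "\<And>j x. x \<le> j \<Longrightarrow> 0 < x \<Longrightarrow> j < K \<Longrightarrow> (\<Sum>w\<in>\<Omega>. \<nu> j w * v x w) \<le> - \<gamma>"
    and hi: "\<And>j x. j < x \<Longrightarrow> x < K \<Longrightarrow> \<gamma> \<le> (\<Sum>w\<in>\<Omega>. \<nu> j w * v x w)"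
    and "a + 2 ^ t \<le> K" and "(\<Sum>w\<in>\<Omega>. p w * (u w)\<^sup>2) \<le> B"
  shows "\<exists>j u'. j \<in> {a..<a + 2 ^ t} \<and> (\<Sum>w\<in>\<Omega>. p w * (u' w)\<^sup>2) \<le> B + real t \<and>
    (\<Sum>w\<in>\<Omega>. \<nu> j w * u w) + real t * \<gamma> \<le> (\<Sum>w\<in>\<Omega>. \<nu> j w * u' w)"
  using assms(7,8)
proof (induction t arbitrary: a u B)
  case 0
  then show ?case by (intro exI[of _ a] exI[of _ u]) auto
next
  case (Suc t)
  let ?x = "a + 2 ^ t"
  have xpos: "0 < ?x" by simp
  \<comment> \<open>The sign \<open>s\<close> opposes the correlation, so the cross term does not
    increase the squared norm and a step costs at most 1.\<close>
  have step: "(\<Sum>w\<in>\<Omega>. p w * (u w + s * v ?x w)\<^sup>2) \<le> B + 1"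
    if "s * (\<Sum>w\<in>\<Omega>. p w * u w * v ?x w) \<le> 0" "\<bar>s\<bar> = 1" for s
  proof -
    have "(\<Sum>w\<in>\<Omega>. p w * (u w + s * v ?x w)\<^sup>2)
        = (\<Sum>w\<in>\<Omega>. p w * (u w)\<^sup>2 + 2 * (s * (p w * u w * v ?x w)) + p w * (s * v ?x w)\<^sup>2)"
      by (intro sum.cong refl) (simp add: power2_sum algebra_simps)
    also have "\<dots> = (\<Sum>w\<in>\<Omega>. p w * (u w)\<^sup>2) + 2 * (s * (\<Sum>w\<in>\<Omega>. p w * u w * v ?x w))
        + (\<Sum>w\<in>\<Omega>. p w * (s * v ?x w)\<^sup>2)"
      by (simp add: sum.distrib sum_distrib_left)
    also have "(\<Sum>w\<in>\<Omega>. p w * (s * v ?x w)\<^sup>2) \<le> (\<Sum>w\<in>\<Omega>. p w * 1)"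
      using p(1) v that(2)
      by (intro sum_mono mult_left_mono) (auto simp: abs_square_le_1 abs_mult)
    finally show ?thesis using that(1) Suc.prems(2) p(2) by simp
  qed
  have gain: "(\<Sum>w\<in>\<Omega>. \<nu> j w * (u w + s * v ?x w)) = (\<Sum>w\<in>\<Omega>. \<nu> j w * u w) + s * (\<Sum>w\<in>\<Omega>. \<nu> j w * v ?x w)" for j s
    by (simp add: algebra_simps sum.distrib sum_distrib_left)
  show ?case
  proof (cases "(\<Sum>w\<in>\<Omega>. p w * u w * v ?x w) \<le> 0")
    case True
    obtain j u' where j: "j \<in> {a..<a + 2 ^ t}" "(\<Sum>w\<in>\<Omega>. p w * (u' w)\<^sup>2) \<le> B + 1 + real t"
      "(\<Sum>w\<in>\<Omega>. \<nu> j w * (u w + 1 * v ?x w)) + real t * \<gamma> \<le> (\<Sum>w\<in>\<Omega>. \<nu> j w * u' w)"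
      using Suc.IH[OF _ step[of 1], of a] True Suc.prems(1) by auto
    moreover have "\<gamma> \<le> (\<Sum>w\<in>\<Omega>. \<nu> j w * v ?x w)"
      using j(1) Suc.prems(1) by (intro hi) (auto intro: less_le_trans)
    ultimately show ?thesis unfolding gain
      by (intro exI[of _ j] exI[of _ u']) (auto simp: algebra_simps)
  next
    case False
    obtain j u' where j: "j \<in> {?x..<?x + 2 ^ t}" "(\<Sum>w\<in>\<Omega>. p w * (u' w)\<^sup>2) \<le> B + 1 + real t"
      "(\<Sum>w\<in>\<Omega>. \<nu> j w * (u w + -1 * v ?x w)) + real t * \<gamma> \<le> (\<Sum>w\<in>\<Omega>. \<nu> j w * u' w)"
      using Suc.IH[OF _ step[of "-1"], of ?x] False Suc.prems(1) by (auto simp: ac_simps mult_2)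
    moreover have "(\<Sum>w\<in>\<Omega>. \<nu> j w * v ?x w) \<le> - \<gamma>"
      using j(1) Suc.prems(1) xpos by (intro lo) auto
    ultimately show ?thesis unfolding gain
      by (intro exI[of _ j] exI[of _ u']) (auto simp: algebra_simps)
  qed
qed

text \<open>Cutting \<open>\<mu> j\<close> down to density \<open>E\<close> relative to
  \<open>\<mu> 0\<close> removes mass at most \<delta>, hence margin at most \<delta>. After
  \<open>s\<close> perceptron steps the cut measure has gained
  \<open>s * (\<Delta> - \<delta>)\<close> on a vector whose norm in \<open>L^2\<close> of
  \<open>\<mu> 0\<close> is at most \<open>sqrt s\<close>; by domination and Jensen's inequality the
  gain is at most \<open>E * sqrt s\<close>.\<close>

lemma indistinguishable_thresholds_bound:
  fixes \<mu> :: "nat \<Rightarrow> 'w \<Rightarrow> real" and \<phi> :: "nat \<Rightarrow> 'w set"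
  assumes fin: "finite \<Omega>"
    and pos: "\<And>j w. j < 2 ^ s \<Longrightarrow> w \<in> \<Omega> \<Longrightarrow> 0 \<le> \<mu> j w"
    and one: "\<And>j. j < 2 ^ s \<Longrightarrow> sum (\<mu> j) \<Omega> = 1"
    and dp: "\<And>j F. j < 2 ^ s \<Longrightarrow> F \<subseteq> \<Omega> \<Longrightarrow> sum (\<mu> j) F \<le> E * sum (\<mu> 0) F + \<delta>"
    and E: "0 \<le> E" and r: "0 \<le> r" "r \<le> 1" and \<delta>: "\<delta> \<le> \<Delta>"
    and lo: "\<And>j x. x \<le> j \<Longrightarrow> 0 < x \<Longrightarrow> j < 2 ^ s \<Longrightarrow> sum (\<mu> j) (\<Omega> \<inter> \<phi> x) \<le> r - \<Delta>"
    and hi: "\<And>j x. j < x \<Longrightarrow> x < 2 ^ s \<Longrightarrow> r + \<Delta> \<le> sum (\<mu> j) (\<Omega> \<inter> \<phi> x)"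
  shows "real s * (\<Delta> - \<delta>)\<^sup>2 \<le> E\<^sup>2"
proof -
  \<comment> \<open>Subtracting the common level \<open>r\<close> turns probabilities below and
    above \<open>r\<close> into margins of opposite sign.\<close>
  define v where "v x w = indicator (\<phi> x) w - r" for x w
  define \<nu> where "\<nu> j w = min (\<mu> j w) (E * \<mu> 0 w)" for j w
  have vb: "\<bar>v x w\<bar> \<le> 1" for x w using r by (auto simp: v_def indicator_def)
  have cut: "(\<Sum>w\<in>\<Omega>. \<mu> j w - \<nu> j w) \<le> \<delta>" if j: "j < 2 ^ s" for j
  proof -
    \<comment> \<open>On this set privacy bounds exactly the mass that the truncation
      removes.\<close>
    let ?F = "{w\<in>\<Omega>. E * \<mu> 0 w < \<mu> j w}"
    have "(\<Sum>w\<in>\<Omega>. \<mu> j w - \<nu> j w) = (\<Sum>w\<in>?F. \<mu> j w - E * \<mu> 0 w)"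
      using fin by (intro sum.mono_neutral_cong_right) (auto simp: \<nu>_def min_def)
    also have "\<dots> \<le> \<delta>" using dp[OF j, of ?F] by (simp add: sum_subtractf sum_distrib_left)
    finally show ?thesis .
  qed
  have mv: "(\<Sum>w\<in>\<Omega>. \<mu> j w * v x w) = sum (\<mu> j) (\<Omega> \<inter> \<phi> x) - r" if j: "j < 2 ^ s" for j x
  proof -
    have "(\<Sum>w\<in>\<Omega>. \<mu> j w * v x w) = (\<Sum>w\<in>\<Omega>. \<mu> j w * indicator (\<phi> x) w) - r * sum (\<mu> j) \<Omega>"
      by (simp add: v_def algebra_simps sum_subtractf sum_distrib_left)
    then show ?thesis using fin one[OF j] by (simp add: sum.inter_restrict indicator_def of_bool_def if_distrib cong: if_cong)
  qed
  have close: "\<bar>(\<Sum>w\<in>\<Omega>. \<mu> j w * v x w) - (\<Sum>w\<in>\<Omega>. \<nu> j w * v x w)\<bar> \<le> \<delta>" if j: "j < 2 ^ s" for j x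
  proof -
    have "\<bar>(\<Sum>w\<in>\<Omega>. \<mu> j w * v x w) - (\<Sum>w\<in>\<Omega>. \<nu> j w * v x w)\<bar> = \<bar>\<Sum>w\<in>\<Omega>. (\<mu> j w - \<nu> j w) * v x w\<bar>"
      by (simp add: sum_subtractf algebra_simps)
    also have "\<dots> \<le> (\<Sum>w\<in>\<Omega>. \<bar>(\<mu> j w - \<nu> j w) * v x w\<bar>)" by (rule sum_abs)
    also have "\<dots> \<le> (\<Sum>w\<in>\<Omega>. \<mu> j w - \<nu> j w)"
    proof (intro sum_mono)
      fix w
      have "0 \<le> \<mu> j w - \<nu> j w" by (simp add: \<nu>_def)
      then show "\<bar>(\<mu> j w - \<nu> j w) * v x w\<bar> \<le> \<mu> j w - \<nu> j w"
        using vb[of x w] by (simp add: abs_mult mult_left_le)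
    qed
    finally show ?thesis using cut[OF j] by simp
  qed
  have "\<exists>j u'. j \<in> {0..<0 + 2 ^ s} \<and> (\<Sum>w\<in>\<Omega>. \<mu> 0 w * (u' w)\<^sup>2) \<le> 0 + real s \<and>
    (\<Sum>w\<in>\<Omega>. \<nu> j w * 0) + real s * (\<Delta> - \<delta>) \<le> (\<Sum>w\<in>\<Omega>. \<nu> j w * u' w)"
  proof (rule perceptron_search[where v = v and K = "2 ^ s"])
    fix j x :: nat assume *: "x \<le> j" "0 < x" "j < 2 ^ s"
    show "(\<Sum>w\<in>\<Omega>. \<nu> j w * v x w) \<le> - (\<Delta> - \<delta>)"
      using close[of j x] lo[OF *] mv[of j x] * by linarith
  next
    fix j x :: nat assume *: "j < x" "x < 2 ^ s"
    show "\<Delta> - \<delta> \<le> (\<Sum>w\<in>\<Omega>. \<nu> j w * v x w)"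
      using close[of j x] hi[OF *] mv[of j x] * by linarith
  qed (use fin pos one vb in auto)
  then obtain j u where j: "j < 2 ^ s" and u: "(\<Sum>w\<in>\<Omega>. \<mu> 0 w * (u w)\<^sup>2) \<le> real s"
    "real s * (\<Delta> - \<delta>) \<le> (\<Sum>w\<in>\<Omega>. \<nu> j w * u w)" by auto
  let ?a = "\<Sum>w\<in>\<Omega>. \<mu> 0 w * \<bar>u w\<bar>"
  have "(\<Sum>w\<in>\<Omega>. \<nu> j w * u w) \<le> (\<Sum>w\<in>\<Omega>. E * (\<mu> 0 w * \<bar>u w\<bar>))"
  proof (intro sum_mono)
    fix w assume w: "w \<in> \<Omega>"
    have "0 \<le> \<nu> j w" using pos[OF j w] pos[OF _ w, of 0] E by (simp add: \<nu>_def)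
    then have "\<nu> j w * u w \<le> \<nu> j w * \<bar>u w\<bar>" by (intro mult_left_mono) auto
    also have "\<dots> \<le> E * \<mu> 0 w * \<bar>u w\<bar>" by (intro mult_right_mono) (auto simp: \<nu>_def)
    finally show "\<nu> j w * u w \<le> E * (\<mu> 0 w * \<bar>u w\<bar>)" by (simp add: mult.assoc)
  qed
  then have "real s * (\<Delta> - \<delta>) \<le> E * ?a" using u(2) by (simp add: sum_distrib_left)
  moreover have "0 \<le> real s * (\<Delta> - \<delta>)" using \<delta> by simp
  ultimately have "(real s * (\<Delta> - \<delta>))\<^sup>2 \<le> (E * ?a)\<^sup>2" by (rule power_mono)
  also have "\<dots> \<le> E\<^sup>2 * real s"
    unfolding power_mult_distrib
    using weighted_abs_le_sqrt[of \<Omega> "\<mu> 0" u] fin pos[of 0] one[of 0] u(1)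
    by (intro mult_left_mono) auto
  finally have "real s * (real s * (\<Delta> - \<delta>)\<^sup>2) \<le> real s * E\<^sup>2"
    by (simp add: power_mult_distrib power2_eq_square mult_ac)
  then show ?thesis by (cases "s = 0") auto
qed

section \<open>Homogeneous sets from Ramsey's theorem\<close>

lemma sorted_list_of_set_nth_card:
  fixes Z :: "nat set"
  assumes "finite Z" "x \<in> Z"
  shows "sorted_list_of_set Z ! card {w\<in>Z. w < x} = x"
proof -
  let ?l = "sorted_list_of_set Z"
  obtain k where k: "k < length ?l" "?l ! k = x" using assms by (metis in_set_conv_nth set_sorted_list_of_set)
  have lt: "?l ! i < ?l ! j \<longleftrightarrow> i < j" if "i < length ?l" "j < length ?l" for i j
    using that strict_sorted_list_of_set[of Z] sorted_wrt_nth_less[of "(<)" ?l]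
    by (cases i j rule: linorder_cases) fastforce+
  have "{w\<in>Z. w < x} = (!) ?l ` {..<k}"
  proof (intro set_eqI iffI)
    fix w assume "w \<in> {w\<in>Z. w < x}"
    then have "w \<in> set ?l" "w < x" using assms(1) by auto
    then obtain i where "i < length ?l" "?l ! i = w" "w < x" by (auto simp: in_set_conv_nth)
    then show "w \<in> (!) ?l ` {..<k}" using lt[of i k] k by auto
  next
    fix w assume "w \<in> (!) ?l ` {..<k}"
    then obtain i where "i < k" "w = ?l ! i" by auto
    then show "w \<in> {w\<in>Z. w < x}" using lt[of i k] k nth_mem[of i ?l] assms(1) by auto
  qed
  moreover have "inj_on ((!) ?l) {..<k}"
  proof (rule inj_onI)
    fix i j assume "i \<in> {..<k}" "j \<in> {..<k}" "?l ! i = ?l ! j"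
    then show "i = j" using lt[of i j] lt[of j i] k(1) by (cases i j rule: linorder_cases) auto
  qed
  ultimately show ?thesis using k by (simp add: card_image)
qed

text \<open>A set \<open>Z\<close> of \<open>n + 1\<close> points is coloured by the list, in
  increasing order of \<open>x\<close>, of the values \<open>q (Z - {x}) x\<close> rounded to the
  grid of width \<rho>. On a monochromatic set the rounded value depends only on the position of
  \<open>x\<close>. \<open>N\<close> must come before \<open>q\<close>, because the thresholds from
  which \<open>q\<close> is built are chosen for that \<open>N\<close>.\<close>

lemma homogeneous_subset:
  fixes \<rho> :: real
  assumes "0 < \<rho>" and nM: "n < M"
  shows "\<exists>N::nat. \<forall>q :: nat set \<Rightarrow> nat \<Rightarrow> real. (\<forall>W x. 0 \<le> q W x \<and> q W x \<le> 1) \<longrightarrow>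
    (\<exists>Y p. Y \<subseteq> {..<N} \<and> card Y = M \<and>
      (\<forall>W x. W \<subseteq> Y \<longrightarrow> card W = n \<longrightarrow> x \<in> Y - W \<longrightarrow> \<bar>q W x - p (card {w\<in>W. w < x})\<bar> \<le> \<rho>))"
proof -
  define B where "B = nat \<lfloor>1 / \<rho>\<rfloor>"
  define cols :: "nat list set" where "cols = {l. set l \<subseteq> {..B} \<and> length l = Suc n}"
  have "finite cols" unfolding cols_def by (intro finite_lists_length_eq) auto
  then obtain e where e: "bij_betw e cols {..<card cols}"
    using ex_bij_betw_finite_nat by (auto simp: lessThan_atLeast0)
  obtain N :: nat where N: "partn_lst {..<N} (replicate (card cols) M) (Suc n)"
    using ramsey_full by blast
  show ?thesis
  proof (intro exI[of _ N] allI impI)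
    fix q :: "nat set \<Rightarrow> nat \<Rightarrow> real" assume q: "\<forall>W x. 0 \<le> q W x \<and> q W x \<le> 1"
    define val where "val Z x = nat \<lfloor>q (Z - {x}) x / \<rho>\<rfloor>" for Z x
    define col where "col Z = map (val Z) (sorted_list_of_set Z)" for Z
    have val: "val Z x \<le> B" for Z x
      unfolding val_def B_def using q assms(1)
      by (intro nat_mono floor_mono divide_right_mono) auto
    have col: "col Z \<in> cols" if "finite Z" "card Z = Suc n" for Z
      using that val by (auto simp: cols_def col_def)
    have ec: "e \<circ> col \<in> nsets {..<N} (Suc n) \<rightarrow> {..<card cols}"
      using col bij_betwE[OF e] by (auto simp: nsets_def)
    obtain i Y where iY: "i < length (replicate (card cols) M)"
      "Y \<in> nsets {..<N} (replicate (card cols) M ! i)"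
      and mono: "(e \<circ> col) ` nsets Y (Suc n) \<subseteq> {i}"
      by (rule partn_lstE[OF N ec]) simp_all
    then have Y: "Y \<in> nsets {..<N} M" by simp
    have fY: "finite Y" "card Y = M" "Y \<subseteq> {..<N}" using Y by (auto simp: nsets_def)
    have same: "col Z = col Z'" if "Z \<in> nsets Y (Suc n)" "Z' \<in> nsets Y (Suc n)" for Z Z'
    proof -
      have "e (col Z) = e (col Z')" using mono that by (auto simp: image_subset_iff)
      moreover have "col Z \<in> cols" "col Z' \<in> cols" using that col by (auto simp: nsets_def)
      ultimately show ?thesis using e by (auto simp: bij_betw_def inj_on_def)
    qed
    obtain Z0 where Z0: "Z0 \<in> nsets Y (Suc n)"
    proof -
      obtain Z where "Z \<subseteq> Y" "card Z = Suc n"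
        by (rule obtain_subset_with_card_n[of "Suc n" Y]) (use nM fY in auto)
      then show ?thesis using that[of Z] fY(1) by (auto simp: nsets_def finite_subset)
    qed
    \<comment> \<open>The centre of the rounding cell of position \<open>k\<close>.\<close>
    define p where "p k = \<rho> * real (col Z0 ! k) + \<rho> / 2" for k
    have "\<bar>q W x - p (card {w\<in>W. w < x})\<bar> \<le> \<rho>" if W: "W \<subseteq> Y" "card W = n" "x \<in> Y - W" for W x
    proof -
      let ?Z = "insert x W"
      let ?k = "card {w\<in>W. w < x}"
      have fW: "finite W" using W(1) fY(1) finite_subset by blast
      have Z: "?Z \<in> nsets Y (Suc n)" using W fW by (auto simp: nsets_def)
      have "sorted_list_of_set ?Z ! ?k = x"
      proof -
        have "{w\<in>?Z. w < x} = {w\<in>W. w < x}" by auto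
        then show ?thesis
          using sorted_list_of_set_nth_card[of ?Z x] fW by simp
      qed
      moreover have "?k < Suc n" using card_mono[of W "{w\<in>W. w < x}"] fW W(2) by auto
      ultimately have "col ?Z ! ?k = val ?Z x" using fW W by (simp add: col_def)
      then have "col Z0 ! ?k = nat \<lfloor>q W x / \<rho>\<rfloor>" using same[OF Z Z0] W(3) by (simp add: val_def)
      then have "real (col Z0 ! ?k) \<le> q W x / \<rho>" "q W x / \<rho> < real (col Z0 ! ?k) + 1"
        using q assms(1) by auto
      then show ?thesis using assms(1) by (auto simp: p_def field_simps)
    qed
    then show "\<exists>Y p. Y \<subseteq> {..<N} \<and> card Y = M \<and>
      (\<forall>W x. W \<subseteq> Y \<longrightarrow> card W = n \<longrightarrow> x \<in> Y - W \<longrightarrow> \<bar>q W x - p (card {w\<in>W. w < x})\<bar> \<le> \<rho>)"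
      using fY by blast
  qed
qed

section \<open>Running a learner on independent samples\<close>

lemma integrable_pmf_bounded:
  fixes f :: "'b \<Rightarrow> real"
  assumes "\<And>x. \<bar>f x\<bar> \<le> B"
  shows "integrable (measure_pmf p) f"
  using assms by (intro measure_pmf.integrable_const_bound[where B = B]) auto

lemma expectation_mono_pmf:
  fixes f g :: "'b \<Rightarrow> real"
  assumes "\<And>x. x \<in> set_pmf p \<Longrightarrow> f x \<le> g x" "\<And>x. \<bar>f x\<bar> \<le> B" "\<And>x. \<bar>g x\<bar> \<le> C"
  shows "measure_pmf.expectation p f \<le> measure_pmf.expectation p g"
  using assms integrable_pmf_bounded[of f B p] integrable_pmf_bounded[of g C p]
  by (intro integral_mono_AE) (auto simp: AE_measure_pmf_iff)

lemma expectation_bind_pmf: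
  fixes f :: "'c \<Rightarrow> real"
  assumes "\<And>x. \<bar>f x\<bar> \<le> B"
  shows "measure_pmf.expectation (bind_pmf M N) f =
    measure_pmf.expectation M (\<lambda>x. measure_pmf.expectation (N x) f)"
  unfolding measure_pmf_bind
  using assms measure_pmf_in_subprob_space
  by (intro integral_bind[where K = "count_space UNIV" and B = B and B' = 1])
     (auto simp: measure_pmf.emeasure_space_le_1)

lemma prob_bind_pmf:
  "measure_pmf.prob (bind_pmf M N) X = measure_pmf.expectation M (\<lambda>x. measure_pmf.prob (N x) X)"
  using expectation_bind_pmf[of "indicator X" 1 M N] by (simp add: indicator_def)

lemma map_replicate_pmf: "map_pmf (map f) (replicate_pmf n p) = replicate_pmf n (map_pmf f p)"
proof (induction n)
  case (Suc n)
  then show ?case by (simp add: map_bind_pmf bind_map_pmf flip: Suc)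
qed simp

lemma prob_replicate_Suc:
  "measure_pmf.prob (replicate_pmf (Suc n) p) X =
    measure_pmf.expectation p (\<lambda>x. measure_pmf.prob (replicate_pmf n p) {xs. x # xs \<in> X})"
  by (simp add: prob_bind_pmf vimage_def flip: map_pmf_def)

lemma expectation_replicate_Suc:
  fixes f :: "'b list \<Rightarrow> real"
  assumes "\<And>x. \<bar>f x\<bar> \<le> B"
  shows "measure_pmf.expectation (replicate_pmf (Suc n) p) f =
    measure_pmf.expectation p (\<lambda>x. measure_pmf.expectation (replicate_pmf n p) (\<lambda>xs. f (x # xs)))"
  by (simp add: expectation_bind_pmf[OF assms] flip: map_pmf_def)

lemma length_replicate_pmf: "xs \<in> set_pmf (replicate_pmf n p) \<Longrightarrow> length xs = n"
  by (simp add: set_replicate_pmf)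

lemma prob_in_set_replicate_pmf:
  "measure_pmf.prob (replicate_pmf n p) {xs. a \<in> set xs} \<le> real n * pmf p a"
proof (induction n)
  case (Suc n)
  have "measure_pmf.prob (replicate_pmf (Suc n) p) {xs. a \<in> set xs}
      \<le> measure_pmf.expectation p (\<lambda>x. indicator {a} x + real n * pmf p a)"
    unfolding prob_replicate_Suc
  proof (rule expectation_mono_pmf[where B = 1 and C = "1 + real n"])
    fix x
    show "measure_pmf.prob (replicate_pmf n p) {xs. x # xs \<in> {xs. a \<in> set xs}}
        \<le> indicator {a} x + real n * pmf p a"
      using Suc by (cases "x = a") (auto intro: order_trans[OF measure_pmf.prob_le_1])
    have "0 \<le> real n * pmf p a" "real n * pmf p a \<le> real n * 1"
      by (simp, intro mult_left_mono, auto simp: pmf_le_1)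
    then show "\<bar>indicator {a} x + real n * pmf p a\<bar> \<le> 1 + real n"
      by (auto simp: indicator_def)
  qed auto
  also have "\<dots> = real (Suc n) * pmf p a"
    by (subst Bochner_Integration.integral_add)
       (auto simp: measure_pmf_single algebra_simps intro: integrable_pmf_bounded[of _ 1])
  finally show ?case .
qed simp

text \<open>Either the first draw hits \<open>a\<close> and a later one hits it again, or
  \<open>a\<close> occurs twice among the later draws. A bound quadratic in the mass of
  \<open>a\<close> is what makes double hits cheaper than a jump of order
  \<open>1 / n\<close>.\<close>

lemma prob_count_replicate_pmf:
  "measure_pmf.prob (replicate_pmf n p) {xs. 2 \<le> count_list xs a} \<le> (real n * pmf p a)\<^sup>2"
proof (induction n)
  case (Suc n)
  let ?a = "pmf p a"
  have "measure_pmf.prob (replicate_pmf (Suc n) p) {xs. 2 \<le> count_list xs a}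
      \<le> measure_pmf.expectation p (\<lambda>x. (real n * ?a) * indicator {a} x + (real n * ?a)\<^sup>2)"
    unfolding prob_replicate_Suc
  proof (rule expectation_mono_pmf[where B = 1 and C = "real n + (real n)\<^sup>2"])
    fix x
    show "measure_pmf.prob (replicate_pmf n p) {xs. x # xs \<in> {xs. 2 \<le> count_list xs a}}
        \<le> (real n * ?a) * indicator {a} x + (real n * ?a)\<^sup>2"
    proof (cases "x = a")
      case True
      have "{xs. 1 \<le> count_list xs a} = {xs. a \<in> set xs}"
        by (metis count_list_0_iff less_one not_le)
      then have "measure_pmf.prob (replicate_pmf n p) {xs. x # xs \<in> {xs. 2 \<le> count_list xs a}}
          \<le> real n * ?a"
        using True prob_in_set_replicate_pmf[of n p a] by (simp add: numeral_2_eq_2)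
      also have "\<dots> \<le> real n * ?a + (real n * ?a)\<^sup>2" by simp
      finally show ?thesis using True by simp
    qed (use Suc in simp)
    have "0 \<le> real n * ?a" "real n * ?a \<le> real n * 1"
      by (simp, intro mult_left_mono, auto simp: pmf_le_1)
    moreover from this have "(real n * ?a)\<^sup>2 \<le> (real n)\<^sup>2" by (intro power_mono) auto
    ultimately show "\<bar>real n * ?a * indicator {a} x + (real n * ?a)\<^sup>2\<bar> \<le> real n + (real n)\<^sup>2"
      unfolding indicator_def by (cases "x = a") (simp_all add: add_mono add_increasing)
  qed auto
  also have "\<dots> = (real n * ?a) * ?a + (real n * ?a)\<^sup>2"
    by (subst Bochner_Integration.integral_add)
       (auto simp: measure_pmf_single intro: integrable_pmf_bounded[of _ 1])
  also have "\<dots> \<le> (real (Suc n) * ?a)\<^sup>2"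
    by (simp add: power2_eq_square algebra_simps)
  finally show ?case .
qed simp

section \<open>Output distributions on random samples\<close>

lemma hyp_space_point [measurable]: "{h. h x} \<in> sets hyp_space"
proof -
  have "(\<lambda>h. h x) \<in> measurable hyp_space (count_space UNIV)"
    unfolding hyp_space_def by (rule measurable_component_singleton) simp
  from measurable_sets[OF this, of "{True}"] show ?thesis
    by (simp add: hyp_space_def space_PiM vimage_def)
qed

lemma space_hyp_space: "space hyp_space = UNIV"
  by (simp add: hyp_space_def space_PiM)

lemma hyp_space_label: "{h. h x = y} \<in> sets hyp_space"
proof (cases y)
  case False
  then have "{h. h x = y} = space hyp_space - {h. h x}" by (auto simp: space_hyp_space)
  then show ?thesis by simp
qed simp

lemma randomized_algD:
  assumes "randomized_alg A"
  shows "prob_space (A S)" "sets (A S) = sets hyp_space" "space (A S) = UNIV"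
proof -
  show "prob_space (A S)" "sets (A S) = sets hyp_space"
    using assms by (auto simp: randomized_alg_def space_prob_algebra)
  then show "space (A S) = UNIV" using sets_eq_imp_space_eq space_hyp_space by metis
qed

definition run :: "('a dataset \<Rightarrow> ('a \<Rightarrow> bool) measure) \<Rightarrow> nat \<Rightarrow> ('a \<times> bool) pmf \<Rightarrow> ('a \<Rightarrow> bool) set \<Rightarrow> real"
  where "run A m D E = measure_pmf.expectation (replicate_pmf m D) (\<lambda>S. measure (A S) E)"

text \<open>If \<open>f\<close> and \<open>g\<close> differ only at the index \<open>a\<close>, a sample of indices which hits \<open>a\<close> at most once
  yields datasets differing in at most one example.\<close>

lemma run_dp:
  assumes A: "randomized_alg A" and dp: "is_dp_on_size A m \<epsilon> \<delta>" and E: "E \<in> sets hyp_space"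
    and \<epsilon>: "\<epsilon> \<le> \<epsilon>'" "0 \<le> \<epsilon>'" and \<delta>: "\<delta> \<le> \<delta>'" "0 \<le> \<delta>'"
    and fg: "\<And>i. i \<noteq> a \<Longrightarrow> f i = g i"
  shows "run A m (map_pmf f p) E \<le> exp \<epsilon>' * run A m (map_pmf g p) E + \<delta>' + (real m * pmf p a)\<^sup>2"
proof -
  interpret A: prob_space "A S" for S using A by (rule randomized_algD)
  let ?F = "\<lambda>I. measure (A (map f I)) E" and ?G = "\<lambda>I. measure (A (map g I)) E"
  let ?B = "{I. 2 \<le> count_list I a}"
  have pt: "?F I \<le> exp \<epsilon>' * ?G I + \<delta>' + indicator ?B I" if I: "I \<in> set_pmf (replicate_pmf m p)" for I
  proof -
    have len: "length I = m" using I by (rule length_replicate_pmf)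
    have e1: "1 \<le> exp \<epsilon>'" using \<epsilon>(2) by simp
    \<comment> \<open>Equal datasets are not related by \<open>differ_in_one\<close>; for them the
      bound comes from the signs of \<open>\<epsilon>'\<close> and \<open>\<delta>'\<close>.\<close>
    have same: ?thesis if "map f I = map g I"
    proof -
      have "?F I = 1 * ?G I" unfolding that by simp
      also have "\<dots> \<le> exp \<epsilon>' * ?G I" using e1 by (intro mult_right_mono) auto
      finally show ?thesis using \<delta>(2) by (auto simp: indicator_def)
    qed
    consider "2 \<le> count_list I a" | "count_list I a = 0" | "f a = g a" | "count_list I a = 1" "f a \<noteq> g a"
      by linarith
    then show ?thesis
    proof cases
      case 1
      have "?F I \<le> 1" by (rule A.prob_le_1)
      moreover have "0 \<le> exp \<epsilon>' * ?G I" by simp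
      ultimately have "?F I \<le> exp \<epsilon>' * ?G I + \<delta>' + 1" using \<delta>(2) by linarith
      then show ?thesis using 1 by simp
    next
      case 2
      then have "map f I = map g I" using fg unfolding count_list_0_iff by (metis map_eq_conv)
      then show ?thesis by (rule same)
    next
      case 3
      then have "map f I = map g I" using fg by (metis map_eq_conv)
      then show ?thesis by (rule same)
    next
      case 4
      have "{i. i < length (map f I) \<and> map f I ! i \<noteq> map g I ! i} = {i. i < length I \<and> a = I ! i}"
        using 4(2) fg by auto (metis fg)
      then have "differ_in_one (map f I) (map g I)"
        using 4(1) by (simp add: differ_in_one_def count_list_eq_length_filter length_filter_conv_card)
      then have "?F I \<le> exp \<epsilon> * ?G I + \<delta>"
        using dp E len by (auto simp: is_dp_on_size_def)
      also have "\<dots> \<le> exp \<epsilon>' * ?G I + \<delta>'"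
        using \<epsilon> \<delta> by (intro add_mono mult_right_mono) auto
      finally show ?thesis by (auto simp: indicator_def)
    qed
  qed
  have ge: "0 \<le> exp \<epsilon>' * ?G I" "exp \<epsilon>' * ?G I \<le> exp \<epsilon>'" for I
    using A.prob_le_1[of "map g I" E] by (auto intro: mult_left_le)
  have ind: "0 \<le> indicat_real ?B I \<and> indicat_real ?B I \<le> 1" for I
    by (simp add: indicator_def)
  have "run A m (map_pmf f p) E = measure_pmf.expectation (replicate_pmf m p) ?F"
    by (simp add: run_def flip: map_replicate_pmf)
  also have "\<dots> \<le> measure_pmf.expectation (replicate_pmf m p) (\<lambda>I. exp \<epsilon>' * ?G I + \<delta>' + indicator ?B I)"
  proof (rule expectation_mono_pmf[OF pt, where B = 1 and C = "exp \<epsilon>' + \<delta>' + 1"])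
    fix I
    show "\<bar>?F I\<bar> \<le> 1" by simp
    show "\<bar>exp \<epsilon>' * ?G I + \<delta>' + indicator ?B I\<bar> \<le> exp \<epsilon>' + \<delta>' + 1"
      using ge(1)[of I] ge(2)[of I] \<delta>(2) ind[of I]
      by linarith
  qed
  also have "\<dots> = exp \<epsilon>' * run A m (map_pmf g p) E + \<delta>' + measure_pmf.prob (replicate_pmf m p) ?B"
  proof -
    have G: "integrable (measure_pmf (replicate_pmf m p)) ?G" by (rule integrable_pmf_bounded[of _ 1]) simp
    have I: "integrable (measure_pmf (replicate_pmf m p)) (indicat_real ?B)"
      by (rule integrable_pmf_bounded[of _ 1]) (use ind in auto)
    show ?thesis using G I
      by (subst Bochner_Integration.integral_add; simp add: run_def flip: map_replicate_pmf)
  qed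
  also have "\<dots> \<le> exp \<epsilon>' * run A m (map_pmf g p) E + \<delta>' + (real m * pmf p a)\<^sup>2"
    using prob_count_replicate_pmf by simp
  finally show ?thesis .
qed

lemma run_sum_partition:
  assumes A: "randomized_alg A" and "finite I" "\<And>i. i \<in> I \<Longrightarrow> E i \<in> sets hyp_space" "disjoint_family_on E I"
  shows "run A m D (\<Union>i\<in>I. E i) = (\<Sum>i\<in>I. run A m D (E i))"
proof -
  interpret A: prob_space "A S" for S using A by (rule randomized_algD)
  have "measure (A S) (\<Union>i\<in>I. E i) = (\<Sum>i\<in>I. measure (A S) (E i))" for S
    using assms by (intro A.finite_measure_finite_Union) (auto simp: randomized_algD(2)[OF A])
  moreover have "integrable (measure_pmf (replicate_pmf m D)) (\<lambda>S. measure (A S) (E i))" for i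
    by (rule integrable_pmf_bounded[of _ 1]) simp
  ultimately show ?thesis by (simp add: run_def)
qed

lemma run_UNIV:
  assumes "randomized_alg A"
  shows "run A m D UNIV = 1"
proof -
  have "measure (A S) UNIV = 1" for S
    using prob_space.prob_space[OF randomized_algD(1)[OF assms, of S]] randomized_algD(3)[OF assms, of S]
    by simp
  then show ?thesis by (simp add: run_def)
qed

lemma run_nonneg: "0 \<le> run A m D E"
  by (simp add: run_def)

lemma run_le_1: "randomized_alg A \<Longrightarrow> run A m D E \<le> 1"
  using expectation_mono_pmf[of "replicate_pmf m D" "\<lambda>S. measure (A S) E" "\<lambda>_. 1" 1 1]
    prob_space.prob_le_1[OF randomized_algD(1), of A _ E]
  by (simp add: run_def)

lemma loss_map_uniform:
  assumes "finite W" "W \<noteq> {}"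
  shows "loss (map_pmf f (pmf_of_set W)) h
    = (\<Sum>i\<in>W. indicator {h. h (fst (f i)) \<noteq> snd (f i)} h) / card W"
proof -
  have "W \<inter> f -` {(x, y). h x \<noteq> y} = {i\<in>W. h (fst (f i)) \<noteq> snd (f i)}" by auto
  then show ?thesis
    using assms by (simp add: loss_def measure_pmf_of_set indicator_def sum.If_cases Int_def)
qed

text \<open>For the uniform distribution on \<open>W\<close> the pointwise error probabilities add
  up to \<open>card W\<close> times the expected loss, and a loss, being at most 1, is bounded by
  \<open>max 0 \<alpha>\<close> plus the indicator of exceeding \<alpha>. The maximum is there
  because \<alpha> may be negative.\<close>

lemma run_uniform_errors:
  assumes A: "randomized_alg A" and lr: "is_learner H A m \<alpha> \<beta>"
    and W: "finite W" "W \<noteq> {}" and D: "realizable_dist H (map_pmf f (pmf_of_set W))"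
  shows "(\<Sum>i\<in>W. run A m (map_pmf f (pmf_of_set W)) {h. h (fst (f i)) \<noteq> snd (f i)})
    \<le> real (card W) * (max 0 \<alpha> + \<beta>)"
proof -
  interpret A: prob_space "A S" for S using A by (rule randomized_algD)
  let ?D = "map_pmf f (pmf_of_set W)"
  let ?E = "\<lambda>i. {h. h (fst (f i)) \<noteq> snd (f i)}"
  let ?L = "{h. loss ?D h > \<alpha>}"
  have ms: "?E i \<in> sets (A S)" for i S
    using hyp_space_label[of "fst (f i)" "\<not> snd (f i)"] by (simp add: randomized_algD(2)[OF A])
  have lm: "loss ?D \<in> borel_measurable (A S)" for S
    unfolding loss_map_uniform[OF W] using ms
    by (intro borel_measurable_divide borel_measurable_sum) auto
  have Lm: "?L \<in> sets (A S)" for S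
    using borel_measurable_less[OF borel_measurable_const lm] by (simp add: randomized_algD(3)[OF A])
  have l01: "0 \<le> loss ?D h" "loss ?D h \<le> 1" for h by (auto simp: loss_def)
  have pt: "(\<Sum>i\<in>W. measure (A S) (?E i)) \<le> real (card W) * (max 0 \<alpha> + measure (A S) ?L)" for S
  proof -
    have "(\<Sum>i\<in>W. measure (A S) (?E i)) = (\<Sum>i\<in>W. integral\<^sup>L (A S) (indicator (?E i)))"
      using ms by simp
    also have "\<dots> = integral\<^sup>L (A S) (\<lambda>h. \<Sum>i\<in>W. indicator (?E i) h)"
      using ms by (subst Bochner_Integration.integral_sum) (auto simp: A.emeasure_eq_measure)
    also have "\<dots> = integral\<^sup>L (A S) (\<lambda>h. card W * loss ?D h)"
      unfolding loss_map_uniform[OF W] using W by simp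
    also have "\<dots> = card W * integral\<^sup>L (A S) (loss ?D)" by simp
    also have "integral\<^sup>L (A S) (loss ?D) \<le> integral\<^sup>L (A S) (\<lambda>h. max 0 \<alpha> + indicator ?L h)"
    proof (rule integral_mono)
      show "integrable (A S) (loss ?D)"
        using lm l01 by (intro A.integrable_const_bound[of _ 1]) auto
      show "integrable (A S) (\<lambda>h. max 0 \<alpha> + indicator ?L h)"
        using Lm by (intro Bochner_Integration.integrable_add) (auto simp: A.emeasure_eq_measure)
      fix h show "loss ?D h \<le> max 0 \<alpha> + indicator ?L h"
        using l01[of h] by (auto simp: indicator_def)
    qed
    also have "\<dots> = max 0 \<alpha> + measure (A S) ?L"
      using Lm by (subst Bochner_Integration.integral_add) (auto simp: A.prob_space A.emeasure_eq_measure)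
    finally show ?thesis by (simp add: mult_left_mono)
  qed
  let ?R = "measure_pmf (replicate_pmf m ?D)"
  have int: "integrable ?R (\<lambda>S. measure (A S) E)" for E by (rule integrable_pmf_bounded[of _ 1]) simp
  have "(\<Sum>i\<in>W. run A m ?D (?E i)) = integral\<^sup>L ?R (\<lambda>S. \<Sum>i\<in>W. measure (A S) (?E i))"
    unfolding run_def by (rule Bochner_Integration.integral_sum[symmetric]) (rule int)
  also have "\<dots> \<le> integral\<^sup>L ?R (\<lambda>S. real (card W) * (max 0 \<alpha> + measure (A S) ?L))"
    by (rule integral_mono) (use pt int in auto)
  also have "\<dots> = real (card W) * (max 0 \<alpha> + integral\<^sup>L ?R (\<lambda>S. measure (A S) ?L))"
    using int by simp
  also have "\<dots> \<le> real (card W) * (max 0 \<alpha> + \<beta>)"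
    using lr D by (intro mult_left_mono add_left_mono) (auto simp: is_learner_def less_imp_le)
  finally show ?thesis .
qed

section \<open>Learnable classes have bounded mistake trees\<close>

definition rank_in :: "nat set \<Rightarrow> nat \<Rightarrow> nat" where
  "rank_in T t = card {u\<in>T. u < t}"

lemma rank_image:
  assumes "strict_mono_on {..<M} y" "T \<subseteq> {..<M}" "t < M"
  shows "rank_in (y ` T) (y t) = rank_in T t"
proof -
  have "{u\<in>y ` T. u < y t} = y ` {u\<in>T. u < t}"
    using strict_mono_on_less[OF assms(1)] assms(2,3) by auto
  moreover have "inj_on y {u\<in>T. u < t}"
    using assms(2) by (intro inj_on_subset[OF strict_mono_on_imp_inj_on[OF assms(1)]]) auto
  ultimately show ?thesis by (simp add: rank_in_def card_image)
qed

lemma rank_mono: "finite T \<Longrightarrow> s \<le> t \<Longrightarrow> rank_in T s \<le> rank_in T t"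
  unfolding rank_in_def by (intro card_mono) auto

lemma rank_less: "finite T \<Longrightarrow> s \<in> T \<Longrightarrow> s < t \<Longrightarrow> rank_in T s < rank_in T t"
  unfolding rank_in_def by (intro psubset_card_mono) auto

lemma rank_surj:
  assumes "finite T" "k < card T"
  shows "\<exists>t\<in>T. rank_in T t = k"
proof -
  have "inj_on (rank_in T) T"
    using rank_less[OF assms(1)] by (intro inj_onI) (metis less_irrefl linorder_neqE_nat)
  moreover have "rank_in T ` T \<subseteq> {..<card T}"
    using assms(1) by (auto simp: rank_in_def intro!: psubset_card_mono)
  ultimately have "rank_in T ` T = {..<card T}"
    by (intro card_subset_eq) (auto simp: card_image)
  then show ?thesis using assms(2) by (metis imageE lessThan_iff)
qed

text \<open>The homogeneous set is enumerated increasingly, so that ranks can be computed among the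
  indices \<open>{..<M}\<close>.\<close>

lemma homogeneous_sequence:
  fixes \<rho> :: real
  assumes "0 < \<rho>" and nM: "n < M"
  shows "\<exists>N::nat. \<forall>q :: nat set \<Rightarrow> nat \<Rightarrow> real. (\<forall>W x. 0 \<le> q W x \<and> q W x \<le> 1) \<longrightarrow>
    (\<exists>y p. strict_mono_on {..<M} y \<and> y ` {..<M} \<subseteq> {..<N} \<and>
      (\<forall>T t. T \<subseteq> {..<M} \<longrightarrow> card T = n \<longrightarrow> t \<in> {..<M} - T \<longrightarrow> \<bar>q (y ` T) (y t) - p (rank_in T t)\<bar> \<le> \<rho>))"
proof -
  obtain N :: nat where N: "\<forall>q :: nat set \<Rightarrow> nat \<Rightarrow> real. (\<forall>W x. 0 \<le> q W x \<and> q W x \<le> 1) \<longrightarrow>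
    (\<exists>Y p. Y \<subseteq> {..<N} \<and> card Y = M \<and>
      (\<forall>W x. W \<subseteq> Y \<longrightarrow> card W = n \<longrightarrow> x \<in> Y - W \<longrightarrow> \<bar>q W x - p (rank_in W x)\<bar> \<le> \<rho>))"
    using homogeneous_subset[OF assms] unfolding rank_in_def by blast
  show ?thesis
  proof (intro exI[of _ N] allI impI)
    fix q :: "nat set \<Rightarrow> nat \<Rightarrow> real" assume "\<forall>W x. 0 \<le> q W x \<and> q W x \<le> 1"
    then obtain Y p where Y: "Y \<subseteq> {..<N}" "card Y = M"
      and hom: "\<And>W x. W \<subseteq> Y \<Longrightarrow> card W = n \<Longrightarrow> x \<in> Y - W \<Longrightarrow> \<bar>q W x - p (rank_in W x)\<bar> \<le> \<rho>"
      using N[rule_format, of q] by auto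
    have fY: "finite Y" using Y(1) finite_subset by blast
    define y where "y i = sorted_list_of_set Y ! i" for i
    have y: "strict_mono_on {..<M} y"
      using Y(2) by (auto simp: strict_mono_on_def y_def intro!: sorted_wrt_nth_less[of "(<)"])
    have yY: "y i \<in> Y" if "i < M" for i
      using that Y(2) nth_mem[of i "sorted_list_of_set Y"] fY by (simp add: y_def)
    have inj: "inj_on y {..<M}" by (rule strict_mono_on_imp_inj_on[OF y])
    have "\<bar>q (y ` T) (y t) - p (rank_in T t)\<bar> \<le> \<rho>"
      if T: "T \<subseteq> {..<M}" "card T = n" "t \<in> {..<M} - T" for T t
    proof -
      have "card (y ` T) = n" using T inj by (metis card_image inj_on_subset)
      moreover have "y t \<notin> y ` T" using T inj by (auto dest: inj_onD)
      moreover have "y ` T \<subseteq> Y" "y t \<in> Y" using T yY by auto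
      ultimately have "\<bar>q (y ` T) (y t) - p (rank_in (y ` T) (y t))\<bar> \<le> \<rho>" by (intro hom) auto
      then show ?thesis using rank_image[OF y T(1)] T(3) by simp
    qed
    then show "\<exists>y p. strict_mono_on {..<M} y \<and> y ` {..<M} \<subseteq> {..<N} \<and>
      (\<forall>T t. T \<subseteq> {..<M} \<longrightarrow> card T = n \<longrightarrow> t \<in> {..<M} - T \<longrightarrow> \<bar>q (y ` T) (y t) - p (rank_in T t)\<bar> \<le> \<rho>)"
      using y yY Y(1) by blast
  qed
qed

text \<open>Labels depend on the rank within \<open>T\<close> alone. Hence \<open>balanced\<close>
  commutes with increasing reindexing, and moving one point inside a gap of the others changes no
  other label.\<close>

definition balanced :: "nat \<Rightarrow> (nat \<Rightarrow> 'a) \<Rightarrow> nat set \<Rightarrow> ('a \<times> bool) pmf" where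
  "balanced h x T = map_pmf (\<lambda>t. (x t, h \<le> rank_in T t)) (pmf_of_set T)"

lemma balanced_image:
  assumes "strict_mono_on {..<M} y" "T \<subseteq> {..<M}" "T \<noteq> {}"
  shows "balanced h x (y ` T) = balanced h (x \<circ> y) T"
proof -
  have fT: "finite T" using assms(2) finite_subset by blast
  have "inj_on y T" using strict_mono_on_imp_inj_on[OF assms(1)] assms(2) inj_on_subset by blast
  then have "pmf_of_set (y ` T) = map_pmf y (pmf_of_set T)"
    using fT assms(3) by (simp add: map_pmf_of_set_inj)
  then have "balanced h x (y ` T) = map_pmf (\<lambda>t. (x (y t), h \<le> rank_in (y ` T) (y t))) (pmf_of_set T)"
    by (simp add: balanced_def map_pmf_comp)
  also have "\<dots> = balanced h (x \<circ> y) T"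
    unfolding balanced_def
  proof (intro map_pmf_cong refl)
    fix t assume "t \<in> set_pmf (pmf_of_set T)"
    then have "t < M" using fT assms(2,3) by (auto simp: set_pmf_of_set)
    then show "(x (y t), h \<le> rank_in (y ` T) (y t)) = ((x \<circ> y) t, h \<le> rank_in T t)"
      using rank_image[OF assms(1,2)] by simp
  qed
  finally show ?thesis .
qed

lemma balanced_realizable:
  assumes thr: "\<And>c. 1 \<le> c \<Longrightarrow> c < M \<Longrightarrow> \<exists>g\<in>H. \<forall>t<M. g (x t) \<longleftrightarrow> c \<le> t"
    and T: "T \<subseteq> {..<M}" "h < card T" "1 \<le> h"
  shows "realizable_dist H (balanced h x T)"
proof -
  have fT: "finite T" using T(1) finite_subset by blast
  then have ne: "T \<noteq> {}" using T(2) by auto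
  obtain c where c: "c \<in> T" "rank_in T c = h" using rank_surj[OF fT T(2)] by auto
  have "1 \<le> c"
  proof (rule ccontr)
    assume "\<not> 1 \<le> c"
    then have "rank_in T c = 0" by (simp add: rank_in_def)
    then show False using c T(3) by simp
  qed
  then obtain g where g: "g \<in> H" "\<And>t. t < M \<Longrightarrow> g (x t) \<longleftrightarrow> c \<le> t"
    using thr[of c] c(1) T(1) by auto
  have "c \<le> t \<longleftrightarrow> h \<le> rank_in T t" if "t \<in> T" for t
    using rank_mono[OF fT, of c t] rank_less[OF fT that, of c] c(2) by (auto simp: not_le[symmetric])
  then have "loss (balanced h x T) g = 0"
    using g(2) T(1) fT ne by (auto simp: balanced_def loss_map_uniform indicator_def intro!: sum.neutral)
  then show ?thesis using g(1) unfolding realizable_dist_def by (metis)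
qed

text \<open>As \<open>a\<close> and \<open>b\<close> lie in the same gap of \<open>V\<close>, the
  labels on \<open>V\<close> agree, and only one point of mass \<open>1 / n\<close> is
  exchanged.\<close>

lemma run_balanced_dp:
  assumes A: "randomized_alg A" and dp: "is_dp_on_size A m \<epsilon> \<delta>" and E: "E \<in> sets hyp_space"
    and \<epsilon>: "\<epsilon> \<le> \<epsilon>'" "0 \<le> \<epsilon>'" and \<delta>: "\<delta> \<le> \<delta>'" "0 \<le> \<delta>'"
    and V: "finite V" "a \<notin> V" "b \<notin> V" "\<And>v. v \<in> V \<Longrightarrow> v < a \<longleftrightarrow> v < b"
    and n: "card V + 1 = n"
  shows "run A m (balanced h x (insert a V)) E
    \<le> exp \<epsilon>' * run A m (balanced h x (insert b V)) E + \<delta>' + (real m / real n)\<^sup>2"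
proof -
  let ?\<pi> = "\<lambda>i. if i = a then b else i"
  let ?f = "\<lambda>t. (x t, h \<le> rank_in (insert a V) t)"
  let ?g = "\<lambda>t. if t = a then (x b, h \<le> rank_in (insert b V) b) else ?f t"
  have lab: "rank_in (insert a V) t = rank_in (insert b V) t" if "t \<in> V" for t
  proof -
    have ab: "a < t \<longleftrightarrow> b < t" using V that by (metis linorder_neqE_nat not_less_iff_gr_or_eq)
    have "{u \<in> insert c V. u < t} = (if c < t then insert c {u\<in>V. u < t} else {u\<in>V. u < t})" for c
      by auto
    then show ?thesis using V ab by (simp add: rank_in_def)
  qed
  \<comment> \<open>Both distributions become images of one uniform index, the form that
    \<open>run_dp\<close> expects.\<close>
  have "pmf_of_set (insert b V) = map_pmf ?\<pi> (pmf_of_set (insert a V))"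
    using V by (subst map_pmf_of_set_bij_betw[of _ _ "insert b V"]) (auto simp: bij_betw_def inj_on_def)
  then have "balanced h x (insert b V) = map_pmf ?g (pmf_of_set (insert a V))"
    using V lab by (auto simp: balanced_def map_pmf_comp intro!: map_pmf_cong)
  moreover have "pmf (pmf_of_set (insert a V)) a = 1 / real n"
    using V n by (simp add: card_insert_if)
  ultimately show ?thesis
    using run_dp[OF A dp E \<epsilon> \<delta>, of a ?f ?g "pmf_of_set (insert a V)"]
    unfolding balanced_def by simp
qed

section \<open>The jump of the predictions: limited by privacy, forced by accuracy\<close>

lemma exists_jump:
  fixes p :: "nat \<Rightarrow> real"
  assumes "a < b" "(real b - real a) * \<eta> \<le> p b - p a"
  shows "\<exists>i. a \<le> i \<and> i < b \<and> \<eta> \<le> p (Suc i) - p i"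
proof (rule ccontr)
  assume neg: "\<not> ?thesis"
  have "(\<Sum>i=a..<b. p (Suc i) - p i) < (\<Sum>i=a..<b. \<eta>)"
    using neg assms(1) by (intro sum_strict_mono) (auto simp: not_le)
  then show False using assms by (simp add: sum_Suc_diff' of_nat_diff)
qed

lemma pattern_measurable:
  fixes Q :: "nat set"
  assumes "finite Q"
  shows "{h. {i\<in>Q. h (z i)} = w} \<in> sets hyp_space"
proof (cases "w \<subseteq> Q")
  case True
  have "{h. {i\<in>Q. h (z i)} = w} = {h\<in>space hyp_space. \<forall>i\<in>Q. h (z i) = (i \<in> w)}"
    using True by (auto simp: space_hyp_space)
  moreover have "{h\<in>space hyp_space. h (z i) = (i \<in> w)} \<in> sets hyp_space" for i
    using hyp_space_label[of "z i" "i \<in> w"] by (simp add: space_hyp_space)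
  ultimately show ?thesis using assms sets.sets_Collect_finite_All[of Q hyp_space] by simp
next
  case False
  then have "{h. {i\<in>Q. h (z i)} = w} = {}" by auto
  then show ?thesis by (simp only: sets.empty_sets)
qed

text \<open>The sample points \<open>i + 2 j + 1\<close> and the query points \<open>i + 2 k\<close> interleave, all of them between
  the first \<open>i\<close> and the last \<open>n - 1 - i\<close> points of the sample.\<close>

lemma no_jump:
  fixes x :: "nat \<Rightarrow> 'a"
  assumes A: "randomized_alg A" and dp: "is_dp_on_size A m \<epsilon> \<delta>"
    and \<epsilon>: "\<epsilon> \<le> \<epsilon>'" "0 \<le> \<epsilon>'" and \<delta>: "\<delta> \<le> \<delta>'" "0 \<le> \<delta>'"
    and hom: "\<And>T t. T \<subseteq> {..<M} \<Longrightarrow> card T = n \<Longrightarrow> t \<in> {..<M} - T \<Longrightarrow>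
        \<bar>run A m (balanced h x T) {g. g (x t)} - p (rank_in T t)\<bar> \<le> \<rho>"
    and M: "n + 2 * 2 ^ s < M" and i: "i < n" and s: "1 \<le> s"
    and jump: "\<eta> \<le> p (Suc i) - p i"
    and \<gamma>: "\<delta>' + (real m / real n)\<^sup>2 \<le> \<eta> / 2 - \<rho>"
  shows "real s * (\<eta> / 2 - \<rho> - (\<delta>' + (real m / real n)\<^sup>2))\<^sup>2 \<le> (exp \<epsilon>')\<^sup>2"
proof -
  define K :: nat where "K = 2 ^ s"
  have K: "2 \<le> K" using s power_increasing[of 1 s "2::nat"] by (simp add: K_def)
  \<comment> \<open>Query 0 is left out: it lies below every position of the moving point and
    distinguishes nothing.\<close>
  define Q where "Q = {1..<K}"
  define V where "V = {..<i} \<union> {i + 2 * K + 1..<n + 2 * K}"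
  define a where "a j = i + 2 * j + 1" for j
  define b where "b k = i + 2 * k" for k
  define D where "D j = balanced h x (insert (a j) V)" for j
  have V: "finite V" "card V + 1 = n"
    using i unfolding V_def by (simp, subst card_Un_disjoint, auto)
  have aV: "a j \<notin> V" if "j < K" for j using that by (auto simp: V_def a_def)
  have bV: "b k \<notin> V" "b k \<noteq> a j" if "k < K" for k j
    using that unfolding V_def a_def b_def by auto presburger
  have sep: "v < a j \<longleftrightarrow> v < a 0" if "v \<in> V" "j < K" for v j
    using that by (auto simp: V_def a_def)
  have rk: "rank_in (insert (a j) V) (b k) = (if k \<le> j then i else Suc i)" if "j < K" "k < K" for j k
  proof -
    have "{u \<in> insert (a j) V. u < b k} = {..<i} \<union> (if k \<le> j then {} else {a j})"
      using that by (auto simp: V_def a_def b_def)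
    then show ?thesis by (auto simp: rank_in_def a_def)
  qed
  have q: "\<bar>run A m (D j) {g. g (x (b k))} - p (if k \<le> j then i else Suc i)\<bar> \<le> \<rho>"
    if "j < K" "k < K" for j k
  proof -
    have sub: "insert (a j) V \<subseteq> {..<M}" using that M i by (auto simp: V_def a_def K_def)
    have "card (insert (a j) V) = n" using V aV[OF that(1)] by simp
    moreover have "b k \<in> {..<M} - insert (a j) V"
      using bV[OF that(2)] M that(2) i by (auto simp: b_def K_def)
    ultimately have "\<bar>run A m (D j) {g. g (x (b k))} - p (rank_in (insert (a j) V) (b k))\<bar> \<le> \<rho>"
      unfolding D_def by (rule hom[OF sub])
    then show ?thesis unfolding rk[OF that] .
  qed
  \<comment> \<open>Only the answers to finitely many queries are kept, so that the outputs become
    distributions on the finite set \<open>Pow Q\<close>.\<close>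
  define pat where "pat g = {k\<in>Q. g (x (b k))}" for g
  have fQ: "finite Q" by (simp add: Q_def)
  have meas: "{g. pat g = w} \<in> sets hyp_space" for w
    unfolding pat_def by (rule pattern_measurable[OF fQ])
  define \<mu> where "\<mu> j w = run A m (D j) {g. pat g = w}" for j w
  have sum\<mu>: "sum (\<mu> j) F = run A m (D j) {g. pat g \<in> F}" if "F \<subseteq> Pow Q" for j F
  proof -
    have "(\<Union>w\<in>F. {g. pat g = w}) = {g. pat g \<in> F}" by auto
    moreover have "finite F" using that fQ by (simp add: finite_subset)
    moreover have "disjoint_family_on (\<lambda>w. {g. pat g = w}) F" by (auto simp: disjoint_family_on_def)
    ultimately show ?thesis
      using run_sum_partition[OF A, of F "\<lambda>w. {g. pat g = w}" m "D j"] meas by (simp add: \<mu>_def)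
  qed
  have measF: "{g. pat g \<in> F} \<in> sets hyp_space" if "F \<subseteq> Pow Q" for F
  proof -
    have "{g. pat g \<in> F} = (\<Union>w\<in>F. {g. pat g = w})" by auto
    moreover have "finite F" using that fQ finite_subset by blast
    ultimately show ?thesis using meas by auto
  qed
  have \<phi>: "sum (\<mu> j) (Pow Q \<inter> {w. k \<in> w}) = run A m (D j) {g. g (x (b k))}" if "k \<in> Q" for j k
  proof -
    have "{g. pat g \<in> Pow Q \<inter> {w. k \<in> w}} = {g. g (x (b k))}" using that by (auto simp: pat_def)
    then show ?thesis by (simp add: sum\<mu>)
  qed
  \<comment> \<open>The level lies midway between the two predicted values; the margin is half the
    jump, reduced by the homogeneity error.\<close>
  let ?r = "(p i + p (Suc i)) / 2" and ?\<Delta> = "\<eta> / 2 - \<rho>" and ?\<delta> = "\<delta>' + (real m / real n)\<^sup>2"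
  have lo: "run A m (D j) {g. g (x (b k))} \<le> ?r - ?\<Delta>" if "k \<le> j" "j < K" for j k
  proof -
    have "\<bar>run A m (D j) {g. g (x (b k))} - p i\<bar> \<le> \<rho>" using q[of j k] that by simp
    moreover have "p i \<le> ?r - \<eta> / 2" using jump by (simp add: field_simps)
    ultimately show ?thesis by (simp add: abs_le_iff)
  qed
  have hi: "?r + ?\<Delta> \<le> run A m (D j) {g. g (x (b k))}" if "j < k" "k < K" for j k
  proof -
    have "\<bar>run A m (D j) {g. g (x (b k))} - p (Suc i)\<bar> \<le> \<rho>" using q[of j k] that by simp
    moreover have "?r + \<eta> / 2 \<le> p (Suc i)" using jump by (simp add: field_simps)
    ultimately show ?thesis by (simp add: abs_le_iff)
  qed
  have "0 \<le> ?\<delta>" using \<delta> by simp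
  then have \<Delta>: "0 \<le> ?\<Delta>" using \<gamma> by simp
  show ?thesis
  proof (rule indistinguishable_thresholds_bound[where \<Omega> = "Pow Q" and \<mu> = \<mu> and \<phi> = "\<lambda>k. {w. k \<in> w}" and r = ?r and s = s])
    show "sum (\<mu> j) (Pow Q) = 1" for j
    proof -
      have "{g. pat g \<in> Pow Q} = UNIV" by (auto simp: pat_def)
      then show ?thesis using run_UNIV[OF A] by (simp add: sum\<mu>)
    qed
    show "sum (\<mu> j) F \<le> exp \<epsilon>' * sum (\<mu> 0) F + ?\<delta>" if "j < 2 ^ s" "F \<subseteq> Pow Q" for j F
    proof -
      have jK: "j < K" using that(1) by (simp add: K_def)
      have "run A m (D j) {g. pat g \<in> F} \<le> exp \<epsilon>' * run A m (D 0) {g. pat g \<in> F} + \<delta>' + (real m / real n)\<^sup>2"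
        unfolding D_def
      proof (rule run_balanced_dp[OF A dp measF[OF that(2)] \<epsilon> \<delta> V(1) _ _ _ V(2)])
        show "a j \<notin> V" "a 0 \<notin> V" using aV jK K by auto
        show "v < a j \<longleftrightarrow> v < a 0" if "v \<in> V" for v using sep[OF that jK] .
      qed
      then show ?thesis using that(2) by (simp add: sum\<mu>)
    qed
    \<comment> \<open>The values of \<open>p\<close> are not known to be probabilities; the bounds
      on \<open>?r\<close> come from actual runs at query 1, which exists because
      \<open>2 \<le> K\<close>.\<close>
    show "0 \<le> ?r" using lo[of 1 1] K \<Delta> run_nonneg[of A m "D 1" "{g. g (x (b 1))}"] by linarith
    show "?r \<le> 1" using hi[of 0 1] K \<Delta> run_le_1[OF A, of m "D 0" "{g. g (x (b 1))}"] by linarith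
    show "sum (\<mu> j) (Pow Q \<inter> {w. k \<in> w}) \<le> ?r - ?\<Delta>" if "k \<le> j" "0 < k" "j < 2 ^ s" for j k
    proof -
      have "k \<in> Q" "j < K" using that by (simp_all add: Q_def K_def)
      then show ?thesis using lo[OF that(1)] \<phi> by simp
    qed
    show "?r + ?\<Delta> \<le> sum (\<mu> j) (Pow Q \<inter> {w. k \<in> w})" if "j < k" "k < 2 ^ s" for j k
    proof -
      have "k \<in> Q" "k < K" using that by (simp_all add: Q_def K_def)
      then show ?thesis using hi[OF that(1)] \<phi> by simp
    qed
    show "?\<delta> \<le> ?\<Delta>" by (rule \<gamma>)
  qed (auto simp: fQ \<mu>_def run_nonneg)
qed

lemma left_right_error:
  fixes e :: "nat \<Rightarrow> real"
  assumes "\<And>j. 0 \<le> e j" "(\<Sum>j<2 * h. e j) \<le> 2 * real h * \<gamma>" "0 < h"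
  shows "\<exists>j<h. e j \<le> 2 * \<gamma>" "\<exists>j\<ge>h. j < 2 * h \<and> e j \<le> 2 * \<gamma>"
proof -
  have split: "(\<Sum>j<2 * h. e j) = (\<Sum>j<h. e j) + (\<Sum>j=h..<2 * h. e j)"
    using sum.atLeastLessThan_concat[of 0 h "2 * h" e] by (simp add: lessThan_atLeast0)
  have ge: "0 \<le> (\<Sum>j<h. e j)" "0 \<le> (\<Sum>j=h..<2 * h. e j)" using assms(1) by (auto intro: sum_nonneg)
  show "\<exists>j<h. e j \<le> 2 * \<gamma>"
  proof (rule ccontr)
    assume "\<not> ?thesis"
    then have "(\<Sum>j<h. 2 * \<gamma>) < (\<Sum>j<h. e j)"
      using assms(3) by (intro sum_strict_mono) (auto simp: not_le)
    then show False using split ge assms(2) by (simp add: mult_ac)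
  qed
  show "\<exists>j\<ge>h. j < 2 * h \<and> e j \<le> 2 * \<gamma>"
  proof (rule ccontr)
    assume "\<not> ?thesis"
    then have "(\<Sum>j=h..<2 * h. 2 * \<gamma>) < (\<Sum>j=h..<2 * h. e j)"
      using assms(3) by (intro sum_strict_mono) (auto simp: not_le)
    then show False using split ge assms(2) by (simp add: mult_ac)
  qed
qed

text \<open>Accuracy speaks of sample points, homogeneity of points outside the sample. The sample
  therefore sits on even indices: replacing \<open>2 * j\<close> by \<open>2 * j + 1\<close> makes
  \<open>2 * j\<close> an unseen point of the same rank, and by privacy the output hardly changes. A
  well predicted point in each half gives \<open>p a \<le> 1 / 4\<close> and
  \<open>3 / 4 \<le> p b\<close>, a difference spread over at most \<open>n\<close> ranks.\<close>

lemma accuracy_jump: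
  fixes x :: "nat \<Rightarrow> 'a"
  assumes A: "randomized_alg A" and dp: "is_dp_on_size A m \<epsilon> \<delta>" and lr: "is_learner H A m \<alpha> \<beta>"
    and \<epsilon>: "\<epsilon> \<le> \<epsilon>'" "0 \<le> \<epsilon>'" and \<delta>: "\<delta> \<le> \<delta>'" "0 \<le> \<delta>'"
    and thr: "\<And>c. 1 \<le> c \<Longrightarrow> c < M \<Longrightarrow> \<exists>g\<in>H. \<forall>t<M. g (x t) \<longleftrightarrow> c \<le> t"
    and hom: "\<And>T t. T \<subseteq> {..<M} \<Longrightarrow> card T = n \<Longrightarrow> t \<in> {..<M} - T \<Longrightarrow>
        \<bar>run A m (balanced h x T) {g. g (x t)} - p (rank_in T t)\<bar> \<le> \<rho>"
    and n: "n = 2 * h" "1 \<le> h" and M: "2 * n < M"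
    and small: "exp \<epsilon>' * (2 * (max 0 \<alpha> + \<beta>)) + (\<delta>' + (real m / real n)\<^sup>2) + \<rho> \<le> 1 / 4"
  shows "\<exists>i<n. 1 / (2 * real n) \<le> p (Suc i) - p i"
proof -
  define W where "W = (\<lambda>j. 2 * j) ` {..<n}"
  define w where "w j = insert (2 * j + 1) (W - {2 * j})" for j
  let ?\<gamma> = "max 0 \<alpha> + \<beta>" and ?\<delta> = "\<delta>' + (real m / real n)\<^sup>2"
  have W: "finite W" "W \<subseteq> {..<M}" "card W = n" "W \<noteq> {}"
    using n M by (auto simp: W_def card_image inj_on_def lessThan_empty_iff)
  have rk: "rank_in W (2 * j) = j" if "j < n" for j
  proof -
    have "{u\<in>W. u < 2 * j} = (\<lambda>j. 2 * j) ` {..<j}" using that by (auto simp: W_def)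
    then show ?thesis by (simp add: rank_in_def card_image inj_on_def)
  qed
  define e where "e j = run A m (balanced h x W) {g. g (x (2 * j)) \<noteq> (h \<le> j)}" for j
  have "(\<Sum>t\<in>W. run A m (balanced h x W) {g. g (x t) \<noteq> (h \<le> rank_in W t)}) \<le> real (card W) * ?\<gamma>"
    using run_uniform_errors[OF A lr W(1,4), of "\<lambda>t. (x t, h \<le> rank_in W t)"]
      balanced_realizable[of M H x, OF thr W(2), of h] n W(3)
    by (simp add: balanced_def)
  also have "(\<Sum>t\<in>W. run A m (balanced h x W) {g. g (x t) \<noteq> (h \<le> rank_in W t)}) = (\<Sum>j<n. e j)"
    unfolding W_def[symmetric] e_def
    by (subst (1) W_def, subst sum.reindex) (auto simp: inj_on_def rk intro!: sum.cong)
  finally have tot: "(\<Sum>j<2 * h. e j) \<le> 2 * real h * ?\<gamma>" using W(3) n(1) by simp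
  have move: "run A m (balanced h x (w j)) E \<le> exp \<epsilon>' * run A m (balanced h x W) E + ?\<delta>"
    if "j < n" "E \<in> sets hyp_space" for j E
  proof -
    have "W = insert (2 * j) (W - {2 * j})" using that by (auto simp: W_def)
    moreover have "run A m (balanced h x (w j)) E
        \<le> exp \<epsilon>' * run A m (balanced h x (insert (2 * j) (W - {2 * j}))) E + \<delta>' + (real m / real n)\<^sup>2"
      unfolding w_def
    proof (intro run_balanced_dp[OF A dp that(2) \<epsilon> \<delta>])
      have "2 * j + 1 \<noteq> 2 * k" for k :: nat by presburger
      then show "2 * j + 1 \<notin> W - {2 * j}" by (auto simp: W_def)
      show "card (W - {2 * j}) + 1 = n"
        using W that(1) by (subst card_Diff_singleton) (auto simp: W_def)
    qed (use W in auto)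
    ultimately show ?thesis by simp
  qed
  have near: "\<bar>run A m (balanced h x (w j)) {g. g (x (2 * j))} - p j\<bar> \<le> \<rho>" if "j < n" for j
  proof -
    have mem: "2 * j \<in> W" "2 * j + 1 \<notin> W" using that by (auto simp: W_def) presburger
    have "{u\<in>w j. u < 2 * j} = {u\<in>W. u < 2 * j}" by (auto simp: w_def)
    then have "rank_in (w j) (2 * j) = j" using rk[OF that] by (simp add: rank_in_def)
    moreover have "card (w j) = n" using W mem n by (simp add: w_def card_Diff_singleton)
    moreover have "w j \<subseteq> {..<M}" using W(2) that M by (auto simp: w_def)
    moreover have "2 * j \<in> {..<M} - w j" using that M by (auto simp: w_def)
    ultimately show ?thesis using hom[of "w j" "2 * j"] by simp
  qed
  have e0: "0 \<le> e j" for j using run_nonneg by (simp add: e_def)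
  obtain a where a: "a < h" "e a \<le> 2 * ?\<gamma>"
    using left_right_error(1)[OF e0 tot] n(2) by auto
  obtain b where b: "h \<le> b" "b < n" "e b \<le> 2 * ?\<gamma>"
    using left_right_error(2)[OF e0 tot] n by auto
  have mono: "exp \<epsilon>' * c \<le> exp \<epsilon>' * (2 * ?\<gamma>)" if "c \<le> 2 * ?\<gamma>" for c
    using that by simp
  have pa: "p a \<le> 1 / 4"
  proof -
    have "run A m (balanced h x (w a)) {g. g (x (2 * a))} \<le> exp \<epsilon>' * e a + ?\<delta>"
      using move[of a "{g. g (x (2 * a))}"] a(1) n by (simp add: e_def)
    then show ?thesis using near[of a] mono[OF a(2)] small a(1) n by linarith
  qed
  have pb: "3 / 4 \<le> p b"
  proof -
    have "run A m (balanced h x (w b)) {g. g (x (2 * b)) = False} \<le> exp \<epsilon>' * e b + ?\<delta>"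
      using move[of b, OF _ hyp_space_label[of "x (2 * b)" False]] b by (simp add: e_def)
    moreover have "run A m (balanced h x (w b)) {g. g (x (2 * b)) = False}
        = 1 - run A m (balanced h x (w b)) {g. g (x (2 * b))}"
      (is "?l = 1 - ?r")
    proof -
      have u: "(\<Union>y\<in>UNIV. {g. g (x (2 * b)) = y}) = UNIV" by auto
      have "run A m (balanced h x (w b)) (\<Union>y\<in>UNIV. {g. g (x (2 * b)) = y})
          = (\<Sum>y\<in>UNIV. run A m (balanced h x (w b)) {g. g (x (2 * b)) = y})"
        by (rule run_sum_partition[OF A]) (auto simp: hyp_space_label disjoint_family_on_def)
      then have "1 = (\<Sum>y\<in>UNIV. run A m (balanced h x (w b)) {g. g (x (2 * b)) = y})"
        unfolding u run_UNIV[OF A] .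
      then show ?thesis by (simp add: UNIV_bool)
    qed
    ultimately show ?thesis using near[of b] mono[OF b(3)] small b(2) by linarith
  qed
  have "\<exists>i. a \<le> i \<and> i < b \<and> 1 / (2 * real n) \<le> p (Suc i) - p i"
  proof (rule exists_jump)
    show "a < b" using a b by simp
    have "(real b - real a) * (1 / (2 * real n)) \<le> real n * (1 / (2 * real n))"
      using b(2) by (intro mult_right_mono) auto
    also have "\<dots> = 1 / 2" using n by simp
    finally show "(real b - real a) * (1 / (2 * real n)) \<le> p b - p a" using pa pb by linarith
  qed
  then show ?thesis using b(2) less_trans by blast
qed

lemma learnable_imp_mistake_tree_bounded:
  assumes "approx_DP_PAC_learnable H"
  shows "\<exists>d. \<not> mistake_tree H UNIV d []"
proof (rule ccontr)
  assume "\<not> ?thesis"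
  then have sh: "\<And>d. mistake_tree H UNIV d []" by simp
  from assms obtain \<alpha> \<beta> A \<epsilon> \<delta> where ab: "\<alpha> \<longlonglongrightarrow> 0" "\<beta> \<longlonglongrightarrow> 0"
    and A: "randomized_alg A" and \<delta>: "superpoly_small \<delta>"
    and lr: "\<And>m. is_learner H A m (\<alpha> m) (\<beta> m)" and dp: "\<And>m. is_dp_on_size A m \<epsilon> (\<delta> m)"
    unfolding approx_DP_PAC_learnable_def by blast
  define \<epsilon>' where "\<epsilon>' = max \<epsilon> 0"
  have "(\<lambda>m. exp \<epsilon>' * (2 * (max 0 (\<alpha> m) + \<beta> m))) \<longlonglongrightarrow> exp \<epsilon>' * (2 * (max 0 0 + 0))"
    by (intro tendsto_intros ab)
  then have ev1: "eventually (\<lambda>m. exp \<epsilon>' * (2 * (max 0 (\<alpha> m) + \<beta> m)) < 1 / 16) sequentially"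
    by (rule order_tendstoD) simp
  have ev2: "eventually (\<lambda>m. \<delta> m \<le> real m powr - 3) sequentially"
    using \<delta> by (auto simp: superpoly_small_def)
  \<comment> \<open>This is the bound \<open>1 / (16 * n)\<close> for the \<open>n\<close> defined
    below, which is quadratic in \<open>m\<close>; hence an exponent above 2.\<close>
  have ev3: "eventually (\<lambda>m::nat. real m powr - 3 \<le> 1 / (16 * (16 * (real m)\<^sup>2 + 16))) sequentially"
    by real_asymp
  obtain m where m: "exp \<epsilon>' * (2 * (max 0 (\<alpha> m) + \<beta> m)) < 1 / 16"
    "\<delta> m \<le> 1 / (16 * (16 * (real m)\<^sup>2 + 16))"
    using eventually_happens[OF eventually_conj[OF ev1 eventually_conj[OF ev2 ev3]]]
    by (auto intro: order_trans)
  \<comment> \<open>As \<open>n\<close> is at least \<open>16 * m^2\<close>, the double hit bound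
    \<open>(m / n)^2\<close> is at most \<open>1 / (16 * n)\<close>. Half the jump is
    \<open>4 / (16 * n)\<close>; \<rho>, \<open>\<delta>'\<close> and the double hits use up three
    of these four parts, and one remains as margin.\<close>
  define h where "h = 8 * m\<^sup>2 + 8"
  define n where "n = 2 * h"
  have rn: "real n = 16 * (real m)\<^sup>2 + 16" by (simp add: n_def h_def)
  define \<rho> where "\<rho> = 1 / (16 * real n)"
  define \<delta>' where "\<delta>' = 1 / (16 * real n)"
  have \<delta>': "\<delta> m \<le> \<delta>'" "0 \<le> \<delta>'" using m(2) by (simp_all add: \<delta>'_def rn)
  have n16: "16 \<le> real n" by (simp add: rn)
  have sq: "(real m / real n)\<^sup>2 \<le> 1 / (16 * real n)"
    using n16 by (simp add: power_divide divide_simps power2_eq_square[of "real n"]) (simp add: rn)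
  define z where "z = 1 / (2 * real n) / 2 - \<rho> - (\<delta>' + (real m / real n)\<^sup>2)"
  have z: "0 < z"
  proof -
    have "1 / (16 * real n) \<le> z" using sq unfolding z_def \<rho>_def \<delta>'_def by (simp add: field_simps)
    moreover have "0 < 1 / (16 * real n)" using n16 by simp
    ultimately show ?thesis by linarith
  qed
  obtain s0 :: nat where s0: "(exp \<epsilon>')\<^sup>2 / z\<^sup>2 < real s0" using reals_Archimedean2 by blast
  define s where "s = Suc s0"
  have s: "(exp \<epsilon>')\<^sup>2 < real s * z\<^sup>2"
    using s0 z by (simp add: s_def field_simps add_strict_increasing)
  \<comment> \<open>Enough indices both for \<open>accuracy_jump\<close> and for the
    \<open>2 ^ s\<close> positions of the moving point in \<open>no_jump\<close>.\<close>
  define M where "M = 2 * n + 2 * 2 ^ s + 1"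
  obtain N :: nat where N: "\<forall>q :: nat set \<Rightarrow> nat \<Rightarrow> real. (\<forall>W x. 0 \<le> q W x \<and> q W x \<le> 1) \<longrightarrow>
    (\<exists>y p. strict_mono_on {..<M} y \<and> y ` {..<M} \<subseteq> {..<N} \<and>
      (\<forall>T t. T \<subseteq> {..<M} \<longrightarrow> card T = n \<longrightarrow> t \<in> {..<M} - T \<longrightarrow> \<bar>q (y ` T) (y t) - p (rank_in T t)\<bar> \<le> \<rho>))"
    using homogeneous_sequence[of \<rho> n M] n16 by (auto simp: \<rho>_def M_def)
  obtain x :: "nat \<Rightarrow> 'a" where x: "\<And>c. 1 \<le> c \<Longrightarrow> c < N \<Longrightarrow> \<exists>g\<in>H. \<forall>j<N. g (x j) \<longleftrightarrow> c \<le> j"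
    using mistake_tree_thresholds[of H N] sh by blast
  obtain y p where y: "strict_mono_on {..<M} y" "y ` {..<M} \<subseteq> {..<N}"
    and hom0: "\<And>T t. T \<subseteq> {..<M} \<Longrightarrow> card T = n \<Longrightarrow> t \<in> {..<M} - T \<Longrightarrow>
      \<bar>run A m (balanced h x (y ` T)) {g. g (x (y t))} - p (rank_in T t)\<bar> \<le> \<rho>"
    using N[rule_format, of "\<lambda>W t. run A m (balanced h x W) {g. g (x t)}"] run_nonneg run_le_1[OF A]
    by blast
  have hom: "\<bar>run A m (balanced h (x \<circ> y) T) {g. g ((x \<circ> y) t)} - p (rank_in T t)\<bar> \<le> \<rho>"
    if "T \<subseteq> {..<M}" "card T = n" "t \<in> {..<M} - T" for T t
  proof -
    have "T \<noteq> {}" using that(2) n16 by auto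
    then show ?thesis using hom0[OF that] balanced_image[OF y(1) that(1), of h x] by simp
  qed
  have thr: "\<exists>g\<in>H. \<forall>t<M. g ((x \<circ> y) t) \<longleftrightarrow> c \<le> t" if "1 \<le> c" "c < M" for c
  proof -
    have "y 0 < y c" using that by (intro strict_mono_onD[OF y(1)]) auto
    moreover have "y c < N" using y(2) that by auto
    ultimately obtain g where g: "g \<in> H" "\<And>j. j < N \<Longrightarrow> g (x j) \<longleftrightarrow> y c \<le> j"
      using x[of "y c"] by auto
    have "g ((x \<circ> y) t) \<longleftrightarrow> c \<le> t" if "t < M" for t
      using g(2)[of "y t"] y(2) that strict_mono_on_less_eq[OF y(1), of c t] \<open>c < M\<close> by auto
    then show ?thesis using g(1) by blast
  qed
  have \<epsilon>: "\<epsilon> \<le> \<epsilon>'" "0 \<le> \<epsilon>'" by (auto simp: \<epsilon>'_def)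
  have "1 / (16 * real n) \<le> 1 / 16" using n16 by simp
  then have "exp \<epsilon>' * (2 * (max 0 (\<alpha> m) + \<beta> m)) + (\<delta>' + (real m / real n)\<^sup>2) + \<rho> \<le> 1 / 4"
    using m(1) sq unfolding \<rho>_def \<delta>'_def by linarith
  moreover have "1 \<le> h" "2 * n < M" by (simp_all add: M_def h_def)
  ultimately have "\<exists>i<n. 1 / (2 * real n) \<le> p (Suc i) - p i"
    by (intro accuracy_jump[where x = "x \<circ> y" and p = p, OF A dp lr \<epsilon> \<delta>' thr hom n_def])
  then obtain i where i: "i < n" "1 / (2 * real n) \<le> p (Suc i) - p i" by blast
  have "n + 2 * 2 ^ s < M" "1 \<le> s" "\<delta>' + (real m / real n)\<^sup>2 \<le> 1 / (2 * real n) / 2 - \<rho>"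
    using z n16 by (simp_all add: M_def s_def z_def)
  then have "real s * z\<^sup>2 \<le> (exp \<epsilon>')\<^sup>2"
    unfolding z_def
    by (intro no_jump[where x = "x \<circ> y" and p = p, OF A dp \<epsilon> \<delta>' hom _ i(1) _ i(2)])
  then show False using s by simp
qed

section \<open>Global stability\<close>

text \<open>The standard optimal algorithm: it predicts the label whose version space has the larger
  Littlestone dimension, with ties going to True. Comparing trees depth by depth avoids naming the
  dimension and covers empty version spaces.\<close>

definition soa :: "('a \<Rightarrow> bool) set \<Rightarrow> 'a dataset \<Rightarrow> 'a \<Rightarrow> bool" where
  "soa H S x \<longleftrightarrow> (\<forall>j. mistake_tree H UNIV j ((x, False) # S) \<longrightarrow> mistake_tree H UNIV j ((x, True) # S))"

lemma soa_mistake: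
  assumes "\<not> mistake_tree H UNIV (Suc j) S" "soa H S x \<noteq> y"
  shows "\<not> mistake_tree H UNIV j ((x, y) # S)"
proof
  assume s: "mistake_tree H UNIV j ((x, y) # S)"
  have "mistake_tree H UNIV j ((x, \<not> y) # S)"
  proof (cases y)
    case True
    then obtain i where i: "mistake_tree H UNIV i ((x, False) # S)" "\<not> mistake_tree H UNIV i ((x, True) # S)"
      using assms(2) unfolding soa_def by blast
    have "j \<le> i"
    proof (rule ccontr)
      assume "\<not> j \<le> i"
      then have "mistake_tree H UNIV i ((x, y) # S)" using mistake_tree_antimono[OF s] by simp
      then show False using i(2) True by simp
    qed
    then show ?thesis using mistake_tree_antimono[OF i(1)] True by simp
  next
    case False
    then show ?thesis using s assms(2) unfolding soa_def by simp
  qed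
  then have "mistake_tree H UNIV j ((x, z) # S)" for z using s by (cases "z = y") auto
  then show False using assms(1) by auto
qed

text \<open>A label that contradicts \<open>S\<close> has no tree of any depth, so it loses the
  comparison.\<close>

lemma soa_consistent:
  assumes "realizable_data H S"
  shows "consistent (soa H S) S"
  unfolding consistent_iff
proof clarify
  fix x y assume xy: "(x, y) \<in> set S"
  have no: "\<not> mistake_tree H UNIV j ((x, \<not> y) # S)" for j
  proof
    assume "mistake_tree H UNIV j ((x, \<not> y) # S)"
    then obtain h where "consistent h ((x, \<not> y) # S)"
      using mistake_tree_realizable unfolding realizable_data_def by blast
    then have "h x = (\<not> y)" "h x = y" using xy by (auto intro!: consistentD[of h])
    then show False by simp
  qed
  have yes: "mistake_tree H UNIV 0 ((x, y) # S)"
    using xy by (auto intro: realizable_data_mono[OF assms])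
  show "soa H S x = y"
  proof (cases y)
    case True
    then show ?thesis using no unfolding soa_def by simp
  next
    case False
    then have "mistake_tree H UNIV 0 ((x, False) # S)" "\<not> mistake_tree H UNIV 0 ((x, True) # S)"
      using no[of 0] yes by simp_all
    then have "\<not> soa H S x" unfolding soa_def by blast
    then show ?thesis using False by simp
  qed
qed

text \<open>A compactness argument: the points are labelled along their enumeration, and the labels
  given so far stay compatible with every finite sample from the support.\<close>

lemma limit_concept:
  fixes D :: "('a::countable \<times> bool) pmf"
  assumes D: "realizable_dist H D"
  obtains c where "\<And>S. consistent c S \<Longrightarrow> realizable_data H S"
    and "\<And>x y. (x, y) \<in> set_pmf D \<Longrightarrow> c x = y"
proof -
  define ok where "ok S \<longleftrightarrow> (\<forall>T. set T \<subseteq> set_pmf D \<longrightarrow> realizable_data H (S @ T))" for S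
  have ok0: "ok []"
    unfolding ok_def
  proof (intro allI impI)
    fix T assume T: "set T \<subseteq> set_pmf D"
    \<comment> \<open>A hypothesis with loss below every point mass of \<open>T\<close> cannot err
      on \<open>T\<close>; the 1 covers the empty \<open>T\<close>.\<close>
    define e where "e = Min (insert 1 (pmf D ` set T))"
    have "0 < e" using T by (auto simp: e_def pmf_positive)
    then obtain h where h: "h \<in> H" "loss D h < e" using D by (auto simp: realizable_dist_def)
    have "h x = y" if "(x, y) \<in> set T" for x y
    proof (rule ccontr)
      assume "h x \<noteq> y"
      then have "measure_pmf.prob D {(x, y)} \<le> loss D h"
        unfolding loss_def by (intro measure_pmf.finite_measure_mono) auto
      moreover have "e \<le> pmf D (x, y)" unfolding e_def using that by (intro Min_le) auto
      ultimately show False using h(2) by (simp add: measure_pmf_single)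
    qed
    then show "realizable_data H ([] @ T)" using h(1) by (auto simp: realizable_data_def consistent_iff)
  qed
  have ext: "\<exists>y. ok ((x, y) # S)" if S: "ok S" for x S
  proof (rule ccontr)
    assume "\<not> ?thesis"
    then obtain T where T: "\<And>y. set (T y) \<subseteq> set_pmf D" "\<And>y. \<not> realizable_data H (((x, y) # S) @ T y)"
      unfolding ok_def by metis
    \<comment> \<open>A hypothesis that fits both counterexamples gives \<open>x\<close> some label
      and refutes the counterexample for that label.\<close>
    have "realizable_data H (S @ T True @ T False)" using S T(1) by (auto simp: ok_def)
    then obtain h where h: "h \<in> H" "consistent h (S @ T True @ T False)"
      by (auto simp: realizable_data_def)
    have "consistent h (((x, h x) # S) @ T (h x))"
      using h(2) by (cases "h x") (auto simp: consistent_iff)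
    then show False using T(2)[of "h x"] h(1) by (auto simp: realizable_data_def)
  qed
  define W where "W = rec_nat [] (\<lambda>k S. (from_nat k :: 'a, SOME y. ok ((from_nat k, y) # S)) # S)"
  have W: "W 0 = []" "W (Suc k) = (from_nat k, SOME y. ok ((from_nat k, y) # W k)) # W k" for k
    by (simp_all add: W_def)
  have okW: "ok (W k)" for k
    by (induction k) (auto simp: W ok0 intro: someI_ex[OF ext])
  define c where "c x = (SOME y. ok ((x, y) # W (to_nat x)))" for x
  have cW: "(x, c x) \<in> set (W k)" if "to_nat x < k" for x k
    using that by (induction k) (auto simp: W c_def less_Suc_eq)
  show thesis
  proof
    fix S assume S: "consistent c S"
    obtain k where k: "\<And>x. x \<in> fst ` set S \<Longrightarrow> to_nat x < k"
      using finite_nat_bounded[of "to_nat ` fst ` set S"] by auto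
    have "set S \<subseteq> set (W k)"
    proof safe
      fix x y assume xy: "(x, y) \<in> set S"
      then have "x \<in> fst ` set S" by force
      then show "(x, y) \<in> set (W k)" using cW k consistentD[OF S xy] by auto
    qed
    moreover have "realizable_data H (W k @ [])" using okW[of k, unfolded ok_def, rule_format, of "[]"] by simp
    ultimately show "realizable_data H S" by (auto intro: realizable_data_mono)
  next
    fix x y assume "(x, y) \<in> set_pmf D"
    then have "realizable_data H (W (Suc (to_nat x)) @ [(x, y)])"
      using okW[of "Suc (to_nat x)"] unfolding ok_def by simp
    then obtain h where h: "consistent h (W (Suc (to_nat x)) @ [(x, y)])"
      unfolding realizable_data_def by blast
    have "h x = c x" using cW[of x "Suc (to_nat x)"] by (intro consistentD[OF h]) simp
    moreover have "h x = y" by (rule consistentD[OF h]) simp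
    ultimately show "c x = y" by simp
  qed
qed

text \<open>An entrant is a surviving dataset with a fresh sample. A wrong coin may have made the
  two incompatible; the check ensures that every proposed hypothesis fits its fresh sample.\<close>

definition hypothesis :: "('a \<Rightarrow> bool) set \<Rightarrow> 'a dataset option \<times> 'a dataset \<Rightarrow> ('a \<Rightarrow> bool) option" where
  "hypothesis H p = (case fst p of None \<Rightarrow> None
     | Some S \<Rightarrow> if realizable_data H (snd p @ S) then Some (soa H (snd p @ S)) else None)"

text \<open>Equal hypotheses eliminate each other: such draws are frequent only if a single
  hypothesis is frequent, and that is the desired stability.\<close>

definition duel :: "('a \<Rightarrow> bool) set \<Rightarrow> 'a dataset option \<times> 'a dataset \<Rightarrow> 'a dataset option \<times> 'a dataset
    \<Rightarrow> bool \<Rightarrow> 'a dataset option" where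
  "duel H p q b = (case (hypothesis H p, hypothesis H q) of
     (Some f, Some g) \<Rightarrow> if f = g then None else
       let x = (SOME x. f x \<noteq> g x); r = (if f x \<noteq> b then p else q)
       in Some ((x, b) # snd r @ the (fst r))
   | _ \<Rightarrow> None)"

lemma hypothesis_SomeD:
  assumes "hypothesis H p = Some f"
  shows "\<exists>S. fst p = Some S \<and> realizable_data H (snd p @ S) \<and> f = soa H (snd p @ S)"
  using assms by (auto simp: hypothesis_def split: option.splits if_splits)

lemma hypothesis_consistent: "hypothesis H p = Some f \<Longrightarrow> consistent f (snd p)"
  using hypothesis_SomeD[of H p f] soa_consistent[of H "snd p @ _"] by (auto simp: consistent_iff)

lemma duel_SomeD:
  assumes "duel H p q b = Some S"
  shows "\<exists>r x R. r \<in> {p, q} \<and> fst r = Some R \<and> S = (x, b) # snd r @ R \<and> soa H (snd r @ R) x \<noteq> b"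
proof -
  obtain f g where fg: "hypothesis H p = Some f" "hypothesis H q = Some g" "f \<noteq> g"
    using assms by (auto simp: duel_def split: option.splits if_splits)
  define x where "x = (SOME x. f x \<noteq> g x)"
  have x: "f x \<noteq> g x" unfolding x_def using fg(3) by (intro someI_ex[of "\<lambda>x. f x \<noteq> g x"]) auto
  have S: "S = (let r = (if f x \<noteq> b then p else q) in (x, b) # snd r @ the (fst r))"
    using assms fg by (auto simp: duel_def x_def Let_def)
  obtain P Q where "fst p = Some P" "f = soa H (snd p @ P)" "fst q = Some Q" "g = soa H (snd q @ Q)"
    using hypothesis_SomeD[OF fg(1)] hypothesis_SomeD[OF fg(2)] by auto
  then show ?thesis
  proof (cases "f x \<noteq> b")
    case True
    then show ?thesis using S \<open>fst p = Some P\<close> \<open>f = soa H (snd p @ P)\<close>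
      by (intro exI[of _ p] exI[of _ x] exI[of _ P]) auto
  next
    case False
    then show ?thesis using S x \<open>fst q = Some Q\<close> \<open>g = soa H (snd q @ Q)\<close>
      by (intro exI[of _ q] exI[of _ x] exI[of _ Q]) auto
  qed
qed

abbreviation coin :: "bool pmf" where "coin \<equiv> bernoulli_pmf (1/2)"

fun tournament :: "('a \<Rightarrow> bool) set \<Rightarrow> nat \<Rightarrow> ('a \<times> bool) pmf \<Rightarrow> nat \<Rightarrow> 'a dataset option pmf" where
  "tournament H n D 0 = return_pmf (Some [])"
| "tournament H n D (Suc k) = do {
     p \<leftarrow> pair_pmf (tournament H n D k) (replicate_pmf n D);
     q \<leftarrow> pair_pmf (tournament H n D k) (replicate_pmf n D);
     b \<leftarrow> coin;
     return_pmf (duel H p q b)}"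

abbreviation entrant :: "('a \<Rightarrow> bool) set \<Rightarrow> nat \<Rightarrow> ('a \<times> bool) pmf \<Rightarrow> nat \<Rightarrow> ('a dataset option \<times> 'a dataset) pmf" where
  "entrant H n D k \<equiv> pair_pmf (tournament H n D k) (replicate_pmf n D)"

text \<open>Every duel is decided by a mistake of the optimal algorithm on the surviving dataset.\<close>

lemma tournament_not_mistake_tree:
  assumes "\<not> mistake_tree H UNIV d []"
  shows "k \<le> d \<Longrightarrow> Some S \<in> set_pmf (tournament H n D k) \<Longrightarrow> \<not> mistake_tree H UNIV (d - k) S"
proof (induction k arbitrary: S)
  case 0 then show ?case using assms by simp
next
  case (Suc k)
  from Suc.prems(2) obtain p q b where pq: "p \<in> set_pmf (entrant H n D k)"
    "q \<in> set_pmf (entrant H n D k)" "duel H p q b = Some S"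
    by (auto simp del: set_pair_pmf simp: set_bind_pmf)
  from duel_SomeD[OF this(3)] obtain r x R where r: "r \<in> {p, q}" "fst r = Some R"
    "S = (x, b) # snd r @ R" "soa H (snd r @ R) x \<noteq> b" by blast
  have "Some R \<in> set_pmf (tournament H n D k)" using pq(1,2) r(1,2) by auto
  then have "\<not> mistake_tree H UNIV (d - k) R" using Suc by simp
  then have "\<not> mistake_tree H UNIV (d - k) (snd r @ R)" using mistake_tree_mono[of H UNIV "d - k" "snd r @ R" R] by auto
  moreover have "d - k = Suc (d - Suc k)" using Suc.prems(1) by simp
  ultimately show ?case using soa_mistake[of H "d - Suc k" "snd r @ R" x b] r(3,4) by simp
qed

definition survival :: "('a \<Rightarrow> bool) set \<Rightarrow> nat \<Rightarrow> ('a \<times> bool) pmf \<Rightarrow> ('a \<Rightarrow> bool) \<Rightarrow> nat \<Rightarrow> real" where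
  "survival H n D c k = measure_pmf.prob (tournament H n D k) {r. \<exists>S. r = Some S \<and> consistent c S}"

lemma survival_entrant:
  "survival H n D c k = measure_pmf.prob (entrant H n D k) {p. \<exists>S. fst p = Some S \<and> consistent c S}"
proof -
  have "survival H n D c k = measure_pmf.prob (map_pmf fst (entrant H n D k)) {r. \<exists>S. r = Some S \<and> consistent c S}"
    by (simp only: survival_def map_fst_pair_pmf)
  then show ?thesis by (simp add: vimage_def)
qed

text \<open>With \<open>q\<close> the survival probability, two independent survivors propose
  different hypotheses with probability at least \<open>q * (q / 2)\<close>, and the coin agrees
  with \<open>c\<close> at the point of disagreement with probability 1/2. Whichever side errs then,
  its new dataset is consistent with \<open>c\<close>.\<close>

lemma survival_step:
  assumes c: "\<And>S. consistent c S \<Longrightarrow> realizable_data H S" "\<And>x y. (x, y) \<in> set_pmf D \<Longrightarrow> c x = y"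
    and unstable: "\<And>f. measure_pmf.prob (entrant H n D k) {p. hypothesis H p = Some f} \<le> survival H n D c k / 2"
  shows "(survival H n D c k)\<^sup>2 / 4 \<le> survival H n D c (Suc k)"
proof -
  let ?P = "entrant H n D k" and ?q = "survival H n D c k"
  \<comment> \<open>Restricting to the support ensures that the fresh samples are labelled by
    \<open>c\<close>.\<close>
  define G where "G = {p. \<exists>S. fst p = Some S \<and> consistent c (S :: 'a dataset)} \<inter> (set_pmf ?P)"
  define win where "win p q = measure_pmf.prob coin {b. \<exists>S. duel H p q b = Some S \<and> consistent c S}" for p q
  have q: "?q = measure_pmf.prob ?P G"
    unfolding survival_entrant G_def by (rule measure_Int_set_pmf[symmetric])
  have hyp: "\<exists>S f. fst p = Some S \<and> consistent c (snd p @ S) \<and> hypothesis H p = Some f" if pG: "p \<in> G" for p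
  proof -
    obtain S where S: "fst p = Some S" "consistent c S" using pG by (auto simp: G_def)
    have "set (snd p) \<subseteq> set_pmf D" using pG by (auto simp: G_def set_replicate_pmf)
    then have "consistent c (snd p @ S)" using S(2) c(2) by (auto simp: consistent_iff)
    then show ?thesis using S(1) c(1) by (auto simp: hypothesis_def)
  qed
  have win: "1 / 2 \<le> win p q" if pq: "p \<in> G" "q \<in> G" "hypothesis H p \<noteq> hypothesis H q" for p q
  proof -
    obtain S f where S: "fst p = Some S" "consistent c (snd p @ S)" "hypothesis H p = Some f"
      using hyp[OF pq(1)] by blast
    obtain T g where T: "fst q = Some T" "consistent c (snd q @ T)" "hypothesis H q = Some g"
      using hyp[OF pq(2)] by blast
    define x where "x = (SOME x. f x \<noteq> g x)"
    have "duel H p q (c x) = Some ((x, c x) # (if f x \<noteq> c x then snd p @ S else snd q @ T))"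
      using S T pq(3) by (simp add: duel_def x_def Let_def)
    moreover have "consistent c ((x, c x) # (if f x \<noteq> c x then snd p @ S else snd q @ T))"
      using S(2) T(2) by (auto simp: consistent_iff)
    ultimately have "{c x} \<subseteq> {b. \<exists>S. duel H p q b = Some S \<and> consistent c S}" by auto
    then have "measure_pmf.prob coin {c x} \<le> win p q"
      unfolding win_def by (intro measure_pmf.finite_measure_mono) auto
    then show ?thesis by (cases "c x") (simp_all add: measure_pmf_single)
  qed
  have win01: "0 \<le> win p q" "win p q \<le> 1" for p q by (auto simp: win_def)
  have inner: "?q / 4 \<le> measure_pmf.expectation ?P (win p)" if p: "p \<in> G" for p
  proof -
    obtain f where f: "hypothesis H p = Some f" using hyp[OF p] by blast
    let ?N = "{r. hypothesis H r = Some f}"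
    have "?q \<le> measure_pmf.prob ?P (G - ?N) + measure_pmf.prob ?P ?N"
    proof -
      have "measure_pmf.prob ?P G \<le> measure_pmf.prob ?P ((G - ?N) \<union> ?N)"
        by (intro measure_pmf.finite_measure_mono) auto
      also have "\<dots> \<le> measure_pmf.prob ?P (G - ?N) + measure_pmf.prob ?P ?N"
        by (rule measure_Un_le) auto
      finally show ?thesis by (simp add: q)
    qed
    then have "?q / 4 \<le> 1 / 2 * measure_pmf.prob ?P (G - ?N)" using unstable[of f] by simp
    also have "\<dots> = measure_pmf.expectation ?P (\<lambda>r. 1 / 2 * indicator (G - ?N) r)" by simp
    also have "\<dots> \<le> measure_pmf.expectation ?P (win p)"
    proof (rule expectation_mono_pmf[where B = 1 and C = 1])
      fix r show "1 / 2 * indicator (G - ?N) r \<le> win p r"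
        using win[OF p, of r] win01[of p r] f by (cases "r \<in> G - ?N") auto
    qed (use win01 in \<open>auto simp: indicator_def\<close>)
    finally show ?thesis .
  qed
  have E01: "0 \<le> measure_pmf.expectation ?P (win p)" "measure_pmf.expectation ?P (win p) \<le> 1" for p
    using win01 expectation_mono_pmf[of ?P "win p" "\<lambda>_. 1" 1 1] by auto
  have q01: "0 \<le> ?q" "?q \<le> 1" by (auto simp: survival_def)
  have "?q\<^sup>2 / 4 = measure_pmf.expectation ?P (\<lambda>p. ?q / 4 * indicator G p)"
    by (simp add: power2_eq_square flip: q)
  also have "\<dots> \<le> measure_pmf.expectation ?P (\<lambda>p. measure_pmf.expectation ?P (win p))"
  proof (rule expectation_mono_pmf[where B = 1 and C = 1])
    fix p show "?q / 4 * indicator G p \<le> measure_pmf.expectation ?P (win p)"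
      using inner[of p] E01[of p] by (cases "p \<in> G") auto
  qed (use E01 q01 in \<open>auto simp: indicator_def\<close>)
  also have "\<dots> = survival H n D c (Suc k)"
    by (simp add: survival_def prob_bind_pmf win_def[abs_def] vimage_def flip: map_pmf_def)
  finally show ?thesis .
qed

text \<open>The recursion of \<open>survival_step\<close>, in closed form
  \<open>4 * (1 / 4) ^ (2 ^ k)\<close>.\<close>

fun stability :: "nat \<Rightarrow> real" where
  "stability 0 = 1"
| "stability (Suc k) = (stability k)\<^sup>2 / 4"

lemma stability_bounds: "0 < stability k \<and> stability k \<le> 1"
proof (induction k)
  case (Suc k)
  then have "(stability k)\<^sup>2 \<le> 1\<^sup>2" by (intro power_mono) auto
  then show ?case using Suc by simp
qed simp

lemma stability_antimono: "i \<le> j \<Longrightarrow> stability j \<le> stability i"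
proof (rule lift_Suc_antimono_le[of stability])
  fix k
  have "(stability k)\<^sup>2 \<le> stability k"
    using stability_bounds[of k] by (simp add: power2_eq_square mult_left_le)
  then show "stability (Suc k) \<le> stability k"
    using stability_bounds[of k] by simp
qed

text \<open>If no level were stable, datasets consistent with \<open>c\<close> would occur at level
  \<open>d\<close>; but a dataset of level \<open>d\<close> has no tree of depth 0, so it is not
  realizable.\<close>

lemma globally_stable:
  fixes D :: "('a::countable \<times> bool) pmf"
  assumes d: "\<not> mistake_tree H UNIV d []" and D: "realizable_dist H D"
  shows "\<exists>k<d. \<exists>f. stability d / 2 \<le> measure_pmf.prob (entrant H n D k) {p. hypothesis H p = Some f}"
proof (rule ccontr)
  assume neg: "\<not> ?thesis"
  obtain c where c: "\<And>S. consistent c S \<Longrightarrow> realizable_data H S" "\<And>x y. (x, y) \<in> set_pmf D \<Longrightarrow> c x = y"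
    using limit_concept[OF D] by blast
  have "k \<le> d \<Longrightarrow> stability k \<le> survival H n D c k" for k
  proof (induction k)
    case 0
    then show ?case by (simp add: survival_def consistent_iff)
  next
    case (Suc k)
    have le: "stability k \<le> survival H n D c k" using Suc by simp
    have "measure_pmf.prob (entrant H n D k) {p. hypothesis H p = Some f} \<le> survival H n D c k / 2" for f
    proof -
      have "measure_pmf.prob (entrant H n D k) {p. hypothesis H p = Some f} < stability d / 2"
        using neg Suc.prems by (meson Suc_le_eq not_le)
      also have "\<dots> \<le> survival H n D c k / 2"
        using stability_antimono[of k d] le Suc.prems by simp
      finally show ?thesis by simp
    qed
    then have "(survival H n D c k)\<^sup>2 / 4 \<le> survival H n D c (Suc k)" by (intro survival_step c)
    moreover have "(stability k)\<^sup>2 \<le> (survival H n D c k)\<^sup>2"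
      using le stability_bounds[of k] by (intro power_mono) auto
    ultimately show ?case by simp
  qed
  then have "0 < survival H n D c d" using stability_bounds[of d] less_le_trans by blast
  moreover have "survival H n D c d = 0"
  proof -
    have "set_pmf (tournament H n D d) \<inter> {r. \<exists>S. r = Some S \<and> consistent c S} = {}"
      using tournament_not_mistake_tree[OF d, of d] c(1) by auto
    then show ?thesis unfolding survival_def by (simp add: measure_pmf_zero_iff)
  qed
  ultimately show False by simp
qed

section \<open>Hypotheses of large error\<close>

lemma prob_consistent_replicate:
  "measure_pmf.prob (replicate_pmf n D) {T. consistent h T} = (1 - loss D h) ^ n"
proof (induction n)
  case 0 then show ?case by (simp add: consistent_iff)
next
  case (Suc n)
  have "{T. z # T \<in> {T. consistent h T}} = (if h (fst z) = snd z then {T. consistent h T} else {})" for z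
    by (auto simp: consistent_iff)
  then have "measure_pmf.prob (replicate_pmf (Suc n) D) {T. consistent h T}
      = measure_pmf.expectation D (\<lambda>z. (1 - loss D h) ^ n * indicator {z. h (fst z) = snd z} z)"
    unfolding prob_replicate_Suc using Suc by (intro Bochner_Integration.integral_cong) (auto simp: indicator_def)
  also have "\<dots> = (1 - loss D h) ^ n * measure_pmf.prob D {z. h (fst z) = snd z}" by simp
  also have "{z. h (fst z) = snd z} = UNIV - {(x, y). h x \<noteq> y}" by auto
  also have "measure_pmf.prob D \<dots> = 1 - loss D h"
    unfolding loss_def using measure_pmf.prob_compl[of "{(x, y). h x \<noteq> y}" D] by simp
  finally show ?case by simp
qed

lemma hypothesis_bad_rare:
  assumes "\<alpha> < loss D h" "0 \<le> \<alpha>"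
  shows "measure_pmf.prob (entrant H n D k) {p. hypothesis H p = Some h} \<le> (1 - \<alpha>) ^ n"
proof -
  have "measure_pmf.prob (entrant H n D k) {p. hypothesis H p = Some h}
      \<le> measure_pmf.prob (entrant H n D k) (snd -` {T. consistent h T})"
    by (intro measure_pmf.finite_measure_mono) (auto dest: hypothesis_consistent)
  also have "\<dots> = measure_pmf.prob (map_pmf snd (entrant H n D k)) {T. consistent h T}" by simp
  also have "\<dots> = (1 - loss D h) ^ n" by (simp only: map_snd_pair_pmf prob_consistent_replicate)
  also have "\<dots> \<le> (1 - \<alpha>) ^ n"
    using assms by (intro power_mono) (auto simp: loss_def)
  finally show ?thesis .
qed

section \<open>Blocks of independent samples\<close>

lemma bind_replicate_add:
  "bind_pmf (replicate_pmf (a + b) p) f =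
    bind_pmf (replicate_pmf a p) (\<lambda>xs. bind_pmf (replicate_pmf b p) (\<lambda>ys. f (xs @ ys)))"
  by (simp add: replicate_pmf_distrib bind_assoc_pmf bind_return_pmf)

fun tour_len :: "nat \<Rightarrow> nat \<Rightarrow> nat" where
  "tour_len n 0 = 0"
| "tour_len n (Suc k) = 2 * (tour_len n k + n) + 1"

text \<open>A deterministic version of the tournament: every example carries a coin (and a number,
  from which a block draws its level), and the last element of each segment contributes only its coin.\<close>

fun tour :: "('a \<Rightarrow> bool) set \<Rightarrow> nat \<Rightarrow> nat \<Rightarrow> (('a \<times> bool) \<times> bool \<times> nat) list \<Rightarrow> 'a dataset option" where
  "tour H n 0 u = Some []"
| "tour H n (Suc k) u = (let l = tour_len n k;
       e = (\<lambda>v. (tour H n k (take l v), map fst (take n (drop l v))))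
     in duel H (e u) (e (drop (l + n) u)) (fst (snd (u ! (2 * (l + n))))))"

definition entry :: "('a \<Rightarrow> bool) set \<Rightarrow> nat \<Rightarrow> nat \<Rightarrow> (('a \<times> bool) \<times> bool \<times> nat) list \<Rightarrow> 'a dataset option \<times> 'a dataset" where
  "entry H n k v = (tour H n k (take (tour_len n k) v), map fst (take n (drop (tour_len n k) v)))"

lemma tour_Suc:
  "tour H n (Suc k) u = duel H (entry H n k u) (entry H n k (drop (tour_len n k + n) u))
    (fst (snd (u ! (2 * (tour_len n k + n)))))"
  by (simp add: entry_def Let_def)

lemma entry_append: "length v = tour_len n k + n \<Longrightarrow> entry H n k (v @ w) = entry H n k v"
  by (simp add: entry_def)

lemma tour_entry_dist:
  assumes "map_pmf fst X = D" "map_pmf (\<lambda>z. fst (snd z)) X = coin"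
  shows "map_pmf (tour H n k) (replicate_pmf (tour_len n k) X) = tournament H n D k"
    and "map_pmf (entry H n k) (replicate_pmf (tour_len n k + n) X) = entrant H n D k"
proof -
  have entry: "map_pmf (entry H n k) (replicate_pmf (tour_len n k + n) X) = entrant H n D k"
    if "map_pmf (tour H n k) (replicate_pmf (tour_len n k) X) = tournament H n D k" for k
  proof -
    have "map_pmf (entry H n k) (replicate_pmf (tour_len n k + n) X) =
      bind_pmf (replicate_pmf (tour_len n k) X) (\<lambda>v. bind_pmf (replicate_pmf n X)
        (\<lambda>w. return_pmf (tour H n k v, map fst w)))"
      unfolding map_pmf_def bind_replicate_add
      by (intro bind_pmf_cong refl) (auto simp: entry_def dest!: length_replicate_pmf)
    also have "\<dots> = pair_pmf (map_pmf (tour H n k) (replicate_pmf (tour_len n k) X))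
        (map_pmf (map fst) (replicate_pmf n X))"
      by (simp add: pair_pmf_def bind_map_pmf)
    finally show ?thesis using that assms(1) by (simp add: map_replicate_pmf)
  qed
  have tour: "map_pmf (tour H n k) (replicate_pmf (tour_len n k) X) = tournament H n D k" for k
  proof (induction k)
    case (Suc k)
    define l where "l = tour_len n k + n"
    have len: "tour_len n (Suc k) = l + (l + 1)" by (simp add: l_def)
    have "map_pmf (tour H n (Suc k)) (replicate_pmf (tour_len n (Suc k)) X) =
      bind_pmf (replicate_pmf l X) (\<lambda>v. bind_pmf (replicate_pmf l X) (\<lambda>w. bind_pmf X
        (\<lambda>z. return_pmf (duel H (entry H n k v) (entry H n k w) (fst (snd z))))))"
      unfolding len map_pmf_def bind_replicate_add
    proof (rule bind_pmf_cong[OF refl], rule bind_pmf_cong[OF refl])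
      fix v w assume "v \<in> set_pmf (replicate_pmf l X)" "w \<in> set_pmf (replicate_pmf l X)"
      then have l: "length v = l" "length w = l" by (auto dest: length_replicate_pmf)
      have "tour H n (Suc k) (v @ w @ [z]) = duel H (entry H n k v) (entry H n k w) (fst (snd z))" for z
        using l unfolding l_def by (simp only: tour_Suc entry_append) (simp add: nth_append entry_append)
      then show "bind_pmf (replicate_pmf 1 X) (\<lambda>ys. return_pmf (tour H n (Suc k) (v @ w @ ys)))
          = bind_pmf X (\<lambda>z. return_pmf (duel H (entry H n k v) (entry H n k w) (fst (snd z))))"
        by (simp only: replicate_pmf_1 bind_map_pmf)
    qed
    also have "\<dots> = bind_pmf (map_pmf (entry H n k) (replicate_pmf l X)) (\<lambda>p.
        bind_pmf (map_pmf (entry H n k) (replicate_pmf l X)) (\<lambda>q.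
        bind_pmf (map_pmf (\<lambda>z. fst (snd z)) X) (\<lambda>b. return_pmf (duel H p q b))))"
      by (simp only: bind_map_pmf)
    also have "\<dots> = tournament H n D (Suc k)"
      unfolding l_def by (simp only: entry[OF Suc] assms(2) tournament.simps)
    finally show ?case .
  qed simp
  from tour show "map_pmf (tour H n k) (replicate_pmf (tour_len n k) X) = tournament H n D k" .
  from entry[OF tour] show "map_pmf (entry H n k) (replicate_pmf (tour_len n k + n) X) = entrant H n D k" .
qed

lemma tour_len_mono: "k \<le> d \<Longrightarrow> tour_len n k \<le> tour_len n d"
  by (rule lift_Suc_mono_le[of "tour_len n"]) auto

text \<open>The summand \<open>2 * n + 1\<close> turns the recursion into an exact doubling.\<close>

lemma tour_len_le: "tour_len n k + 2 * n + 1 \<le> 2 ^ (k + 1) * (n + 1)"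
  by (induction k) auto

text \<open>The stable level depends on the unknown distribution, so each block draws its level at
  random; this costs a factor \<open>d + 1\<close> in the stability bound.\<close>

definition block_hypothesis :: "('a \<Rightarrow> bool) set \<Rightarrow> nat \<Rightarrow> (('a \<times> bool) \<times> bool \<times> nat) list \<Rightarrow> ('a \<Rightarrow> bool) option" where
  "block_hypothesis H n u = hypothesis H (entry H n (snd (snd (hd u))) (tl u))"

text \<open>The randomness is attached to the examples so that neighbouring datasets can be compared
  under equal randomness; then at most one block changes its output.\<close>

definition extras :: "nat \<Rightarrow> (bool \<times> nat) pmf" where
  "extras d = pair_pmf coin (pmf_of_set {..d})"

definition block_dist :: "('a \<Rightarrow> bool) set \<Rightarrow> nat \<Rightarrow> ('a \<times> bool) pmf \<Rightarrow> nat \<Rightarrow> nat \<Rightarrow> ('a \<Rightarrow> bool) option pmf" where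
  "block_dist H n D d b = map_pmf (block_hypothesis H n) (replicate_pmf b (pair_pmf D (extras d)))"

lemma block_dist_eq:
  assumes "tour_len n d + n + 1 \<le> b"
  shows "block_dist H n D d b = bind_pmf (pmf_of_set {..d}) (\<lambda>k. map_pmf (hypothesis H) (entrant H n D k))"
proof -
  let ?X = "pair_pmf D (extras d)"
  have snd: "map_pmf (\<lambda>z. g (snd z)) ?X = map_pmf g (extras d)" for g :: "bool \<times> nat \<Rightarrow> bool"
    using arg_cong[OF map_snd_pair_pmf[of D "extras d"], of "map_pmf g"] by (simp add: map_pmf_comp)
  have snd': "map_pmf (\<lambda>z. g (snd z)) ?X = map_pmf g (extras d)" for g :: "bool \<times> nat \<Rightarrow> nat"
    using arg_cong[OF map_snd_pair_pmf[of D "extras d"], of "map_pmf g"] by (simp add: map_pmf_comp)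
  have X: "map_pmf fst ?X = D" "map_pmf (\<lambda>z. fst (snd z)) ?X = coin"
    "map_pmf (\<lambda>z. snd (snd z)) ?X = pmf_of_set {..d}"
    unfolding snd[of fst] snd'[of snd] unfolding extras_def
    by (rule map_fst_pair_pmf map_snd_pair_pmf)+
  obtain b' where b: "b = 1 + b'" using le_Suc_ex[of 1 b] assms by auto
  have inner: "map_pmf (\<lambda>v. hypothesis H (entry H n k v)) (replicate_pmf b' ?X)
      = map_pmf (hypothesis H) (entrant H n D k)" if "k \<le> d" for k
  proof -
    have "tour_len n k + n \<le> b'" using assms b tour_len_mono[OF that, of n] by simp
    then obtain r where r: "b' = (tour_len n k + n) + r" using le_Suc_ex by blast
    have "map_pmf (\<lambda>v. hypothesis H (entry H n k v)) (replicate_pmf b' ?X)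
        = bind_pmf (replicate_pmf (tour_len n k + n) ?X) (\<lambda>v. bind_pmf (replicate_pmf r ?X)
          (\<lambda>w. return_pmf (hypothesis H (entry H n k v))))"
      unfolding r map_pmf_def bind_replicate_add
      by (intro bind_pmf_cong refl) (auto simp: entry_def dest!: length_replicate_pmf)
    also have "\<dots> = map_pmf (hypothesis H) (map_pmf (entry H n k) (replicate_pmf (tour_len n k + n) ?X))"
      by (simp add: map_pmf_comp flip: map_pmf_def)
    finally show ?thesis unfolding tour_entry_dist(2)[OF X(1,2)] .
  qed
  have "block_dist H n D d b = bind_pmf ?X (\<lambda>z. map_pmf (\<lambda>v. hypothesis H (entry H n (snd (snd z)) v)) (replicate_pmf b' ?X))"
    unfolding block_dist_def b
    by (simp add: block_hypothesis_def map_bind_pmf map_pmf_def bind_assoc_pmf bind_return_pmf)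
  also have "\<dots> = bind_pmf (map_pmf (\<lambda>z. snd (snd z)) ?X) (\<lambda>k. map_pmf (\<lambda>v. hypothesis H (entry H n k v)) (replicate_pmf b' ?X))"
    by (simp only: bind_map_pmf)
  also have "\<dots> = bind_pmf (pmf_of_set {..d}) (\<lambda>k. map_pmf (hypothesis H) (entrant H n D k))"
    unfolding X(3) by (intro bind_pmf_cong refl inner) simp
  finally show ?thesis .
qed

lemma block_dist_stable:
  fixes D :: "('a::countable \<times> bool) pmf"
  assumes "tour_len n d + n + 1 \<le> b" "\<not> mistake_tree H UNIV d []" "realizable_dist H D"
  shows "\<exists>f. stability d / (2 * (real d + 1)) \<le> pmf (block_dist H n D d b) (Some f)"
proof -
  obtain k f where k: "k < d" "stability d / 2 \<le> measure_pmf.prob (entrant H n D k) {p. hypothesis H p = Some f}"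
    using globally_stable[OF assms(2,3)] by blast
  let ?P = "\<lambda>k. measure_pmf.prob (entrant H n D k) {p. hypothesis H p = Some f}"
  have "pmf (block_dist H n D d b) (Some f) = measure_pmf.expectation (pmf_of_set {..d}) ?P"
    unfolding block_dist_eq[OF assms(1)] pmf_bind by (simp add: pmf_map vimage_def)
  also have "\<dots> = (\<Sum>k\<le>d. ?P k) / (real d + 1)"
    by (simp add: integral_pmf_of_set add.commute)
  also have "\<dots> \<ge> ?P k / (real d + 1)"
    using k(1) member_le_sum[of k "{..d}" ?P] by (intro divide_right_mono) auto
  also have "?P k / (real d + 1) \<ge> stability d / 2 / (real d + 1)"
    using k(2) by (intro divide_right_mono) auto
  finally show ?thesis by (auto simp: mult.commute)
qed

lemma block_dist_bad:
  assumes "tour_len n d + n + 1 \<le> b" "\<alpha> < loss D h" "0 \<le> \<alpha>"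
  shows "pmf (block_dist H n D d b) (Some h) \<le> (1 - \<alpha>) ^ n"
proof -
  let ?P = "\<lambda>k. measure_pmf.prob (entrant H n D k) {p. hypothesis H p = Some h}"
  have "pmf (block_dist H n D d b) (Some h) = measure_pmf.expectation (pmf_of_set {..d}) ?P"
    unfolding block_dist_eq[OF assms(1)] pmf_bind by (simp add: pmf_map vimage_def)
  also have "\<dots> \<le> measure_pmf.expectation (pmf_of_set {..d}) (\<lambda>_. (1 - \<alpha>) ^ n)"
    using hypothesis_bad_rare[OF assms(2,3)]
    by (intro expectation_mono_pmf[where B = 1 and C = "\<bar>(1 - \<alpha>) ^ n\<bar>"]) auto
  finally show ?thesis by simp
qed

section \<open>Cutting a sample into blocks\<close>

definition chunks :: "nat \<Rightarrow> nat \<Rightarrow> 'b list \<Rightarrow> 'b list list" where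
  "chunks b K u = map (\<lambda>i. take b (drop (i * b) u)) [0..<K]"

lemma chunks_Suc: "chunks b (Suc K) u = take b u # chunks b K (drop b u)"
  by (simp add: chunks_def upt_conv_Cons add.commute del: upt_Suc flip: map_Suc_upt)

lemma map_chunks_replicate:
  assumes "K * b \<le> m"
  shows "map_pmf (\<lambda>u. map g (chunks b K u)) (replicate_pmf m p) = replicate_pmf K (map_pmf g (replicate_pmf b p))"
  using assms
proof (induction K arbitrary: m)
  case 0
  then show ?case by (simp add: chunks_def map_pmf_const)
next
  case (Suc K)
  obtain m' where m: "m = b + m'" using le_Suc_ex[of b m] Suc.prems by auto
  have "map_pmf (\<lambda>u. map g (chunks b (Suc K) u)) (replicate_pmf m p)
    = bind_pmf (replicate_pmf b p) (\<lambda>v. bind_pmf (replicate_pmf m' p) (\<lambda>w. return_pmf (g v # map g (chunks b K w))))"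
    unfolding m map_pmf_def bind_replicate_add
    by (intro bind_pmf_cong refl) (auto simp: chunks_Suc dest!: length_replicate_pmf)
  also have "\<dots> = bind_pmf (map_pmf g (replicate_pmf b p)) (\<lambda>x. bind_pmf
      (map_pmf (\<lambda>u. map g (chunks b K u)) (replicate_pmf m' p)) (\<lambda>xs. return_pmf (x # xs)))"
    by (simp add: bind_map_pmf)
  also have "\<dots> = replicate_pmf (Suc K) (map_pmf g (replicate_pmf b p))"
    using Suc.IH[of m'] Suc.prems m by simp
  finally show ?case .
qed

text \<open>Unlike \<open>differ_in_one\<close> this admits equality: the changed example may lie in
  no block, or leave the output of its block unchanged.\<close>

definition near :: "'b list \<Rightarrow> 'b list \<Rightarrow> bool" where
  "near u v \<longleftrightarrow> length u = length v \<and> (\<exists>p. \<forall>i<length u. i \<noteq> p \<longrightarrow> u ! i = v ! i)"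

lemma differ_in_one_near: "differ_in_one S T \<Longrightarrow> near S T"
proof -
  assume a: "differ_in_one S T"
  then obtain p where "{i. i < length S \<and> S ! i \<noteq> T ! i} = {p}"
    by (auto simp: differ_in_one_def card_1_singleton_iff)
  then show ?thesis using a unfolding near_def differ_in_one_def by (auto intro!: exI[of _ p])
qed

lemma near_sym: "near u v \<Longrightarrow> near v u"
  unfolding near_def by metis

lemma near_zip:
  assumes "near S T"
  shows "near (zip S R) (zip T R)"
proof -
  obtain p where "length S = length T" "\<forall>i<length S. i \<noteq> p \<longrightarrow> S ! i = T ! i"
    using assms unfolding near_def by blast
  then show ?thesis unfolding near_def by (intro conjI exI[of _ p]) simp_all
qed

lemma near_map_chunks:
  assumes "near u v"
  shows "near (map g (chunks b K u)) (map g (chunks b K v))"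
proof -
  obtain p where p: "length u = length v" "\<And>i. i < length u \<Longrightarrow> i \<noteq> p \<Longrightarrow> u ! i = v ! i"
    using assms unfolding near_def by blast
  have "take b (drop (i * b) u) = take b (drop (i * b) v)" if i: "i \<noteq> p div b" for i
  proof (rule nth_equalityI)
    fix j assume j: "j < length (take b (drop (i * b) u))"
    have "i * b + j \<noteq> p"
    proof
      assume "i * b + j = p"
      then have "p div b = i" using j by (auto simp: div_mult_self3)
      then show False using i by simp
    qed
    then show "take b (drop (i * b) u) ! j = take b (drop (i * b) v) ! j"
    proof -
      have "i * b \<le> length u" "i * b \<le> length v" "i * b + j < length u" "j < b" using p(1) j by auto
      then show ?thesis using p(2)[of "i * b + j"] \<open>i * b + j \<noteq> p\<close> by simp
    qed
  qed (use p in simp)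
  then show ?thesis unfolding near_def by (auto simp: chunks_def intro!: exI[of _ "p div b"])
qed

lemma map_zip_replicate:
  "bind_pmf (replicate_pmf m D) (\<lambda>S. map_pmf (\<lambda>R. f (zip S R)) (replicate_pmf m E))
    = map_pmf f (replicate_pmf m (pair_pmf D E))"
proof (induction m arbitrary: f)
  case 0 then show ?case by (simp add: bind_return_pmf)
next
  case (Suc m)
  have "bind_pmf (replicate_pmf (Suc m) D) (\<lambda>S. map_pmf (\<lambda>R. f (zip S R)) (replicate_pmf (Suc m) E))
    = bind_pmf D (\<lambda>x. bind_pmf (replicate_pmf m D) (\<lambda>S. bind_pmf E (\<lambda>r.
        map_pmf (\<lambda>R. f ((x, r) # zip S R)) (replicate_pmf m E))))"
    by (simp add: map_bind_pmf bind_assoc_pmf bind_return_pmf map_pmf_def)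
  also have "\<dots> = bind_pmf D (\<lambda>x. bind_pmf E (\<lambda>r. bind_pmf (replicate_pmf m D) (\<lambda>S.
        map_pmf (\<lambda>R. f ((x, r) # zip S R)) (replicate_pmf m E))))"
    by (intro bind_pmf_cong refl bind_commute_pmf)
  also have "\<dots> = bind_pmf D (\<lambda>x. bind_pmf E (\<lambda>r. map_pmf (\<lambda>u. f ((x, r) # u)) (replicate_pmf m (pair_pmf D E))))"
    using Suc.IH[of "\<lambda>u. f ((_, _) # u)"] by simp
  also have "\<dots> = map_pmf f (replicate_pmf (Suc m) (pair_pmf D E))"
    by (simp add: pair_pmf_def map_bind_pmf bind_assoc_pmf bind_return_pmf map_pmf_def)
  finally show ?case .
qed

section \<open>Private voting\<close>

text \<open>An exponential mechanism in base 2. Subtracting 1 gives weight 0 to hypotheses without a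
  vote, so that infinitely many hypotheses still have a finite total weight.\<close>

definition vote_weight :: "nat \<Rightarrow> 'h option list \<Rightarrow> 'h option \<Rightarrow> nat" where
  "vote_weight t hs r = (if r = None then 2 ^ t else 2 ^ count_list hs r - 1)"

definition candidates :: "'h option list \<Rightarrow> 'h option set" where
  "candidates hs = insert None (set hs)"

text \<open>The option \<open>None\<close> always has weight \<open>2 ^ t\<close>; it makes the appearance or disappearance of
  a candidate with a single vote almost invisible.\<close>

definition vote :: "nat \<Rightarrow> 'h option list \<Rightarrow> 'h option pmf" where
  "vote t hs = map_pmf fst (pmf_of_set (SIGMA r:candidates hs. {..<vote_weight t hs r}))"

lemma finite_candidates [simp]: "finite (candidates hs)"
  by (simp add: candidates_def)

lemma prob_vote:
  assumes "finite F" "candidates hs \<subseteq> F"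
  shows "measure_pmf.prob (vote t hs) E =
    real (\<Sum>r\<in>F \<inter> E. vote_weight t hs r) / real (\<Sum>r\<in>F. vote_weight t hs r)"
proof -
  let ?U = "\<lambda>F. SIGMA r:F. {..<vote_weight t hs r}"
  have zero: "vote_weight t hs r = 0" if "r \<notin> candidates hs" for r
    using that by (auto simp: vote_weight_def candidates_def)
  have "(None, 0) \<in> ?U (candidates hs)" by (simp add: candidates_def vote_weight_def)
  then have ne: "?U (candidates hs) \<noteq> {}" by blast
  have "?U (candidates hs) \<inter> fst -` E = ?U (candidates hs \<inter> E)" by auto
  moreover have "card (?U (candidates hs \<inter> G)) = (\<Sum>r\<in>F \<inter> G. vote_weight t hs r)" for G
  proof -
    have "card (?U (candidates hs \<inter> G)) = (\<Sum>r\<in>candidates hs \<inter> G. vote_weight t hs r)"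
      by (subst card_SigmaI) auto
    also have "\<dots> = (\<Sum>r\<in>F \<inter> G. vote_weight t hs r)"
      using assms by (intro sum.mono_neutral_left) (auto intro!: zero)
    finally show ?thesis .
  qed
  from this[of E] this[of UNIV]
  have "card (?U (candidates hs \<inter> E)) = (\<Sum>r\<in>F \<inter> E. vote_weight t hs r)"
    "card (?U (candidates hs)) = (\<Sum>r\<in>F. vote_weight t hs r)" by simp_all
  ultimately show ?thesis
    unfolding vote_def using ne by (simp add: measure_pmf_of_set)
qed

lemma count_list_card: "count_list hs r = card {i. i < length hs \<and> hs ! i = r}"
  by (simp add: count_list_eq_length_filter length_filter_conv_card eq_commute)

text \<open>One ballot adds at most one vote, and only to a single \<open>s\<close>; there
  \<open>2 ^ (c + 1) - 1 = 2 * (2 ^ c - 1) + 1\<close>, whence the surplus 1.\<close>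

lemma vote_weight_near:
  assumes "near hs hs'"
  shows "\<exists>s. \<forall>r. vote_weight t hs r \<le> 2 * vote_weight t hs' r + (if r = s then 1 else 0)"
proof -
  obtain p where p: "length hs = length hs'" "\<And>i. i < length hs \<Longrightarrow> i \<noteq> p \<Longrightarrow> hs' ! i = hs ! i"
    using assms unfolding near_def by metis
  have le: "count_list hs r \<le> count_list hs' r + (if r = hs ! p then 1 else 0)" for r
  proof -
    have "{i. i < length hs \<and> hs ! i = r} \<subseteq> {i. i < length hs' \<and> hs' ! i = r} \<union> (if r = hs ! p then {p} else {})"
      using p by (auto split: if_splits)
    then have "count_list hs r \<le> card ({i. i < length hs' \<and> hs' ! i = r} \<union> (if r = hs ! p then {p} else {}))"
      unfolding count_list_card by (intro card_mono) auto
    also have "\<dots> \<le> count_list hs' r + card (if r = hs ! p then {p} else {})"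
      unfolding count_list_card by (rule card_Un_le)
    finally show ?thesis by (auto split: if_splits)
  qed
  have "vote_weight t hs r \<le> 2 * vote_weight t hs' r + (if r = hs ! p then 1 else 0)" for r
  proof (cases "r = None")
    case False
    let ?c = "count_list hs' r"
    have one: "(1::nat) \<le> 2 ^ ?c" by simp
    have pow: "(2::nat) ^ count_list hs r \<le> (if r = hs ! p then 2 * 2 ^ ?c else 2 ^ ?c)"
    proof (cases "r = hs ! p")
      case True
      then have "(2::nat) ^ count_list hs r \<le> 2 ^ Suc ?c"
        using le[of r] by (intro power_increasing) auto
      then show ?thesis unfolding power_Suc if_P[OF True] .
    next
      case False
      then show ?thesis using le[of r] by simp
    qed
    have w: "vote_weight t hs r = 2 ^ count_list hs r - 1" "vote_weight t hs' r = 2 ^ ?c - 1"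
      by (simp_all only: vote_weight_def False if_False)
    have "a - 1 \<le> 2 * (b - 1) + (if P then 1 else 0)"
      if "1 \<le> b" "a \<le> (if P then 2 * b else b)" for a b :: nat and P
      using that by (cases P) auto
    then show ?thesis unfolding w using one pow .
  qed (simp add: vote_weight_def)
  then show ?thesis by blast
qed

text \<open>The weight of the event and the normalizer each contribute a factor 2; the surplus 1 in
  the weight of the event is divided by a total of at least \<open>2 ^ t\<close>.\<close>

lemma vote_dp:
  assumes "near hs hs'"
  shows "measure_pmf.prob (vote t hs) E \<le> 4 * measure_pmf.prob (vote t hs') E + 1 / 2 ^ t"
proof -
  define F where "F = candidates hs \<union> candidates hs'"
  have F: "finite F" "candidates hs \<subseteq> F" "candidates hs' \<subseteq> F" "None \<in> F"
    by (auto simp: F_def candidates_def)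
  have sum: "(\<Sum>r\<in>G. vote_weight t u r) \<le> 2 * (\<Sum>r\<in>G. vote_weight t v r) + 1"
    if uv: "near u v" "finite G" for G and u v :: "'a option list"
  proof -
    obtain s where s: "\<And>r. vote_weight t u r \<le> 2 * vote_weight t v r + (if r = s then 1 else 0)"
      using vote_weight_near[OF uv(1)] by blast
    have "(\<Sum>r\<in>G. vote_weight t u r) \<le> (\<Sum>r\<in>G. 2 * vote_weight t v r + (if r = s then 1 else 0))"
      by (intro sum_mono s)
    also have "\<dots> \<le> 2 * (\<Sum>r\<in>G. vote_weight t v r) + 1"
      using uv(2) by (simp add: sum.distrib sum_distrib_left)
    finally show ?thesis .
  qed
  define W Z W' Z' where "W = real (\<Sum>r\<in>F \<inter> E. vote_weight t hs r)" and "Z = real (\<Sum>r\<in>F. vote_weight t hs r)"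
    and "W' = real (\<Sum>r\<in>F \<inter> E. vote_weight t hs' r)" and "Z' = real (\<Sum>r\<in>F. vote_weight t hs' r)"
  have None: "(\<Sum>r\<in>F. vote_weight t u r) = 2 ^ t + (\<Sum>r\<in>F - {None}. vote_weight t u r)" for u
    using F by (subst sum.remove[of F None]) (auto simp: vote_weight_def)
  have "W \<le> 2 * W' + 1"
    using sum[OF assms finite_Int[of F E]] F(1) unfolding W_def W'_def by linarith
  moreover have Z: "2 ^ t \<le> Z"
    unfolding Z_def None by (simp add: sum_nonneg)
  moreover have "Z' \<le> 2 * Z"
  proof -
    have s: "(\<Sum>r\<in>F - {None}. vote_weight t hs' r) \<le> 2 * (\<Sum>r\<in>F - {None}. vote_weight t hs r) + 1"
      using sum[OF near_sym[OF assms], of "F - {None}"] F(1) by simp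
    \<comment> \<open>The weight of \<open>None\<close>, the same for both lists, absorbs the
      surplus 1 in the normalizer.\<close>
    have "a + b \<le> 2 * (a + c)" if "b \<le> 2 * c + 1" "1 \<le> a" for a b c :: nat
      using that by simp
    from this[OF s, of "2 ^ t"]
    have "(\<Sum>r\<in>F. vote_weight t hs' r) \<le> 2 * (\<Sum>r\<in>F. vote_weight t hs r)"
      unfolding None by simp
    then show ?thesis unfolding Z_def Z'_def by linarith
  qed
  moreover have "2 ^ t \<le> Z'" unfolding Z'_def None by (simp add: sum_nonneg)
  moreover have "0 \<le> W'" by (simp add: W'_def sum_nonneg)
  moreover have t: "(0::real) < 2 ^ t" by simp
  ultimately have pos: "0 < Z" "0 < Z'" by linarith+
  have "W / Z \<le> (2 * W' + 1) / Z" using \<open>W \<le> 2 * W' + 1\<close> pos by (intro divide_right_mono) auto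
  also have "\<dots> = 2 * W' / Z + 1 / Z" by (simp add: add_divide_distrib)
  also have "2 * W' / Z \<le> 4 * W' / Z'"
  proof -
    have "W' * Z' \<le> W' * (2 * Z)" using \<open>Z' \<le> 2 * Z\<close> \<open>0 \<le> W'\<close> by (rule mult_left_mono)
    then show ?thesis using pos by (simp add: field_simps)
  qed
  also have "1 / Z \<le> 1 / 2 ^ t" using Z t pos by (intro divide_left_mono) auto
  finally show ?thesis
    unfolding prob_vote[OF F(1,2)] prob_vote[OF F(1,3)] W_def W'_def Z_def Z'_def by simp
qed

text \<open>A bad hypothesis with one vote has weight 1, so all bad ones together weigh at most the
  number of ballots, while \<open>f\<close> contributes exponentially in its votes.\<close>

lemma vote_error:
  assumes "\<And>h. h \<in> Bad \<Longrightarrow> count_list hs (Some h) \<le> 1"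
  shows "measure_pmf.prob (vote t hs) (insert None (Some ` Bad)) \<le> (2 ^ t + real (length hs)) / 2 ^ count_list hs (Some f)"
proof -
  let ?F = "insert (Some f) (candidates hs)"
  let ?w = "vote_weight t hs"
  have F: "finite ?F" "candidates hs \<subseteq> ?F" by auto
  have None: "None \<in> ?F" by (simp add: candidates_def)
  have "(\<Sum>r\<in>?F \<inter> insert None (Some ` Bad). ?w r) \<le> 2 ^ t + length hs"
  proof -
    have "(\<Sum>r\<in>?F \<inter> insert None (Some ` Bad). ?w r) = 2 ^ t + (\<Sum>r\<in>?F \<inter> Some ` Bad. ?w r)"
    proof -
      have "?F \<inter> insert None (Some ` Bad) = insert None (?F \<inter> Some ` Bad)" using None by auto
      then show ?thesis using F(1) by (simp only:) (subst sum.insert, auto simp: vote_weight_def)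
    qed
    also have "(\<Sum>r\<in>?F \<inter> Some ` Bad. ?w r) = (\<Sum>r\<in>set hs \<inter> Some ` Bad. ?w r)"
      by (intro sum.mono_neutral_right) (auto simp: candidates_def vote_weight_def)
    also have "\<dots> \<le> (\<Sum>r\<in>set hs \<inter> Some ` Bad. 1)"
    proof (intro sum_mono)
      fix r assume "r \<in> set hs \<inter> Some ` Bad"
      then have r: "r \<noteq> None" "count_list hs r \<le> 1" using assms by auto
      then have "(2::nat) ^ count_list hs r \<le> 2 ^ 1" by (intro power_increasing) auto
      then show "?w r \<le> 1" unfolding vote_weight_def if_not_P[OF r(1)] by simp
    qed
    also have "\<dots> \<le> length hs"
      using card_mono[of "set hs" "set hs \<inter> Some ` Bad"] card_length[of hs] by simp
    finally show ?thesis by simp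
  qed
  then have num: "real (\<Sum>r\<in>?F \<inter> insert None (Some ` Bad). ?w r) \<le> 2 ^ t + real (length hs)"
    by (metis of_nat_add of_nat_le_iff of_nat_numeral of_nat_power)
  have "2 ^ count_list hs (Some f) \<le> (\<Sum>r\<in>{None, Some f}. ?w r)"
  proof -
    \<comment> \<open>The weight of \<open>None\<close> makes up for the 1 subtracted in the weight
      of \<open>Some f\<close>.\<close>
    have "b \<le> a + b - 1" if "1 \<le> a" for a b :: nat using that by linarith
    from this[of "2 ^ t" "2 ^ count_list hs (Some f)"] show ?thesis by (simp add: vote_weight_def)
  qed
  also have "\<dots> \<le> (\<Sum>r\<in>?F. ?w r)"
    using F(1) None by (intro sum_mono2) auto
  finally have den: "2 ^ count_list hs (Some f) \<le> real (\<Sum>r\<in>?F. ?w r)"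
    by (metis of_nat_le_iff of_nat_numeral of_nat_power)
  show ?thesis
    unfolding prob_vote[OF F] using num den by (intro frac_le) auto
qed

text \<open>\<open>Bad\<close> may be uncountable, so there is no union bound over it; instead a new
  collision means that the newest ballot repeats one of the at most \<open>K\<close> bad hypotheses
  already cast.\<close>

lemma prob_bad_collision:
  assumes bad: "\<And>h. h \<in> Bad \<Longrightarrow> pmf G (Some h) \<le> \<pi>" and "0 \<le> \<pi>"
  shows "measure_pmf.prob (replicate_pmf K G) {hs. \<exists>h\<in>Bad. 2 \<le> count_list hs (Some h)} \<le> (real K)\<^sup>2 * \<pi>"
proof (induction K)
  case (Suc K)
  let ?C = "{hs. \<exists>h\<in>Bad. 2 \<le> count_list hs (Some h)}"
  let ?R = "replicate_pmf K G"
  have "measure_pmf.prob (replicate_pmf (Suc K) G) ?C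
      = measure_pmf.expectation ?R (\<lambda>hs. measure_pmf.prob G {r. r # hs \<in> ?C})"
  proof -
    \<comment> \<open>The draws are exchanged so that the newest ballot is drawn after the others
      are fixed.\<close>
    have "replicate_pmf (Suc K) G = bind_pmf ?R (\<lambda>hs. map_pmf (\<lambda>r. r # hs) G)"
      by (simp add: map_pmf_def) (rule bind_commute_pmf)
    then show ?thesis by (simp only: prob_bind_pmf) (simp add: vimage_def)
  qed
  also have "\<dots> \<le> measure_pmf.expectation ?R (\<lambda>hs. indicator ?C hs + real K * \<pi>)"
  proof (rule expectation_mono_pmf[where B = 1 and C = "1 + real K * \<pi>"])
    fix hs assume "hs \<in> set_pmf ?R"
    then have len: "length hs = K" by (rule length_replicate_pmf)
    show "measure_pmf.prob G {r. r # hs \<in> ?C} \<le> indicator ?C hs + real K * \<pi>"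
    proof (cases "hs \<in> ?C")
      case True
      have "measure_pmf.prob G {r. r # hs \<in> ?C} \<le> 1" by simp
      then show ?thesis using True assms(2) by (simp add: add_increasing2)
    next
      case False
      have "{r. r # hs \<in> ?C} \<subseteq> set hs \<inter> Some ` Bad"
      proof
        fix r assume "r \<in> {r. r # hs \<in> ?C}"
        then obtain h where h: "h \<in> Bad" "2 \<le> count_list (r # hs) (Some h)" by blast
        moreover have "\<not> 2 \<le> count_list hs (Some h)" using False h(1) by blast
        ultimately have "r = Some h" "count_list hs (Some h) \<noteq> 0" by (auto split: if_splits)
        then show "r \<in> set hs \<inter> Some ` Bad" using h(1) by (simp add: count_list_0_iff)
      qed
      then have "measure_pmf.prob G {r. r # hs \<in> ?C} \<le> measure_pmf.prob G (set hs \<inter> Some ` Bad)"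
        by (intro measure_pmf.finite_measure_mono) auto
      also have "\<dots> = (\<Sum>r\<in>set hs \<inter> Some ` Bad. pmf G r)"
        by (simp add: measure_measure_pmf_finite)
      also have "\<dots> \<le> (\<Sum>r\<in>set hs \<inter> Some ` Bad. \<pi>)" by (intro sum_mono) (use bad in auto)
      also have "\<dots> \<le> real K * \<pi>"
      proof -
        have "card (set hs \<inter> Some ` Bad) \<le> K"
          using card_mono[of "set hs" "set hs \<inter> Some ` Bad"] card_length[of hs] len by simp
        then show ?thesis using assms(2) by (simp add: mult_right_mono)
      qed
      finally show ?thesis using False by simp
    qed
  next
    fix hs
    have "0 \<le> real K * \<pi>" using assms(2) by simp
    moreover have "0 \<le> indicat_real ?C hs \<and> indicat_real ?C hs \<le> 1" by (simp add: indicator_def)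
    ultimately show "\<bar>indicator ?C hs + real K * \<pi>\<bar> \<le> 1 + real K * \<pi>" by linarith
  qed simp
  also have "\<dots> = measure_pmf.prob ?R ?C + real K * \<pi>"
    by (subst Bochner_Integration.integral_add)
       (auto intro: integrable_pmf_bounded[of _ 1] simp: indicator_def)
  also have "\<dots> \<le> (real K)\<^sup>2 * \<pi> + real K * \<pi>" using Suc by simp
  also have "\<dots> \<le> (real (Suc K))\<^sup>2 * \<pi>"
    using assms(2) by (simp add: power2_eq_square algebra_simps)
  finally show ?case .
qed simp

text \<open>The generating function of the binomial vote count at 1/2. It averages the bound of
  \<open>vote_error\<close> directly, in place of a concentration inequality.\<close>

lemma expectation_half_count:
  "measure_pmf.expectation (replicate_pmf K G) (\<lambda>hs. 1 / 2 ^ count_list hs r) = (1 - pmf G r / 2) ^ K"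
proof (induction K)
  case (Suc K)
  have b: "\<bar>1 / 2 ^ count_list hs r\<bar> \<le> (1::real)" for hs by simp
  have "measure_pmf.expectation (replicate_pmf (Suc K) G) (\<lambda>hs. 1 / 2 ^ count_list hs r)
    = measure_pmf.expectation G (\<lambda>x. (1 - indicator {r} x / 2) * (1 - pmf G r / 2) ^ K)"
    unfolding expectation_replicate_Suc[OF b]
  proof (rule Bochner_Integration.integral_cong[OF refl])
    fix x
    have "(\<lambda>xs. 1 / 2 ^ count_list (x # xs) r) = (\<lambda>xs. (1 - indicator {r} x / 2) * (1 / 2 ^ count_list xs r :: real))"
      by (auto simp: indicator_def)
    then show "measure_pmf.expectation (replicate_pmf K G) (\<lambda>xs. 1 / 2 ^ count_list (x # xs) r)
      = (1 - indicator {r} x / 2) * (1 - pmf G r / 2) ^ K"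
      by (simp only: integral_mult_right_zero Suc)
  qed
  also have "\<dots> = measure_pmf.expectation G (\<lambda>x. 1 - indicator {r} x / 2) * (1 - pmf G r / 2) ^ K"
    by simp
  also have "measure_pmf.expectation G (\<lambda>x. 1 - indicator {r} x / 2) = 1 - pmf G r / 2"
    by (subst Bochner_Integration.integral_diff)
       (auto simp: measure_pmf_single intro!: integrable_divide integrable_pmf_bounded[of _ 1] split: split_indicator)
  finally show ?case by simp
qed simp

lemma vote_expected_error:
  assumes bad: "\<And>h. h \<in> Bad \<Longrightarrow> pmf G (Some h) \<le> \<pi>" and \<pi>: "0 \<le> \<pi>"
    and \<eta>: "\<eta> \<le> pmf G (Some f)" "0 < \<eta>"
  shows "measure_pmf.prob (bind_pmf (replicate_pmf K G) (vote t)) (insert None (Some ` Bad))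
    \<le> (real K)\<^sup>2 * \<pi> + (2 ^ t + real K) * (1 - \<eta> / 2) ^ K"
proof -
  let ?R = "replicate_pmf K G" and ?C = "{hs. \<exists>h\<in>Bad. 2 \<le> count_list hs (Some h)}"
  have "measure_pmf.prob (bind_pmf ?R (vote t)) (insert None (Some ` Bad))
    \<le> measure_pmf.expectation ?R (\<lambda>hs. indicator ?C hs + (2 ^ t + real K) * (1 / 2 ^ count_list hs (Some f)))"
    unfolding prob_bind_pmf
  proof (rule expectation_mono_pmf[where B = 1 and C = "1 + (2 ^ t + real K)"])
    fix hs assume "hs \<in> set_pmf ?R"
    then have len: "length hs = K" by (rule length_replicate_pmf)
    show "measure_pmf.prob (vote t hs) (insert None (Some ` Bad))
      \<le> indicator ?C hs + (2 ^ t + real K) * (1 / 2 ^ count_list hs (Some f))"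
    proof (cases "hs \<in> ?C")
      case True
      have "measure_pmf.prob (vote t hs) (insert None (Some ` Bad)) \<le> 1" by simp
      moreover have "0 \<le> (2 ^ t + real K) * (1 / 2 ^ count_list hs (Some f))" by simp
      moreover have "indicat_real ?C hs = 1" using True by (rule indicator_simps(1))
      ultimately show ?thesis by linarith
    next
      case False
      have "count_list hs (Some h) \<le> 1" if "h \<in> Bad" for h
      proof -
        have "\<not> 2 \<le> count_list hs (Some h)" using False that by blast
        then show ?thesis by simp
      qed
      then have "measure_pmf.prob (vote t hs) (insert None (Some ` Bad)) \<le> (2 ^ t + real (length hs)) / 2 ^ count_list hs (Some f)"
        by (rule vote_error)
      moreover have "indicat_real ?C hs = 0" using False by (rule indicator_simps(2))
      ultimately show ?thesis using len by simp
    qed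
  next
    fix hs
    have gen: "\<bar>i + x\<bar> \<le> 1 + y" if "x \<le> y * 1" "0 \<le> x" "0 \<le> i \<and> i \<le> 1" for i x y :: real
      using that by auto
    have "(2 ^ t + real K) * (1 / 2 ^ count_list hs (Some f)) \<le> (2 ^ t + real K) * 1"
      by (intro mult_left_mono) auto
    moreover have "0 \<le> (2 ^ t + real K) * (1 / 2 ^ count_list hs (Some f))" by simp
    moreover have "0 \<le> indicat_real ?C hs \<and> indicat_real ?C hs \<le> 1" by (simp add: indicator_def)
    ultimately show "\<bar>indicator ?C hs + (2 ^ t + real K) * (1 / 2 ^ count_list hs (Some f))\<bar> \<le> 1 + (2 ^ t + real K)"
      by (rule gen)
  qed simp
  also have "\<dots> = measure_pmf.prob ?R ?C + (2 ^ t + real K) * (1 - pmf G (Some f) / 2) ^ K"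
  proof -
    have "integrable (measure_pmf ?R) (indicat_real ?C)"
      by (rule integrable_pmf_bounded[of _ 1]) (simp add: indicator_def)
    moreover have "integrable (measure_pmf ?R) (\<lambda>hs. (2 ^ t + real K) * (1 / 2 ^ count_list hs (Some f)))"
      by (intro integrable_mult_right integrable_pmf_bounded[of _ 1]) simp
    ultimately show ?thesis
      by (subst Bochner_Integration.integral_add) (simp_all only: integral_mult_right_zero expectation_half_count, simp)
  qed
  also have "\<dots> \<le> (real K)\<^sup>2 * \<pi> + (2 ^ t + real K) * (1 - \<eta> / 2) ^ K"
    using prob_bad_collision[of Bad G \<pi> K, OF bad \<pi>] \<eta> pmf_le_1[of G "Some f"]
    by (intro add_mono mult_left_mono power_mono) auto
  finally show ?thesis .
qed

section \<open>The private learner\<close>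

text \<open>The fourth root leaves room for \<open>q^2\<close> blocks of \<open>q^2\<close>
  examples. As \<open>q\<close> is also the weight exponent of \<open>None\<close>, the factor
  \<open>2 ^ q\<close> in the error is beaten by a decay exponential in \<open>q^2\<close>.\<close>

definition rate :: "nat \<Rightarrow> nat" where
  "rate m = nat \<lfloor>real m powr (1 / 4)\<rfloor>"

lemma rate_bounds: "real (rate m) \<le> real m powr (1 / 4)" "real m powr (1 / 4) - 1 \<le> real (rate m)"
proof -
  have "real (rate m) = real_of_int \<lfloor>real m powr (1 / 4)\<rfloor>" by (simp add: rate_def)
  then show "real (rate m) \<le> real m powr (1 / 4)" "real m powr (1 / 4) - 1 \<le> real (rate m)"
    by linarith+
qed

lemma rate_le: "(rate m)\<^sup>2 * (rate m)\<^sup>2 \<le> m"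
proof -
  have "real (rate m) ^ 4 \<le> (real m powr (1 / 4)) ^ 4"
    using rate_bounds(1) by (intro power_mono) auto
  also have "\<dots> = real m" by (cases "m = 0") (simp_all add: powr_power)
  finally have "real ((rate m)\<^sup>2 * (rate m)\<^sup>2) \<le> real m"
    by (simp add: numeral_eq_Suc algebra_simps)
  then show ?thesis by (simp only: of_nat_le_iff)
qed

lemma rate_at_top: "filterlim rate at_top sequentially"
proof -
  have "filterlim (\<lambda>m::nat. real m powr (1 / 4) - 1) at_top sequentially" by real_asymp
  then have "filterlim (\<lambda>m. real (rate m)) at_top sequentially"
    by (rule filterlim_at_top_mono) (simp add: rate_bounds(2) always_eventually)
  then show ?thesis by (simp add: filterlim_sequentially_iff_filterlim_real)
qed

lemma superpoly_small_rate: "superpoly_small (\<lambda>m. 1 / 2 ^ rate m)"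
  unfolding superpoly_small_def
proof
  fix k :: real
  have "eventually (\<lambda>m::nat. 2 powr (1 - real m powr (1 / 4)) \<le> real m powr - k) sequentially"
    by real_asymp
  then show "eventually (\<lambda>m. 1 / 2 ^ rate m \<le> real m powr - k) sequentially"
  proof eventually_elim
    case (elim m)
    have "1 / 2 ^ rate m = 2 powr (- real (rate m))"
      by (simp add: powr_minus powr_realpow divide_simps)
    also have "\<dots> \<le> 2 powr (1 - real m powr (1 / 4))"
      using rate_bounds(2)[of m] by (intro powr_mono) auto
    finally show ?case using elim by linarith
  qed
qed

text \<open>The largest sample size for which the bound of \<open>tour_len_le\<close> at level
  \<open>d\<close> stays within a block of \<open>q^2\<close> examples.\<close>

definition block_samples :: "nat \<Rightarrow> nat \<Rightarrow> nat" where
  "block_samples d q = q\<^sup>2 div 2 ^ (d + 1) - 1"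

text \<open>The error analysis counts the default for \<open>None\<close> as a failure.\<close>

definition decode :: "('a \<Rightarrow> bool) option \<Rightarrow> 'a \<Rightarrow> bool" where
  "decode r = (case r of None \<Rightarrow> (\<lambda>_. False) | Some h \<Rightarrow> h)"

definition ballots :: "('a \<Rightarrow> bool) set \<Rightarrow> nat \<Rightarrow> nat \<Rightarrow> (('a \<times> bool) \<times> bool \<times> nat) list \<Rightarrow> ('a \<Rightarrow> bool) option list" where
  "ballots H d q u = map (block_hypothesis H (block_samples d q)) (chunks (q\<^sup>2) (q\<^sup>2) u)"

definition private_learner :: "('a \<Rightarrow> bool) set \<Rightarrow> nat \<Rightarrow> 'a dataset \<Rightarrow> ('a \<Rightarrow> bool) pmf" where
  "private_learner H d S = bind_pmf (replicate_pmf (length S) (extras d))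
     (\<lambda>R. map_pmf decode (vote (rate (length S)) (ballots H d (rate (length S)) (zip S R))))"

definition learner_measure :: "('a \<Rightarrow> bool) set \<Rightarrow> nat \<Rightarrow> 'a dataset \<Rightarrow> ('a \<Rightarrow> bool) measure" where
  "learner_measure H d S = distr (measure_pmf (private_learner H d S)) hyp_space (\<lambda>h. h)"

lemma measurable_into_hyp_space: "(\<lambda>h. h) \<in> measurable (measure_pmf p) hyp_space"
  by (simp add: space_hyp_space measurable_def)

lemma measure_learner_measure:
  "E \<in> sets hyp_space \<Longrightarrow> measure (learner_measure H d S) E = measure_pmf.prob (private_learner H d S) E"
  unfolding learner_measure_def by (subst measure_distr[OF measurable_into_hyp_space]) auto

text \<open>Holding for every \<open>E\<close>, this avoids a measurability proof for the set of
  hypotheses of large loss: off the sigma-algebra \<open>measure\<close> is 0.\<close>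

lemma measure_learner_measure_le:
  "measure (learner_measure H d S) E \<le> measure_pmf.prob (private_learner H d S) E"
proof (cases "E \<in> sets hyp_space")
  case False
  then have "E \<notin> sets (learner_measure H d S)" by (simp add: learner_measure_def)
  then show ?thesis by (simp add: measure_notin_sets)
qed (simp add: measure_learner_measure)

lemma randomized_learner_measure: "randomized_alg (learner_measure H d)"
  unfolding randomized_alg_def space_prob_algebra learner_measure_def
  by (auto intro: measure_pmf.prob_space_distr measurable_into_hyp_space)

text \<open>For fixed extras \<open>R\<close>, neighbouring datasets give neighbouring ballots, so
  \<open>vote_dp\<close> applies; averaging over \<open>R\<close> preserves its bound. The factor 4
  becomes \<open>exp (ln 4)\<close>.\<close>

lemma learner_measure_dp: "is_dp_on_size (learner_measure H d) m (ln 4) (1 / 2 ^ rate m)"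
  unfolding is_dp_on_size_def
proof (intro allI impI)
  fix S S' :: "'a dataset" and E assume S: "length S = m" "differ_in_one S S'" and E: "E \<in> sets (hyp_space :: ('a \<Rightarrow> bool) measure)"
  have S': "length S' = m" using S by (simp add: differ_in_one_def)
  let ?R = "replicate_pmf m (extras d)"
  let ?v = "\<lambda>S R. vote (rate m) (ballots H d (rate m) (zip S R))"
  let ?E = "decode -` E"
  have "measure (learner_measure H d S) E = measure_pmf.expectation ?R (\<lambda>R. measure_pmf.prob (?v S R) ?E)"
    by (simp add: measure_learner_measure[OF E] private_learner_def S prob_bind_pmf)
  also have "\<dots> \<le> measure_pmf.expectation ?R (\<lambda>R. 4 * measure_pmf.prob (?v S' R) ?E + 1 / 2 ^ rate m)"
  proof (rule expectation_mono_pmf[where B = 1 and C = 5])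
    fix R
    have "near (ballots H d (rate m) (zip S R)) (ballots H d (rate m) (zip S' R))"
      unfolding ballots_def by (intro near_map_chunks near_zip differ_in_one_near S(2))
    then show "measure_pmf.prob (?v S R) ?E \<le> 4 * measure_pmf.prob (?v S' R) ?E + 1 / 2 ^ rate m"
      by (rule vote_dp)
    have "1 / 2 ^ rate m \<le> (1::real)" "0 \<le> 1 / (2::real) ^ rate m" by simp_all
    moreover have "measure_pmf.prob (?v S' R) ?E \<le> 1" by simp
    ultimately show "\<bar>4 * measure_pmf.prob (?v S' R) ?E + 1 / 2 ^ rate m\<bar> \<le> 5"
      using measure_nonneg[of "?v S' R" ?E] by linarith
  qed simp
  also have "\<dots> = 4 * measure_pmf.expectation ?R (\<lambda>R. measure_pmf.prob (?v S' R) ?E) + 1 / 2 ^ rate m"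
    by (subst Bochner_Integration.integral_add) (auto intro!: integrable_pmf_bounded[of _ 4] order_trans[OF measure_pmf.prob_le_1])
  also have "measure_pmf.expectation ?R (\<lambda>R. measure_pmf.prob (?v S' R) ?E) = measure (learner_measure H d S') E"
    by (simp add: measure_learner_measure[OF E] private_learner_def S' prob_bind_pmf)
  finally show "measure (learner_measure H d S) E \<le> exp (ln 4) * measure (learner_measure H d S') E + 1 / 2 ^ rate m"
    by simp
qed

text \<open>The terms stand for two votes for one bad hypothesis, too few votes for the stable one,
  and a positive slack for the strict inequality in \<open>is_learner\<close>. The accuracy is
  \<open>1 / sqrt q\<close>, which is the source of the root in the exponent.\<close>

definition learner_error :: "nat \<Rightarrow> real \<Rightarrow> real \<Rightarrow> real" where
  "learner_error d \<eta> q = (q\<^sup>2)\<^sup>2 * exp (- ((q\<^sup>2 / 2 ^ (d + 1) - 2) / sqrt q))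
     + (2 powr q + q\<^sup>2) * exp (- (\<eta> / 2 * q\<^sup>2)) + 1 / (q + 1)"

lemma learner_error_tendsto:
  assumes "0 < \<eta>"
  shows "(learner_error d \<eta> \<longlongrightarrow> 0) at_top"
proof -
  define c :: real where "c = 1 / 2 ^ (d + 1)"
  have "0 < c" by (simp add: c_def)
  have "((\<lambda>q. (q\<^sup>2)\<^sup>2 * exp (- ((q\<^sup>2 * c - 2) / sqrt q))
     + (2 powr q + q\<^sup>2) * exp (- (\<eta> / 2 * q\<^sup>2)) + 1 / (q + 1)) \<longlongrightarrow> 0) at_top"
    using \<open>0 < c\<close> assms by real_asymp
  then show ?thesis unfolding learner_error_def[abs_def] c_def by simp
qed

lemma power_one_minus_le_exp:
  fixes x :: real
  assumes "0 \<le> x" "x \<le> 1"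
  shows "(1 - x) ^ n \<le> exp (- (x * real n))"
proof -
  have "(1 - x) ^ n \<le> exp (- x) ^ n"
    using assms exp_ge_add_one_self[of "- x"] by (intro power_mono) auto
  then show ?thesis by (simp add: exp_of_nat_mult[symmetric] mult.commute)
qed

lemma private_learner_dist:
  fixes m d :: nat and D :: "('a \<times> bool) pmf"
  defines "q \<equiv> rate m"
  shows "bind_pmf (replicate_pmf m D) (private_learner H d)
    = map_pmf decode (bind_pmf (replicate_pmf (q\<^sup>2) (block_dist H (block_samples d q) D d (q\<^sup>2))) (vote q))"
proof -
  have "bind_pmf (replicate_pmf m D) (private_learner H d)
    = bind_pmf (replicate_pmf m D) (\<lambda>S. bind_pmf (replicate_pmf m (extras d))
        (\<lambda>R. map_pmf decode (vote q (ballots H d q (zip S R)))))"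
    by (intro bind_pmf_cong refl) (simp add: private_learner_def q_def length_replicate_pmf)
  also have "\<dots> = bind_pmf (bind_pmf (replicate_pmf m D) (\<lambda>S. map_pmf (\<lambda>R. ballots H d q (zip S R))
        (replicate_pmf m (extras d)))) (\<lambda>hs. map_pmf decode (vote q hs))"
    by (simp add: bind_assoc_pmf bind_map_pmf)
  also have "\<dots> = bind_pmf (map_pmf (ballots H d q) (replicate_pmf m (pair_pmf D (extras d))))
      (\<lambda>hs. map_pmf decode (vote q hs))"
    by (simp only: map_zip_replicate)
  also have "map_pmf (ballots H d q) (replicate_pmf m (pair_pmf D (extras d)))
    = replicate_pmf (q\<^sup>2) (block_dist H (block_samples d q) D d (q\<^sup>2))"
    unfolding ballots_def[abs_def] block_dist_def
    by (rule map_chunks_replicate) (unfold q_def, rule rate_le)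
  finally show ?thesis by (simp add: map_bind_pmf)
qed

lemma learner_measure_error:
  fixes D :: "('a::countable \<times> bool) pmf"
  assumes d: "\<not> mistake_tree H UNIV d []" and D: "realizable_dist H D" and q: "2 ^ (d + 1) \<le> (rate m)\<^sup>2"
  shows "measure_pmf.expectation (replicate_pmf m D)
      (\<lambda>S. measure (learner_measure H d S) {h. loss D h > 1 / sqrt (real (rate m))})
    < learner_error d (stability d / (2 * (real d + 1))) (real (rate m))"
proof -
  define q where "q = rate m"
  define n where "n = block_samples d q"
  define \<alpha> where "\<alpha> = 1 / sqrt (real q)"
  define \<eta> where "\<eta> = stability d / (2 * (real d + 1))"
  define C :: nat where "C = 2 ^ (d + 1)"
  have \<eta>: "0 < \<eta>" "\<eta> \<le> 1"
  proof -
    show "0 < \<eta>" using stability_bounds[of d] by (simp add: \<eta>_def)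
    have "stability d \<le> 2 * (real d + 1)" using stability_bounds[of d] by simp
    then show "\<eta> \<le> 1" by (simp add: \<eta>_def)
  qed
  have C: "0 < C" "C \<le> q\<^sup>2" using q by (simp_all add: C_def q_def)
  then have q1: "1 \<le> q" by (cases "q = 0") auto
  have \<alpha>: "0 \<le> \<alpha>" "\<alpha> \<le> 1" using q1 by (simp_all add: \<alpha>_def)
  have n: "n + 1 = q\<^sup>2 div C"
    using C by (simp add: n_def block_samples_def C_def div_greater_zero_iff)
  have len: "tour_len n d + n + 1 \<le> q\<^sup>2"
  proof -
    have "tour_len n d + n + 1 \<le> C * (n + 1)" using tour_len_le[of n d] by (simp add: C_def)
    also have "\<dots> \<le> q\<^sup>2" unfolding n by simp
    finally show ?thesis .
  qed
  have nC: "real (q\<^sup>2) / real C - 2 \<le> real n"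
  proof -
    have "real (q\<^sup>2) / real C < real (q\<^sup>2 div C) + 1"
      using floor_divide_of_nat_eq[of "q\<^sup>2" C, where 'a = real] floor_correct[of "real (q\<^sup>2) / real C"]
      by simp
    then show ?thesis using n by linarith
  qed
  let ?G = "block_dist H n D d (q\<^sup>2)" and ?B = "{h. loss D h > \<alpha>}"
  obtain f where f: "\<eta> \<le> pmf ?G (Some f)"
    using block_dist_stable[OF len d D] by (auto simp: \<eta>_def)
  have "measure_pmf.expectation (replicate_pmf m D) (\<lambda>S. measure (learner_measure H d S) ?B)
    \<le> measure_pmf.expectation (replicate_pmf m D) (\<lambda>S. measure_pmf.prob (private_learner H d S) ?B)"
  proof (rule expectation_mono_pmf[where B = 1 and C = 1])
    fix S show "\<bar>measure (learner_measure H d S) ?B\<bar> \<le> 1"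
      using order_trans[OF measure_learner_measure_le measure_pmf.prob_le_1] by simp
  qed (use measure_learner_measure_le in auto)
  also have "\<dots> = measure_pmf.prob (bind_pmf (replicate_pmf m D) (private_learner H d)) ?B"
    by (simp add: prob_bind_pmf)
  also have "\<dots> = measure_pmf.prob (bind_pmf (replicate_pmf (q\<^sup>2) ?G) (vote q)) (decode -` ?B)"
    unfolding private_learner_dist q_def n_def by simp
  also have "\<dots> \<le> measure_pmf.prob (bind_pmf (replicate_pmf (q\<^sup>2) ?G) (vote q)) (insert None (Some ` ?B))"
  proof (intro measure_pmf.finite_measure_mono subsetI)
    fix r assume "r \<in> decode -` ?B"
    then show "r \<in> insert None (Some ` ?B)" by (cases r) (auto simp: decode_def)
  qed simp
  also have "\<dots> \<le> (real (q\<^sup>2))\<^sup>2 * (1 - \<alpha>) ^ n + (2 ^ q + real (q\<^sup>2)) * (1 - \<eta> / 2) ^ (q\<^sup>2)"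
    using block_dist_bad[OF len _ \<alpha>(1)] \<alpha> f \<eta> by (intro vote_expected_error) auto
  also have "\<dots> \<le> (real (q\<^sup>2))\<^sup>2 * exp (- (\<alpha> * real n)) + (2 ^ q + real (q\<^sup>2)) * exp (- (\<eta> / 2 * real (q\<^sup>2)))"
    using \<alpha> \<eta> by (intro add_mono mult_left_mono power_one_minus_le_exp) auto
  also have "\<dots> \<le> (real (q\<^sup>2))\<^sup>2 * exp (- ((real (q\<^sup>2) / real C - 2) / sqrt (real q)))
      + (2 ^ q + real (q\<^sup>2)) * exp (- (\<eta> / 2 * real (q\<^sup>2)))"
  proof (intro add_mono mult_left_mono order_refl)
    have "(real (q\<^sup>2) / real C - 2) / sqrt (real q) \<le> \<alpha> * real n"
      unfolding \<alpha>_def using nC q1 by (simp add: divide_right_mono)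
    then show "exp (- (\<alpha> * real n)) \<le> exp (- ((real (q\<^sup>2) / real C - 2) / sqrt (real q)))" by simp
  qed auto
  also have "\<dots> < learner_error d \<eta> (real q)"
    by (simp add: learner_error_def C_def powr_realpow)
  finally show ?thesis by (simp add: q_def \<alpha>_def \<eta>_def)
qed

lemma mistake_tree_bounded_imp_learnable:
  fixes H :: "('a::countable \<Rightarrow> bool) set"
  assumes d: "\<not> mistake_tree H UNIV d []"
  shows "approx_DP_PAC_learnable H"
proof -
  define \<eta> where "\<eta> = stability d / (2 * (real d + 1))"
  have \<eta>: "0 < \<eta>" using stability_bounds[of d] by (simp add: \<eta>_def)
  define \<alpha> where "\<alpha> m = 1 / sqrt (real (rate m))" for m
  \<comment> \<open>Where the blocks are too short for a tournament the value 2 exceeds every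
    probability; this concerns finitely many \<open>m\<close>.\<close>
  define \<beta> where "\<beta> m = (if 2 ^ (d + 1) \<le> (rate m)\<^sup>2 then learner_error d \<eta> (real (rate m)) else 2)" for m
  have lim: "filterlim (\<lambda>m. real (rate m)) at_top sequentially"
    using filterlim_compose[OF filterlim_real_sequentially rate_at_top] by simp
  have "((\<lambda>x::real. 1 / sqrt x) \<longlongrightarrow> 0) at_top" by real_asymp
  from filterlim_compose[OF this lim] have \<alpha>: "\<alpha> \<longlonglongrightarrow> 0" by (simp add: \<alpha>_def[abs_def])
  have "eventually (\<lambda>m. 2 ^ (d + 1) \<le> rate m) sequentially"
    using rate_at_top by (simp add: filterlim_at_top)
  then have ev: "eventually (\<lambda>m. learner_error d \<eta> (real (rate m)) = \<beta> m) sequentially"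
  proof eventually_elim
    case (elim m)
    then have "1 \<le> rate m" using one_le_power[of "2::nat" "d + 1"] by linarith
    then have "rate m \<le> (rate m)\<^sup>2" by (simp add: power2_eq_square)
    then show ?case using elim by (simp add: \<beta>_def)
  qed
  from filterlim_compose[OF learner_error_tendsto[OF \<eta>, of d] lim]
  have \<beta>: "\<beta> \<longlonglongrightarrow> 0" using ev by (rule Lim_transform_eventually)
  have "is_learner H (learner_measure H d) m (\<alpha> m) (\<beta> m)" for m
    unfolding is_learner_def
  proof (intro allI impI)
    fix D :: "('a \<times> bool) pmf" assume D: "realizable_dist H D"
    show "measure_pmf.expectation (replicate_pmf m D) (\<lambda>S. measure (learner_measure H d S) {h. loss D h > \<alpha> m}) < \<beta> m"
    proof (cases "2 ^ (d + 1) \<le> (rate m)\<^sup>2")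
      case True
      then show ?thesis using learner_measure_error[OF d D True] by (simp add: \<alpha>_def \<beta>_def \<eta>_def)
    next
      case False
      have "measure_pmf.expectation (replicate_pmf m D) (\<lambda>S. measure (learner_measure H d S) {h. loss D h > \<alpha> m}) \<le> 1"
        using run_le_1[OF randomized_learner_measure] by (simp add: run_def)
      moreover have "\<beta> m = 2" using False by (simp add: \<beta>_def)
      ultimately show ?thesis by linarith
    qed
  qed
  then show ?thesis
    unfolding approx_DP_PAC_learnable_def
    using \<alpha> \<beta> randomized_learner_measure superpoly_small_rate learner_measure_dp by blast
qed

theorem mainTheorem5:
  fixes H :: "('a::countable \<Rightarrow> bool) set"
  shows "approx_DP_PAC_learnable H \<longleftrightarrow> clique_dimension H < \<infinity>"
  unfolding clique_dimension_finite_iff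
  using learnable_imp_mistake_tree_bounded mistake_tree_bounded_imp_learnable by blast

end
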